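(* Let $\alpha\in\mathbb{R}_+^n$, $\beta\in\mathbb{R}_+^m$, $\gamma\in\mathbb{R}_+^k$. Suppose that the bounded linear operators $T:\mathcal{F}_\alpha\to\mathcal{F}_\beta$ and $S:\mathcal{F}_\beta\to\mathcal{F}_\gamma$ have the Lee--Yang property. Then so does $S\circ T:\mathcal{F}_\alpha\to\mathcal{F}_\gamma$. In particular, if the continuous linear functional $\phi:\mathcal{F}_\beta\to\mathbb{C}$ and the bounded linear operator $T:\mathcal{F}_\alpha\to\mathcal{F}_\beta$ have the Lee--Yang property, then $\phi\circ T:\mathcal{F}_\alpha\to\mathbb{C}$ has the Lee--Yang property.
   Context: Notation: $\mathbb{N}=\{0,1,2,\ldots\}$, $\mathbb{R}_+^n=(0,\infty)^n$, $z\cdot w=\sum_i z_iw_i$, $\eta!=\prod_i\eta_i!$, $z^\eta=\prod_i z_i^{\eta_i}$. For $\beta\in\mathbb{R}_+^n$, the $\beta$-weighted Bargmann--Fock space $\mathcal{F}_\beta$ is the Hilbert space of entire functions $f(z)=\sum_{\eta\in\mathbb{N}^n}a_\eta z^\eta$ on $\mathbb{C}^n$ with $\|f\|_\beta^2=\sum_\eta\frac{\eta!}{\beta^\eta}|a_\eta|^2<\infty$. $\mathscr{LY}_n(\mathbb{C})$ denotes the set of all entire functions in $n$ variables that are uniform limits on compact subsets of $\mathbb{C}^n$ of polynomials that are nonvanishing whenever all variables are in the open right half-plane $\{\zeta\in\mathbb{C}:\operatorname{Re}\zeta>0\}$. For $\alpha\in\mathbb{R}_+^n$, $\beta\in\mathbb{R}_+^m$,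 a bounded linear operator $T:\mathcal{F}_\alpha\to\mathcal{F}_\beta$ has the Lee--Yang property if its symbol $G_T(z,w)=T(e^{z\cdot w})=\sum_{\eta\in\mathbb{N}^n}T(z^\eta)\frac{w^\eta}{\eta!}$ (where $T$ acts on the $z$-variables, the result being a function of $z\in\mathbb{C}^m$, $w\in\mathbb{C}^n$) belongs to $\mathscr{LY}_{n+m}(\mathbb{C})$. A continuous linear functional $\phi:\mathcal{F}_\beta\to\mathbb{C}$, $\beta\in\mathbb{R}_+^m$, has the Lee--Yang property if $w\mapsto\phi(e^{z\cdot w})$ defines an entire function in $\mathscr{LY}_m(\mathbb{C})$. *)

theory Defs
  imports "HOL-Analysis.Analysis"
begin

text \<open>
  Points of $n$-dimensional complex space are vectors of type \<open>complex ^ 'n\<close>, multi-indices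
  are functions \<open>'n \<Rightarrow> nat\<close>. The variables of a function of \<open>n + m\<close> variables are indexed by
  the sum of the two index types.
\<close>

definition mindex_fact :: "('n::finite \<Rightarrow> nat) \<Rightarrow> real" where
  "mindex_fact \<eta> = (\<Prod>i\<in>UNIV. fact (\<eta> i))"

definition mindex_power :: "('a::comm_monoid_mult) ^ ('n::finite) \<Rightarrow> ('n \<Rightarrow> nat) \<Rightarrow> 'a" where
  "mindex_power z \<eta> = (\<Prod>i\<in>UNIV. (z $ i) ^ \<eta> i)"

text \<open>The bilinear pairing of two complex vectors: there is no complex conjugation, so this is
  not \<^const>\<open>inner\<close>.\<close>

definition dotc :: "complex ^ ('n::finite) \<Rightarrow> complex ^ 'n \<Rightarrow> complex" where
  "dotc z w = (\<Sum>i\<in>UNIV. z $ i * w $ i)"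

definition has_power_series ::
  "(complex ^ ('n::finite) \<Rightarrow> complex) \<Rightarrow> (('n \<Rightarrow> nat) \<Rightarrow> complex) \<Rightarrow> bool" where
  "has_power_series f a \<longleftrightarrow> (\<forall>z. ((\<lambda>\<eta>. a \<eta> * mindex_power z \<eta>) has_sum f z) UNIV)"

definition entire :: "(complex ^ ('n::finite) \<Rightarrow> complex) \<Rightarrow> bool" where
  "entire f \<longleftrightarrow> (\<exists>a. has_power_series f a)"

text \<open>Meaningful for entire functions only; their power series is unique.\<close>

definition power_series_coeff ::
  "(complex ^ ('n::finite) \<Rightarrow> complex) \<Rightarrow> ('n \<Rightarrow> nat) \<Rightarrow> complex" where
  "power_series_coeff f = (THE a. has_power_series f a)"

definition fock_term ::
  "real ^ ('n::finite) \<Rightarrow> (complex ^ 'n \<Rightarrow> complex) \<Rightarrow> ('n \<Rightarrow> nat) \<Rightarrow> real" where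
  "fock_term \<beta> f \<eta> =
     mindex_fact \<eta> / mindex_power \<beta> \<eta> * (cmod (power_series_coeff f \<eta>))\<^sup>2"

definition fock_space :: "real ^ ('n::finite) \<Rightarrow> (complex ^ 'n \<Rightarrow> complex) set" where
  "fock_space \<beta> = {f. entire f \<and> fock_term \<beta> f summable_on UNIV}"

definition fock_norm :: "real ^ ('n::finite) \<Rightarrow> (complex ^ 'n \<Rightarrow> complex) \<Rightarrow> real" where
  "fock_norm \<beta> f = sqrt (\<Sum>\<^sub>\<infinity>\<eta>. fock_term \<beta> f \<eta>)"

definition polynomial_fun :: "(complex ^ ('n::finite) \<Rightarrow> complex) \<Rightarrow> bool" where
  "polynomial_fun p \<longleftrightarrow>
     (\<exists>A c. finite A \<and> p = (\<lambda>z. \<Sum>\<eta>\<in>A. c \<eta> * mindex_power z \<eta>))"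

text \<open>The limit itself may have zeros in the half-plane; in particular, the zero function is a
  member.\<close>

definition LY :: "(complex ^ ('n::finite) \<Rightarrow> complex) set" where
  "LY = {f. entire f \<and>
     (\<exists>p :: nat \<Rightarrow> complex ^ 'n \<Rightarrow> complex.
        (\<forall>j. polynomial_fun (p j) \<and> (\<forall>z. (\<forall>i. Re (z $ i) > 0) \<longrightarrow> p j z \<noteq> 0)) \<and>
        (\<forall>K. compact K \<longrightarrow> uniform_limit K p f sequentially))}"

text \<open>An operator between Fock spaces is a total function on functions; its values outside the
  domain space are irrelevant, so all conditions are relative to the space.\<close>

definition fock_bounded_linear ::
  "real ^ ('n::finite) \<Rightarrow> real ^ ('m::finite) \<Rightarrow>
     ((complex ^ 'n \<Rightarrow> complex) \<Rightarrow> (complex ^ 'm \<Rightarrow> complex)) \<Rightarrow> bool" where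
  "fock_bounded_linear \<alpha> \<beta> T \<longleftrightarrow>
     (\<forall>f\<in>fock_space \<alpha>. T f \<in> fock_space \<beta>) \<and>
     (\<forall>f\<in>fock_space \<alpha>. \<forall>g\<in>fock_space \<alpha>. T (\<lambda>z. f z + g z) = (\<lambda>z. T f z + T g z)) \<and>
     (\<forall>c. \<forall>f\<in>fock_space \<alpha>. T (\<lambda>z. c * f z) = (\<lambda>z. c * T f z)) \<and>
     (\<exists>C. \<forall>f\<in>fock_space \<alpha>. fock_norm \<beta> (T f) \<le> C * fock_norm \<alpha> f)"

definition fock_continuous_functional ::
  "real ^ ('m::finite) \<Rightarrow> ((complex ^ 'm \<Rightarrow> complex) \<Rightarrow> complex) \<Rightarrow> bool" where
  "fock_continuous_functional \<beta> \<phi> \<longleftrightarrow>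
     (\<forall>f\<in>fock_space \<beta>. \<forall>g\<in>fock_space \<beta>. \<phi> (\<lambda>z. f z + g z) = \<phi> f + \<phi> g) \<and>
     (\<forall>c. \<forall>f\<in>fock_space \<beta>. \<phi> (\<lambda>z. c * f z) = c * \<phi> f) \<and>
     (\<forall>f\<in>fock_space \<beta>. \<forall>\<epsilon>>0. \<exists>\<delta>>0. \<forall>g\<in>fock_space \<beta>.
        fock_norm \<beta> (\<lambda>z. g z - f z) < \<delta> \<longrightarrow> cmod (\<phi> g - \<phi> f) < \<epsilon>)"

text \<open>The symbol $G_T(z,w) = T(e^{z \cdot w})$, with \<open>z\<close> the left and \<open>w\<close> the right block of
  variables.\<close>

definition symbol ::
  "((complex ^ ('n::finite) \<Rightarrow> complex) \<Rightarrow> (complex ^ ('m::finite) \<Rightarrow> complex)) \<Rightarrow>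
     complex ^ ('m + 'n) \<Rightarrow> complex" where
  "symbol T v = T (\<lambda>u. exp (dotc u (\<chi> i. v $ Inr i))) (\<chi> j. v $ Inl j)"

definition lee_yang_operator ::
  "real ^ ('n::finite) \<Rightarrow> real ^ ('m::finite) \<Rightarrow>
     ((complex ^ 'n \<Rightarrow> complex) \<Rightarrow> (complex ^ 'm \<Rightarrow> complex)) \<Rightarrow> bool" where
  "lee_yang_operator \<alpha> \<beta> T \<longleftrightarrow> fock_bounded_linear \<alpha> \<beta> T \<and> symbol T \<in> LY"

definition lee_yang_functional ::
  "real ^ ('m::finite) \<Rightarrow> ((complex ^ 'm \<Rightarrow> complex) \<Rightarrow> complex) \<Rightarrow> bool" where
  "lee_yang_functional \<beta> \<phi> \<longleftrightarrow>
     fock_continuous_functional \<beta> \<phi> \<and> (\<lambda>w. \<phi> (\<lambda>z. exp (dotc z w))) \<in> LY"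

end

theory Submission
  imports
    Defs
    "HOL-Complex_Analysis.Great_Picard"
    "HOL-Real_Asymp.Real_Asymp"
    "HOL-Computational_Algebra.Fundamental_Theorem_Algebra"
begin

text \<open>
  Writing $s_{\kappa\eta}$ and $t_{\eta\xi}$ for the power series coefficients of the symbols of
  \<open>S\<close> and \<open>T\<close>, the symbol of \<open>S \<circ> T\<close> has the coefficients
  $\sum_\eta \eta!\, s_{\kappa\eta} t_{\eta\xi}$: the middle block of variables is contracted by
  substituting derivatives for one copy. For polynomials, the Lieb--Sokal lemma says that this
  contraction preserves the absence of zeros in the right half-plane. Approximating polynomials of
  the symbols converge only locally uniformly, which does not control the contraction, so they are
  first truncated to exponents at most \<open>N\<close> by the zero-preserving multiplier
  $k \mapsto \prod_{l<k} (1 - l/N)$. Its values lie in $[0,1]$ and tend to \<open>1\<close>, and the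
  coefficient sums are dominated by Cauchy--Schwarz and boundedness of \<open>S\<close> and \<open>T\<close>, so the
  truncation can be removed in the limit.
\<close>

section \<open>Polynomials without zeros in a half-plane\<close>

text \<open>The contraction sums infinitely many coefficients against the growing factor \<eta>!,
  whereas the approximants give convergence of each single coefficient. Once the exponents are cut
  at N, a contracted coefficient is a finite sum and coefficientwise convergence suffices; N is sent
  to infinity only after the approximants. Two boundary effects shape the estimates. Contracting
  ends with an evaluation at 0, on the edge of the half-plane, so a shift \<delta> > 0 is added both
  to the derivative and to the point of evaluation. Truncation is derived from the same contraction
  lemma without a shift, so it needs polynomials that are zero-free on a slightly larger half-plane;
  translating the approximants supplies them. The multiplier is the one that turns the exponential
  series into (1 + x / N)^N. The composed symbol itself is never shown to be zero-free: the class
  contains the zero function, so only the approximants have to be.\<close>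

lemma cauchy_schwarz_weighted:
  fixes s t n :: real
  assumes "n > 0"
  shows "(s + t)\<^sup>2 \<le> (n + 1) * (s\<^sup>2 + t\<^sup>2 / n)"
proof -
  have "(n + 1) * (s\<^sup>2 + t\<^sup>2 / n) - (s + t)\<^sup>2 = (n * s - t)\<^sup>2 / n"
    using assms by (simp add: field_simps power2_eq_square)
  thus ?thesis
    using assms by (smt (verit) divide_nonneg_pos zero_le_power2)
qed

text \<open>The value p'(x) / p(x) is the sum of 1 / (x - \<rho>) over the roots, and each summand u
  lies in the disc (Re x - c) |u|^2 \<le> Re u because Re \<rho> \<le> c. Discs are convex, so the
  mean of the summands lies there too, which is the claim after multiplication by the square of the
  degree. The induction splits off one root at a time.\<close>

lemma log_deriv_half_plane:
  fixes p :: "complex poly" and c :: real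
  assumes "\<And>z. Re z > c \<Longrightarrow> poly p z \<noteq> 0" and "Re x > c"
  shows "(Re x - c) * (cmod (poly (pderiv p) x / poly p x))\<^sup>2
           \<le> degree p * Re (poly (pderiv p) x / poly p x)"
  using assms(1)
proof (induction "degree p" arbitrary: p)
  case 0
  hence "pderiv p = 0"
    by (metis pderiv_eq_0_iff)
  thus ?case by simp
next
  case (Suc n)
  have "\<not> constant (poly p)"
    using Suc.hyps(2) by (simp add: constant_degree)
  then obtain \<rho> where "poly p \<rho> = 0"
    using fundamental_theorem_of_algebra by blast
  then obtain q where p: "p = [:-\<rho>, 1:] * q"
    by (metis dvdE poly_eq_0_iff_dvd)
  have "q \<noteq> 0"
    using Suc.hyps(2) p by auto
  hence dq: "degree q = n"
    using Suc.hyps(2) unfolding p by (subst (asm) degree_mult_eq) auto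
  have \<rho>: "Re \<rho> \<le> c"
    using Suc.prems \<open>poly p \<rho> = 0\<close> by force
  define u where "u = 1 / (x - \<rho>)"
  define v where "v = poly (pderiv q) x / poly q x"
  have nz: "x - \<rho> \<noteq> 0" "poly q x \<noteq> 0"
    using Suc.prems[OF assms(2)] by (auto simp: p)
  have "poly (pderiv p) x = poly q x + (x - \<rho>) * poly (pderiv q) x"
    unfolding p pderiv_mult by (simp add: pderiv_pCons algebra_simps)
  hence w: "poly (pderiv p) x / poly p x = u + v"
    using nz by (simp add: p u_def v_def field_simps)
  have "Re u = Re (x - \<rho>) * (cmod u)\<^sup>2"
    using nz by (simp add: u_def Re_divide cmod_power2 norm_divide power_divide)
  moreover have "(Re x - c) * (cmod u)\<^sup>2 \<le> Re (x - \<rho>) * (cmod u)\<^sup>2"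
    using \<rho> by (intro mult_right_mono) auto
  ultimately have u: "(Re x - c) * (cmod u)\<^sup>2 \<le> Re u" by simp
  have v: "(Re x - c) * (cmod v)\<^sup>2 \<le> n * Re v"
    unfolding v_def using Suc.hyps(1)[of q] dq Suc.prems p by auto
  show ?case
  proof (cases "n = 0")
    case True
    hence "v = 0"
      using dq unfolding v_def by (simp add: pderiv_eq_0_iff[THEN iffD2])
    thus ?thesis using u w Suc.hyps(2)[symmetric] True by simp
  next
    case False
    hence n: "real n > 0" by simp
    have "(cmod (u + v))\<^sup>2 \<le> (cmod u + cmod v)\<^sup>2"
      by (simp add: norm_triangle_ineq power_mono)
    \<comment> \<open>Cauchy--Schwarz for (1, sqrt n) and (|u|, |v| / sqrt n): one root is weighed
      against the n roots collected in \<open>v\<close>, so that the constant grows from n to n +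
      1.\<close>
    also have "\<dots> \<le> (real n + 1) * ((cmod u)\<^sup>2 + (cmod v)\<^sup>2 / real n)"
      by (rule cauchy_schwarz_weighted[OF n])
    finally have "(Re x - c) * (cmod (u + v))\<^sup>2 \<le>
        (Re x - c) * ((real n + 1) * ((cmod u)\<^sup>2 + (cmod v)\<^sup>2 / real n))"
      using assms(2) by (intro mult_left_mono) auto
    also have "\<dots> = (real n + 1) * ((Re x - c) * (cmod u)\<^sup>2 + ((Re x - c) * (cmod v)\<^sup>2) / real n)"
      by (simp add: algebra_simps)
    also have "\<dots> \<le> (real n + 1) * (Re u + (n * Re v) / real n)"
      using u v n by (intro mult_left_mono add_mono divide_right_mono) auto
    finally show ?thesis
      using n Suc.hyps(2)[symmetric] by (simp add: w add.commute)
  qed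
qed

text \<open>The disc of \<open>log_deriv_half_plane\<close> lies in the closed right half-plane.
  This form no longer mentions the degree, which suits the coefficient \<open>q\<close> in the
  contraction of degree one.\<close>

lemma Re_log_deriv_nonneg:
  fixes p :: "complex poly"
  assumes "\<And>z. Re z > c \<Longrightarrow> poly p z \<noteq> 0" and "Re x > c"
  shows "Re (poly (pderiv p) x / poly p x) \<ge> 0"
proof (cases "degree p = 0")
  case True
  hence "pderiv p = 0"
    by (metis pderiv_eq_0_iff)
  thus ?thesis by simp
next
  case False
  have "0 \<le> (Re x - c) * (cmod (poly (pderiv p) x / poly p x))\<^sup>2"
    using assms(2) by simp
  also have "\<dots> \<le> degree p * Re (poly (pderiv p) x / poly p x)"
    by (rule log_deriv_half_plane[OF assms])
  finally show ?thesis
    using False by (simp add: zero_le_mult_iff)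
qed

text \<open>Laguerre's theorem for a half-plane: the expression is the polarization of p in D
  variables with one argument y and the others x. A zero would give x - y = D p(x) / p'(x), and the
  disc estimate then forces Re y \<le> c. A value of D above the degree corresponds to roots at
  infinity and only weakens the estimate, since p' / p has nonnegative real part.\<close>

lemma polar_derivative_nonzero:
  fixes p :: "complex poly"
  assumes nz: "\<And>z. Re z > c \<Longrightarrow> poly p z \<noteq> 0" and x: "Re x > c" and y: "Re y > c"
    and deg: "degree p \<le> D" and D: "D > 0"
  shows "poly p x + (y - x) * poly (pderiv p) x / of_nat D \<noteq> 0"
proof
  assume eq: "poly p x + (y - x) * poly (pderiv p) x / of_nat D = 0"
  define w where "w = poly (pderiv p) x / poly p x"
  have "(x - y) * w = of_nat D"
    using eq nz[OF x] D by (simp add: w_def field_simps add_eq_0_iff)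
  hence w0: "w \<noteq> 0" and xy: "x - y = of_nat D / w"
    using D by (auto simp: eq_divide_eq)
  have "(Re x - c) * (cmod w)\<^sup>2 \<le> degree p * Re w"
    unfolding w_def by (rule log_deriv_half_plane[OF nz x])
  also have "\<dots> \<le> D * Re w"
    using deg Re_log_deriv_nonneg[OF nz x] by (intro mult_right_mono) (auto simp: w_def)
  also have "\<dots> = Re (x - y) * (cmod w)\<^sup>2"
    using w0 unfolding xy by (simp add: Re_divide cmod_power2)
  finally have "Re x - c \<le> Re (x - y)"
    using w0 by simp
  thus False using y by simp
qed

text \<open>Dividing by y and letting y grow along the real axis exhibits q as a locally uniform
  limit of zero-free polynomials, so Hurwitz applies. Constant q is excluded there and treated
  separately.\<close>

lemma leading_part_nonzero:
  fixes p q :: "complex poly"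
  assumes nz: "\<And>y z. Re y > a \<Longrightarrow> Re z > c \<Longrightarrow> poly p z + y * poly q z \<noteq> 0"
    and q: "q \<noteq> 0" and z: "Re z > c"
  shows "poly q z \<noteq> 0"
proof (cases "degree q = 0")
  case True
  thus ?thesis using q by (auto elim!: degree_eq_zeroE)
next
  case False
  define S where "S = {z. Re z > c}"
  \<comment> \<open>The offset \<bar>a\<bar> + 1 keeps every point inside Re y > a and away from 0,
    whatever the sign of a.\<close>
  define Y where "Y = (\<lambda>n::nat. complex_of_real (\<bar>a\<bar> + 1 + n))"
  have Y: "Re (Y n) > a" "Y n \<noteq> 0" for n
    using abs_ge_self[of a] by (auto simp: Y_def complex_eq_iff)
  show ?thesis
  proof (rule Hurwitz_no_zeros[of S "\<lambda>n z. poly p z / Y n + poly q z" "poly q" z])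
    show "open S" "connected S" unfolding S_def
      by (auto simp: open_halfspace_Re_gt convex_halfspace_Re_gt convex_connected)
    show "(\<lambda>z. poly p z / Y n + poly q z) holomorphic_on S" for n
      using Y by (intro holomorphic_intros) auto
    show "poly q holomorphic_on S" by (intro holomorphic_intros)
    show "uniform_limit K (\<lambda>n z. poly p z / Y n + poly q z) (poly q) sequentially"
      if K: "compact K" for K
    proof (rule uniform_limitI)
      fix e :: real assume e: "e > 0"
      have "compact (poly p ` K)"
        by (intro compact_continuous_image K continuous_intros)
      then obtain B where B: "\<And>z. z \<in> K \<Longrightarrow> norm (poly p z) \<le> B"
        by (meson bounded_iff compact_imp_bounded imageI)
      have "(\<lambda>n. \<bar>B\<bar> / (\<bar>a\<bar> + 1 + real n)) \<longlonglongrightarrow> 0" by real_asymp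
      hence "\<forall>\<^sub>F n in sequentially. \<bar>B\<bar> / (\<bar>a\<bar> + 1 + real n) < e"
        using e by (rule order_tendstoD)
      thus "\<forall>\<^sub>F n in sequentially. \<forall>z\<in>K. dist (poly p z / Y n + poly q z) (poly q z) < e"
      proof eventually_elim
        case (elim n)
        show ?case
        proof
          fix z assume "z \<in> K"
          have "dist (poly p z / Y n + poly q z) (poly q z) = norm (poly p z) / (\<bar>a\<bar> + 1 + real n)"
            by (simp add: dist_norm Y_def norm_divide del: of_real_add)
          also have "\<dots> \<le> \<bar>B\<bar> / (\<bar>a\<bar> + 1 + real n)"
            using B[OF \<open>z \<in> K\<close>] by (intro divide_right_mono) auto
          finally show "dist (poly p z / Y n + poly q z) (poly q z) < e" using elim by simp
        qed
      qed
    qed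
    show "\<not> poly q constant_on S"
    proof
      assume "poly q constant_on S"
      then obtain k where k: "\<And>z. z \<in> S \<Longrightarrow> poly q z = k"
        by (auto simp: constant_on_def)
      have "S \<subseteq> {z. poly (q - [:k:]) z = 0}" using k by auto
      moreover have "q - [:k:] \<noteq> 0"
        using False by auto
      ultimately have "finite S"
        using poly_roots_finite finite_subset by blast
      thus False
        using \<open>open S\<close> z not_open_singleton finite_imp_not_open[of S] by (auto simp: S_def)
    qed
    show "poly p z / Y n + poly q z \<noteq> 0" if "z \<in> S" for n z
    proof
      assume "poly p z / Y n + poly q z = 0"
      hence "poly p z + Y n * poly q z = 0"
        using Y(2)[of n] by (simp add: field_simps)
      thus False using nz[OF Y(1)] that by (auto simp: S_def)
    qed
    show "z \<in> S" using z by (simp add: S_def)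
  qed
qed

text \<open>This is the derivative conjugated by exp (\<delta> z). In the contraction lemmas only a
  + \<delta> > 0 is required, so strictness can come from a margin a (truncation, where \<delta> =
  0) or from the shift (pairing, where a = 0).\<close>

definition shifted_deriv :: "complex \<Rightarrow> complex poly \<Rightarrow> complex poly" where
  "shifted_deriv \<delta> q = pderiv q + smult \<delta> q"

text \<open>The Lieb--Sokal lemma for a variable of degree one.\<close>

lemma linear_contraction_nonzero:
  fixes p q :: "complex poly" and a c \<delta> :: real
  assumes nz: "\<And>y z. Re y > - a \<Longrightarrow> Re z > c \<Longrightarrow> poly p z + y * poly q z \<noteq> 0"
    and a: "a + \<delta> > 0" and z: "Re z > c"
  shows "poly (p + shifted_deriv \<delta> q) z \<noteq> 0"
proof (cases "q = 0")
  case True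
  thus ?thesis using nz[OF _ z, of "of_real (\<bar>a\<bar> + 1)"] by (simp add: shifted_deriv_def)
next
  case False
  have q: "poly q z \<noteq> 0" if "Re z > c" for z
    by (rule leading_part_nonzero[OF nz False that])
  define r where "r = poly p z / poly q z"
  \<comment> \<open>The value y = - r solves p(z) + y q(z) = 0, so it cannot lie in Re y > - a.
    After division by q(z) the contracted polynomial is r + q'(z) / q(z) + \<delta>, with real part
    at least a + \<delta>.\<close>
  have "Re r \<ge> a"
  proof (rule ccontr)
    assume "\<not> Re r \<ge> a"
    hence "Re (- r) > - a" by simp
    from nz[OF this z] show False
      using q[OF z] by (simp add: r_def)
  qed
  moreover have "Re (poly (pderiv q) z / poly q z) \<ge> 0"
    by (rule Re_log_deriv_nonneg[OF q z])
  ultimately have "Re (r + poly (pderiv q) z / poly q z + of_real \<delta>) > 0"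
    using a by simp
  moreover have "poly (p + shifted_deriv \<delta> q) z
      = (r + poly (pderiv q) z / poly q z + of_real \<delta>) * poly q z"
    using q[OF z] by (simp add: r_def shifted_deriv_def field_simps)
  ultimately show ?thesis
    using q[OF z] by (metis less_irrefl mult_eq_0_iff zero_complex.sel(1))
qed

lemma shifted_deriv_add: "shifted_deriv \<delta> (p + q) = shifted_deriv \<delta> p + shifted_deriv \<delta> q"
  by (simp add: shifted_deriv_def pderiv_add smult_add_right)

lemma shifted_deriv_smult: "shifted_deriv \<delta> (smult c p) = smult c (shifted_deriv \<delta> p)"
  by (simp add: shifted_deriv_def pderiv_smult smult_add_right mult.commute)

lemma shifted_deriv_zero: "shifted_deriv \<delta> 0 = 0"
  by (simp add: shifted_deriv_def)

lemma shifted_deriv_sum: "shifted_deriv \<delta> (sum f A) = (\<Sum>x\<in>A. shifted_deriv \<delta> (f x))"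
  by (induction A rule: infinite_finite_induct) (simp_all add: shifted_deriv_add shifted_deriv_zero)

lemma funpow_shifted_deriv_add:
  "(shifted_deriv \<delta> ^^ k) (p + q) = (shifted_deriv \<delta> ^^ k) p + (shifted_deriv \<delta> ^^ k) q"
  by (induction k) (simp_all add: shifted_deriv_add)

lemma funpow_shifted_deriv_smult:
  "(shifted_deriv \<delta> ^^ k) (smult c p) = smult c ((shifted_deriv \<delta> ^^ k) p)"
  by (induction k) (simp_all add: shifted_deriv_smult)

lemma funpow_shifted_deriv_sum:
  "(shifted_deriv \<delta> ^^ k) (sum f A) = (\<Sum>x\<in>A. (shifted_deriv \<delta> ^^ k) (f x))"
  by (induction k) (simp_all add: shifted_deriv_sum)

text \<open>The weights come from polarizing x^k in \<open>Suc d\<close> variables: with one of them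
  named y and the others equal to x, it becomes (1 - k / Suc d) x^k + (k / Suc d) x^(k - 1) y. The
  identity says that nothing is lost when the two parts are put together again.\<close>

lemma sum_polar_weights:
  fixes f :: "nat \<Rightarrow> complex"
  shows "(\<Sum>k\<le>d. (1 - of_nat k / of_nat (Suc d)) * f k)
           + (\<Sum>k\<le>d. of_nat (Suc k) / of_nat (Suc d) * f (Suc k)) = (\<Sum>k\<le>Suc d. f k)"
proof -
  define g where "g = (\<lambda>k. of_nat k / of_nat (Suc d) * f k)"
  have "(\<Sum>k\<le>d. of_nat (Suc k) / of_nat (Suc d) * f (Suc k)) = (\<Sum>k\<le>Suc d. g k)"
    unfolding sum.atMost_Suc_shift by (simp add: g_def)
  also have "\<dots> = (\<Sum>k\<le>d. g k) + f (Suc d)"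
    by (simp add: g_def del: of_nat_Suc)
  finally show ?thesis
    by (simp add: g_def algebra_simps sum_subtractf del: of_nat_Suc)
qed

text \<open>The Lieb--Sokal lemma in arbitrary degree. By polarization one power of \<open>x\<close> at a time is
  traded for a new variable of degree one, which is then replaced by a derivative.\<close>

lemma contraction_nonzero:
  fixes R :: "nat \<Rightarrow> complex poly" and a c \<delta> :: real
  assumes nz: "\<And>x z. Re x > - a \<Longrightarrow> Re z > c \<Longrightarrow> (\<Sum>k\<le>d. x ^ k * poly (R k) z) \<noteq> 0"
    and a: "a + \<delta> > 0" and z: "Re z > c"
  shows "(\<Sum>k\<le>d. poly ((shifted_deriv \<delta> ^^ k) (R k)) z) \<noteq> 0"
  using nz
proof (induction d arbitrary: R)
  case 0
  from "0.prems"[OF _ z, of "of_real (\<bar>a\<bar> + 1)"] show ?case by simp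
next
  case (Suc d)
  define \<mu> where "\<mu> = (\<lambda>k. of_nat k / of_nat (Suc d) :: complex)"
  \<comment> \<open>The coefficient of x^k once the separated variable y has been turned into a
    derivative: the part of \<open>R (Suc k)\<close> that gives up one power of x gains one shifted
    derivative.\<close>
  define R' where "R' = (\<lambda>k. smult (1 - \<mu> k) (R k) + smult (\<mu> (Suc k)) (shifted_deriv \<delta> (R (Suc k))))"
  have "(\<Sum>k\<le>d. x ^ k * poly (R' k) u) \<noteq> 0" if x: "Re x > - a" and u: "Re u > c" for x u
  proof -
    \<comment> \<open>P + y Q is the polarization of the given polynomial with one argument y, so
      \<open>polar_derivative_nonzero\<close> makes it zero-free.\<close>
    define P where "P = (\<Sum>k\<le>d. smult (x ^ k * (1 - \<mu> k)) (R k))"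
    define Q where "Q = (\<Sum>k\<le>d. smult (x ^ k * \<mu> (Suc k)) (R (Suc k)))"
    have "poly (P + shifted_deriv \<delta> Q) u \<noteq> 0"
    proof (rule linear_contraction_nonzero[OF _ a u])
      fix y v assume y: "Re y > - a" and v: "Re v > c"
      define p where "p = (\<Sum>k\<le>Suc d. monom (poly (R k) v) k)"
      have "poly p x + (y - x) * poly (pderiv p) x / of_nat (Suc d) \<noteq> 0"
      proof (rule polar_derivative_nonzero[OF _ x y])
        show "poly p t \<noteq> 0" if "Re t > - a" for t
          using Suc.prems[OF that v] by (simp add: p_def poly_sum poly_monom mult.commute)
        show "degree p \<le> Suc d"
          unfolding p_def by (intro degree_sum_le order.trans[OF degree_monom_le]) auto
      qed auto
      moreover have "poly (pderiv p) x / of_nat (Suc d) = poly Q v"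
      proof -
        have "pderiv p = (\<Sum>k\<le>Suc d. pderiv (monom (poly (R k) v) k))"
          unfolding p_def using higher_pderiv_sum[of 1 "\<lambda>k. monom (poly (R k) v) k" "{..Suc d}"]
          by (simp only: One_nat_def funpow.simps o_apply id_apply)
        hence "poly (pderiv p) x = (\<Sum>k\<le>Suc d. of_nat k * poly (R k) v * x ^ (k - 1))"
          by (simp add: poly_sum poly_monom pderiv_monom)
        also have "\<dots> = (\<Sum>k\<le>d. of_nat (Suc k) * poly (R (Suc k)) v * x ^ k)"
          unfolding sum.atMost_Suc_shift by simp
        finally show ?thesis
          by (simp add: Q_def poly_sum \<mu>_def sum_divide_distrib mult_ac)
      qed
      moreover have "poly p x - x * poly Q v = poly P v"
      proof -
        have "x * poly Q v = (\<Sum>k\<le>d. of_nat (Suc k) / of_nat (Suc d) * (poly (R (Suc k)) v * x ^ Suc k))"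
          by (simp add: Q_def poly_sum \<mu>_def sum_distrib_left mult_ac)
        moreover have "poly P v = (\<Sum>k\<le>d. (1 - of_nat k / of_nat (Suc d)) * (poly (R k) v * x ^ k))"
          by (simp add: P_def poly_sum \<mu>_def mult_ac)
        moreover have "poly p x = (\<Sum>k\<le>Suc d. poly (R k) v * x ^ k)"
          by (simp add: p_def poly_sum poly_monom)
        ultimately show ?thesis
          using sum_polar_weights[of d "\<lambda>k. poly (R k) v * x ^ k"] by (simp add: algebra_simps)
      qed
      ultimately show "poly P v + y * poly Q v \<noteq> 0"
        by (metis (no_types, lifting) add.commute diff_add_eq diff_diff_eq2 left_diff_distrib times_divide_eq_right)
    qed
    also have "poly (P + shifted_deriv \<delta> Q) u = (\<Sum>k\<le>d. x ^ k * poly (R' k) u)"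
      by (simp add: P_def Q_def R'_def shifted_deriv_sum shifted_deriv_smult poly_sum
          flip: sum.distrib) (simp add: algebra_simps)
    finally show ?thesis .
  qed
  hence "(\<Sum>k\<le>d. poly ((shifted_deriv \<delta> ^^ k) (R' k)) z) \<noteq> 0"
    by (rule Suc.IH)
  \<comment> \<open>On \<open>R (Suc k)\<close> act one derivative from this step and k from the
    induction hypothesis; for each \<open>R k\<close> the two weights then add up to 1.\<close>
  also have "(\<Sum>k\<le>d. poly ((shifted_deriv \<delta> ^^ k) (R' k)) z) =
      (\<Sum>k\<le>d. (1 - \<mu> k) * poly ((shifted_deriv \<delta> ^^ k) (R k)) z)
      + (\<Sum>k\<le>d. \<mu> (Suc k) * poly ((shifted_deriv \<delta> ^^ Suc k) (R (Suc k))) z)"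
    by (simp add: R'_def funpow_shifted_deriv_add funpow_shifted_deriv_smult sum.distrib
        funpow_swap1)
  also have "\<dots> = (\<Sum>k\<le>Suc d. poly ((shifted_deriv \<delta> ^^ k) (R k)) z)"
    unfolding \<mu>_def by (rule sum_polar_weights)
  finally show ?case .
qed

text \<open>In several variables the exponent of one variable is shared by many monomials. The terms
  are therefore indexed by an arbitrary finite set and grouped by exponent here, once and for
  all.\<close>

lemma contraction_nonzero_sum:
  fixes q :: "'s \<Rightarrow> complex poly" and a c \<delta> :: real
  assumes fin: "finite S"
    and nz: "\<And>x z. Re x > - a \<Longrightarrow> Re z > c \<Longrightarrow> (\<Sum>s\<in>S. x ^ e s * poly (q s) z) \<noteq> 0"
    and a: "a + \<delta> > 0" and z: "Re z > c"
  shows "(\<Sum>s\<in>S. poly ((shifted_deriv \<delta> ^^ e s) (q s)) z) \<noteq> 0"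
proof -
  define d where "d = Max (insert 0 (e ` S))"
  have e: "e s \<le> d" if "s \<in> S" for s
    using that fin by (auto simp: d_def intro: Max_ge)
  define R where "R = (\<lambda>k. \<Sum>s | s \<in> S \<and> e s = k. q s)"
  have group: "(\<Sum>k\<le>d. \<Sum>s | s \<in> S \<and> e s = k. h s) = sum h S" for h :: "'s \<Rightarrow> complex"
    using e by (intro sum.group fin) auto
  have "(\<Sum>k\<le>d. poly ((shifted_deriv \<delta> ^^ k) (R k)) z) \<noteq> 0"
  proof (rule contraction_nonzero[OF _ a z])
    fix x u assume "Re x > - a" "Re u > c"
    have "(\<Sum>k\<le>d. x ^ k * poly (R k) u) = (\<Sum>k\<le>d. \<Sum>s | s \<in> S \<and> e s = k. x ^ e s * poly (q s) u)"
      by (intro sum.cong) (auto simp: R_def poly_sum sum_distrib_left)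
    also have "\<dots> = (\<Sum>s\<in>S. x ^ e s * poly (q s) u)" by (rule group)
    finally show "(\<Sum>k\<le>d. x ^ k * poly (R k) u) \<noteq> 0"
      using nz[OF \<open>Re x > - a\<close> \<open>Re u > c\<close>] by simp
  qed
  also have "(\<Sum>k\<le>d. poly ((shifted_deriv \<delta> ^^ k) (R k)) z)
      = (\<Sum>k\<le>d. \<Sum>s | s \<in> S \<and> e s = k. poly ((shifted_deriv \<delta> ^^ e s) (q s)) z)"
    by (intro sum.cong) (auto simp: R_def poly_sum funpow_shifted_deriv_sum)
  also have "\<dots> = (\<Sum>s\<in>S. poly ((shifted_deriv \<delta> ^^ e s) (q s)) z)" by (rule group)
  finally show ?thesis .
qed

text \<open>For k \<le> N this is N! / ((N - k)! N^k), that is, k! times the coefficient of x^k in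
  (1 + x / N)^N. The factor with l = N makes it vanish for all larger exponents.\<close>

definition trunc_weight :: "nat \<Rightarrow> nat \<Rightarrow> real" where
  "trunc_weight N k = (\<Prod>l<k. real (N - l) / real N)"

lemma trunc_weight_nonneg: "0 \<le> trunc_weight N k"
  by (simp add: trunc_weight_def prod_nonneg)

lemma trunc_weight_le_1: "trunc_weight N k \<le> 1"
  unfolding trunc_weight_def by (intro prod_le_1) (auto simp: divide_le_eq)

lemma trunc_weight_eq_0: "N < k \<Longrightarrow> trunc_weight N k = 0"
  unfolding trunc_weight_def by (intro prod_zero) (auto intro!: bexI[of _ N])

lemma trunc_weight_tendsto: "(\<lambda>N. trunc_weight N k) \<longlonglongrightarrow> 1"
proof -
  have "(\<lambda>N. real (N - l) / real N) \<longlonglongrightarrow> 1" for l by real_asymp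
  hence "(\<lambda>N. \<Prod>l<k. real (N - l) / real N) \<longlonglongrightarrow> (\<Prod>l<k. 1)"
    by (intro tendsto_prod)
  thus ?thesis by (simp add: trunc_weight_def)
qed

lemma funpow_pderiv_monom_1:
  "(pderiv ^^ k) (monom 1 N) = monom (\<Prod>l<k. of_nat (N - l)) (N - k)"
  by (induction k) (simp_all add: pderiv_monom mult.commute)

text \<open>Truncation amounts to letting \<open>p (d / dt)\<close> act on \<open>t ^ N\<close> and substituting \<open>t = N / x\<close>.\<close>

lemma truncation_nonzero:
  fixes C :: "'s \<Rightarrow> complex"
  assumes fin: "finite S" and \<epsilon>: "\<epsilon> > 0" and N: "N > 0"
    and nz: "\<And>x. Re x > - \<epsilon> \<Longrightarrow> (\<Sum>s\<in>S. C s * x ^ e s) \<noteq> 0"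
    and x: "Re x > 0"
  shows "(\<Sum>s\<in>S. C s * of_real (trunc_weight N (e s)) * x ^ e s) \<noteq> 0"
proof -
  \<comment> \<open>Inversion preserves the right half-plane, and x = N / t turns the k-th
    derivative of t^N into t^N times the weighted power of x.\<close>
  define t where "t = of_nat N / x"
  have x0: "x \<noteq> 0" using x by auto
  have t: "Re t > 0"
    using x N by (simp add: t_def Re_divide zero_less_divide_iff add_pos_nonneg)
  hence t0: "t \<noteq> 0" by auto
  have sd: "shifted_deriv 0 = pderiv"
    by (auto simp: shifted_deriv_def)
  have "(\<Sum>s\<in>S. poly ((shifted_deriv (complex_of_real 0) ^^ e s) (smult (C s) (monom 1 N))) t) \<noteq> 0"
  proof (rule contraction_nonzero_sum[OF fin, of \<epsilon> 0])
    fix x u :: complex assume "Re x > - \<epsilon>" "Re u > 0"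
    moreover have "(\<Sum>s\<in>S. x ^ e s * poly (smult (C s) (monom 1 N)) u) = (\<Sum>s\<in>S. C s * x ^ e s) * u ^ N"
      by (simp add: poly_monom sum_distrib_left mult_ac)
    ultimately show "(\<Sum>s\<in>S. x ^ e s * poly (smult (C s) (monom 1 N)) u) \<noteq> 0"
      using nz by auto
  qed (use \<epsilon> t in auto)
  also have "(\<Sum>s\<in>S. poly ((shifted_deriv (complex_of_real 0) ^^ e s) (smult (C s) (monom 1 N))) t)
      = (\<Sum>s\<in>S. t ^ N * (C s * of_real (trunc_weight N (e s)) * x ^ e s))"
  proof (intro sum.cong refl)
    fix s
    show "poly ((shifted_deriv (complex_of_real 0) ^^ e s) (smult (C s) (monom 1 N))) t
        = t ^ N * (C s * of_real (trunc_weight N (e s)) * x ^ e s)"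
    proof (cases "e s \<le> N")
      case True
      have "t ^ (N - e s) * of_nat N ^ e s = t ^ N * x ^ e s"
        using True x0 t0 N by (simp add: power_diff field_simps) (simp add: t_def power_divide)
      thus ?thesis using N
        by (simp add: sd higher_pderiv_smult funpow_pderiv_monom_1 poly_monom trunc_weight_def
            prod_dividef field_simps)
    next
      case False
      have "(\<Prod>l<e s. of_nat (N - l)) = (0 :: complex)"
        using False by (intro prod_zero) (auto intro!: bexI[of _ N])
      thus ?thesis using False
        by (simp add: sd higher_pderiv_smult funpow_pderiv_monom_1 trunc_weight_eq_0 poly_monom
            del: prod_zero_iff)
    qed
  qed
  finally show ?thesis by (auto simp: sum_distrib_left[symmetric])
qed

text \<open>The result of replacing x by d/dz + \<delta> in x^k z^l and then setting z = \<delta>.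
  The value for \<delta> = 0 would be the wanted pairing, k! for k = l and 0 otherwise, but z = 0 is
  a boundary point, and with a = 0 the contraction lemma asks for a positive shift.\<close>

definition pairing_weight :: "complex \<Rightarrow> nat \<Rightarrow> nat \<Rightarrow> complex" where
  "pairing_weight \<delta> k l = poly ((shifted_deriv \<delta> ^^ k) (monom 1 l)) \<delta>"

lemma pairing_nonzero:
  fixes C :: "'s \<Rightarrow> complex"
  assumes fin: "finite S" and \<delta>: "\<delta> > 0"
    and nz: "\<And>x z. Re x > 0 \<Longrightarrow> Re z > 0 \<Longrightarrow> (\<Sum>s\<in>S. C s * x ^ e s * z ^ e' s) \<noteq> 0"
  shows "(\<Sum>s\<in>S. C s * pairing_weight (of_real \<delta>) (e s) (e' s)) \<noteq> 0"
proof -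
  have "(\<Sum>s\<in>S. poly ((shifted_deriv (of_real \<delta>) ^^ e s) (smult (C s) (monom 1 (e' s)))) (of_real \<delta>)) \<noteq> 0"
    by (rule contraction_nonzero_sum[OF fin, of 0 0])
       (use \<delta> nz in \<open>auto simp: poly_monom mult_ac\<close>)
  thus ?thesis by (simp add: pairing_weight_def funpow_shifted_deriv_smult)
qed

lemma coeff_shifted_deriv:
  "coeff (shifted_deriv \<delta> q) n = of_nat (Suc n) * coeff q (Suc n) + \<delta> * coeff q n"
  by (simp add: shifted_deriv_def coeff_pderiv)

lemma degree_funpow_shifted_deriv: "degree ((shifted_deriv \<delta> ^^ k) q) \<le> degree q"
proof (induction k)
  case (Suc k)
  have "degree (shifted_deriv \<delta> p) \<le> degree p" for p
    unfolding shifted_deriv_def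
    by (intro degree_add_le degree_smult_le) (simp add: degree_pderiv)
  thus ?case using Suc order.trans by fastforce
qed auto

text \<open>Coefficients of iterated shifted derivatives depend continuously on the shift, and the
  degree stays at most l, so the evaluation is a sum over a fixed finite range.\<close>

lemma pairing_weight_tendsto:
  assumes "(f \<longlongrightarrow> 0) F"
  shows "((\<lambda>t. pairing_weight (f t) k l) \<longlongrightarrow> (if k = l then fact k else 0)) F"
proof -
  have coeff: "((\<lambda>t. coeff ((shifted_deriv (f t) ^^ k) q) n) \<longlongrightarrow> coeff ((pderiv ^^ k) q) n) F" for q n
  proof (induction k arbitrary: n)
    case (Suc k)
    have "((\<lambda>t. of_nat (Suc n) * coeff ((shifted_deriv (f t) ^^ k) q) (Suc n)
            + f t * coeff ((shifted_deriv (f t) ^^ k) q) n)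
       \<longlongrightarrow> of_nat (Suc n) * coeff ((pderiv ^^ k) q) (Suc n) + 0 * coeff ((pderiv ^^ k) q) n) F"
      by (intro tendsto_intros Suc assms)
    thus ?case by (simp add: coeff_shifted_deriv coeff_pderiv del: of_nat_Suc)
  qed auto
  have "pairing_weight (f t) k l = (\<Sum>n\<le>l. coeff ((shifted_deriv (f t) ^^ k) (monom 1 l)) n * f t ^ n)" for t
    unfolding pairing_weight_def
    by (subst poly_as_sum_of_monoms'[symmetric, where n = l])
       (auto simp: poly_sum poly_monom intro!: order.trans[OF degree_funpow_shifted_deriv] degree_monom_le)
  moreover have "((\<lambda>t. \<Sum>n\<le>l. coeff ((shifted_deriv (f t) ^^ k) (monom 1 l)) n * f t ^ n)
      \<longlongrightarrow> (\<Sum>n\<le>l. coeff ((pderiv ^^ k) (monom 1 l)) n * 0 ^ n)) F"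
    by (intro tendsto_intros coeff assms)
  moreover have "(\<Sum>n\<le>l. coeff ((pderiv ^^ k) (monom 1 l)) n * 0 ^ n) = coeff ((pderiv ^^ k) (monom 1 l)) 0"
    for k l :: nat
    by (subst sum.atMost_shift) (simp add: sum.neutral power_0_left)
  moreover have "coeff ((pderiv ^^ k) (monom 1 l)) 0 = (if k = l then fact k else 0 :: complex)"
    by (auto simp: coeff_higher_pderiv pochhammer_fact)
  ultimately show ?thesis by simp
qed

section \<open>Truncation and pairing in several variables\<close>

lemma prod_power_fun_upd:
  fixes z :: "'i::finite \<Rightarrow> 'a::comm_semiring_1"
  shows "(\<Prod>j\<in>UNIV. (z(i := x)) j ^ \<eta> j) = x ^ \<eta> i * (\<Prod>j\<in>UNIV - {i}. z j ^ \<eta> j)"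
  by (subst prod.remove[of UNIV i]) (auto intro!: prod.cong)

text \<open>One variable is truncated at a time with the others frozen. The induction runs over the
  set B of variables already treated: those need a positive real part, while the untreated ones must
  be allowed down to - \<epsilon>, to have a margin when their turn comes.\<close>

lemma multi_truncation_nonzero:
  fixes C :: "'s \<Rightarrow> complex" and E :: "'s \<Rightarrow> 'i::finite \<Rightarrow> nat"
  assumes fin: "finite S" and \<epsilon>: "\<epsilon> > 0" and N: "N > 0"
    and nz: "\<And>z. (\<And>i. Re (z i) > - \<epsilon>) \<Longrightarrow> (\<Sum>s\<in>S. C s * (\<Prod>i\<in>UNIV. z i ^ E s i)) \<noteq> 0"
    and z: "\<And>i. Re (z i) > 0"
  shows "(\<Sum>s\<in>S. C s * of_real (\<Prod>i\<in>UNIV. trunc_weight N (E s i)) * (\<Prod>i\<in>UNIV. z i ^ E s i)) \<noteq> 0"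
proof -
  have "(\<Sum>s\<in>S. C s * of_real (\<Prod>i\<in>B. trunc_weight N (E s i)) * (\<Prod>i\<in>UNIV. z i ^ E s i)) \<noteq> 0"
    if "\<And>i. i \<in> B \<Longrightarrow> Re (z i) > 0" "\<And>i. i \<notin> B \<Longrightarrow> Re (z i) > - \<epsilon>" for z B
    using finite[of B] that
  proof (induction B arbitrary: z rule: finite_induct)
    case empty
    thus ?case using nz[of z] by simp
  next
    case (insert i B)
    define D where "D = (\<lambda>s. C s * of_real (\<Prod>j\<in>B. trunc_weight N (E s j))
                              * (\<Prod>j\<in>UNIV - {i}. z j ^ E s j))"
    have "(\<Sum>s\<in>S. D s * of_real (trunc_weight N (E s i)) * z i ^ E s i) \<noteq> 0"
    proof (rule truncation_nonzero[OF fin \<epsilon> N])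
      show "Re (z i) > 0" using insert.prems by simp
      fix x assume x: "Re x > - \<epsilon>"
      have "(\<Sum>s\<in>S. C s * of_real (\<Prod>j\<in>B. trunc_weight N (E s j)) * (\<Prod>j\<in>UNIV. (z(i := x)) j ^ E s j)) \<noteq> 0"
        by (rule insert.IH) (use insert.prems insert.hyps x in auto)
      thus "(\<Sum>s\<in>S. D s * x ^ E s i) \<noteq> 0"
        unfolding prod_power_fun_upd by (simp add: D_def mult_ac)
    qed
    moreover have "(\<Prod>j\<in>UNIV. z j ^ E s j) = z i ^ E s i * (\<Prod>j\<in>UNIV - {i}. z j ^ E s j)" for s
      by (rule prod.remove) auto
    ultimately show ?case
      using insert.hyps by (simp add: D_def mult_ac)
  qed
  from this[of UNIV z] z show ?thesis by simp
qed

text \<open>A paired couple (v i, z i) disappears from the sum altogether, so the remaining powers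
  run over the complement of the treated set. When all couples are treated no variable is left, and
  the induction can be started at any admissible point, here the constant 1.\<close>

lemma multi_pairing_nonzero:
  fixes C :: "'s \<Rightarrow> complex" and E E' :: "'s \<Rightarrow> 'i::finite \<Rightarrow> nat"
  assumes fin: "finite S" and \<delta>: "\<delta> > 0"
    and nz: "\<And>v z. (\<And>i. Re (v i) > 0) \<Longrightarrow> (\<And>i. Re (z i) > 0) \<Longrightarrow>
               (\<Sum>s\<in>S. C s * (\<Prod>i\<in>UNIV. v i ^ E s i) * (\<Prod>i\<in>UNIV. z i ^ E' s i)) \<noteq> 0"
  shows "(\<Sum>s\<in>S. C s * (\<Prod>i\<in>UNIV. pairing_weight (of_real \<delta>) (E s i) (E' s i))) \<noteq> 0"
proof -
  let ?w = "\<lambda>s i. pairing_weight (of_real \<delta>) (E s i) (E' s i)"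
  have "(\<Sum>s\<in>S. C s * (\<Prod>i\<in>B. ?w s i) * (\<Prod>i\<in>-B. v i ^ E s i * z i ^ E' s i)) \<noteq> 0"
    if "\<And>i. Re (v i) > 0" "\<And>i. Re (z i) > 0" for v z B
    using finite[of B] that
  proof (induction B arbitrary: v z rule: finite_induct)
    case empty
    thus ?case using nz[of v z] by (simp add: prod.distrib mult_ac)
  next
    case (insert i B)
    define D where "D = (\<lambda>s. C s * (\<Prod>j\<in>B. ?w s j)
                              * (\<Prod>j\<in>-insert i B. v j ^ E s j * z j ^ E' s j))"
    have "(\<Sum>s\<in>S. D s * ?w s i) \<noteq> 0"
    proof (rule pairing_nonzero[OF fin \<delta>])
      fix x y assume x: "Re x > 0" and y: "Re y > 0"
      have "(\<Sum>s\<in>S. C s * (\<Prod>j\<in>B. ?w s j) * (\<Prod>j\<in>-B. (v(i := x)) j ^ E s j * (z(i := y)) j ^ E' s j)) \<noteq> 0"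
        by (rule insert.IH) (use insert.prems x y in auto)
      moreover have "(\<Prod>j\<in>-B. (v(i := x)) j ^ E s j * (z(i := y)) j ^ E' s j) =
          x ^ E s i * y ^ E' s i * (\<Prod>j\<in>-insert i B. v j ^ E s j * z j ^ E' s j)" for s
        using insert.hyps
        by (subst prod.remove[of _ i]) (auto simp: Compl_insert intro!: prod.cong)
      ultimately show "(\<Sum>s\<in>S. D s * x ^ E s i * y ^ E' s i) \<noteq> 0"
        by (simp add: D_def mult_ac)
    qed
    thus ?case using insert.hyps by (simp add: D_def mult_ac)
  qed
  from this[of "\<lambda>_. 1" "\<lambda>_. 1" UNIV] show ?thesis by simp
qed

section \<open>Power series in several variables\<close>

text \<open>Dominated convergence for unordered sums: a finite set carries g up to e / 4, the tail
  of each h n is at most that of g, and on the finite set the limit is taken termwise.\<close>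

lemma infsum_tendsto_0_dominated:
  fixes h :: "nat \<Rightarrow> 'a \<Rightarrow> real"
  assumes g: "g summable_on UNIV" and h: "\<And>n x. 0 \<le> h n x" "\<And>n x. h n x \<le> g x"
    and lim: "\<And>x. (\<lambda>n. h n x) \<longlonglongrightarrow> 0"
  shows "(\<lambda>n. infsum (h n) UNIV) \<longlonglongrightarrow> 0"
proof (rule LIMSEQ_I)
  fix e :: real assume e: "e > 0"
  have hs: "h n summable_on A" for n A
    by (rule summable_on_subset[OF summable_on_comparison_test[OF g]]) (use h in auto)
  have gs: "g summable_on A" for A
    by (rule summable_on_subset[OF g]) auto
  obtain F where F: "finite F" "dist (sum g F) (infsum g UNIV) \<le> e / 4"
    using infsum_finite_approximation[OF g, of "e / 4"] e by auto
  have split: "infsum u UNIV = sum u F + infsum u (-F)" if "\<And>A. u summable_on A" for u :: "'a \<Rightarrow> real"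
    using infsum_Un_disjoint[of u F "-F"] that F by (simp add: Compl_partition)
  have tail: "infsum g (-F) \<le> e / 4"
    using F split[of g] gs by (simp add: dist_real_def)
  have "(\<lambda>n. sum (h n) F) \<longlonglongrightarrow> (\<Sum>x\<in>F. 0)"
    by (intro tendsto_sum lim)
  hence "\<forall>\<^sub>F n in sequentially. sum (h n) F < e / 4"
    using e by (intro order_tendstoD) auto
  then obtain M where M: "\<And>n. n \<ge> M \<Longrightarrow> sum (h n) F < e / 4"
    by (auto simp: eventually_sequentially)
  show "\<exists>M. \<forall>n\<ge>M. norm (infsum (h n) UNIV - 0) < e"
  proof (intro exI allI impI)
    fix n assume "n \<ge> M"
    have "infsum (h n) (-F) \<le> infsum g (-F)"
      by (intro infsum_mono hs gs h)
    moreover have "0 \<le> infsum (h n) UNIV"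
      by (intro infsum_nonneg h)
    ultimately show "norm (infsum (h n) UNIV - 0) < e"
      using split[of "h n"] hs M[OF \<open>n \<ge> M\<close>] tail e by simp
  qed
qed

text \<open>Reduces to the nonnegative case through the norms of the differences, which 2 g
  dominates.\<close>

lemma infsum_tendsto_dominated:
  fixes b :: "nat \<Rightarrow> 'a \<Rightarrow> 'b::banach"
  assumes g: "g summable_on UNIV" and b: "\<And>n x. norm (b n x) \<le> g x"
    and lim: "\<And>x. (\<lambda>n. b n x) \<longlonglongrightarrow> a x"
  shows "(\<lambda>n. infsum (b n) UNIV) \<longlonglongrightarrow> infsum a UNIV"
proof -
  have a: "norm (a x) \<le> g x" for x
    by (rule LIMSEQ_le_const2[OF tendsto_norm[OF lim]]) (use b in auto)
  have bs: "(\<lambda>x. norm (b n x)) summable_on UNIV" for n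
    by (rule summable_on_comparison_test[OF g]) (use b in auto)
  have as: "(\<lambda>x. norm (a x)) summable_on UNIV"
    by (rule summable_on_comparison_test[OF g]) (use a in auto)
  have ds: "(\<lambda>x. norm (b n x - a x)) summable_on UNIV" for n
    by (rule summable_on_comparison_test[OF summable_on_add[OF bs[of n] as]])
       (auto intro: norm_triangle_ineq4)
  have lim0: "(\<lambda>n. \<Sum>\<^sub>\<infinity>x. norm (b n x - a x)) \<longlonglongrightarrow> 0"
  proof (rule infsum_tendsto_0_dominated)
    show "(\<lambda>x. 2 * g x) summable_on UNIV" by (intro summable_on_cmult_right g)
    show "norm (b n x - a x) \<le> 2 * g x" for n x
      using norm_triangle_ineq4[of "b n x" "a x"] a[of x] b[of n x] by linarith
    show "(\<lambda>n. norm (b n x - a x)) \<longlonglongrightarrow> 0" for x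
      using lim by (simp add: LIM_zero_iff tendsto_norm_zero)
  qed auto
  have "(\<lambda>n. infsum (b n) UNIV - infsum a UNIV) \<longlonglongrightarrow> 0"
  proof (rule Lim_null_comparison[OF _ lim0], rule always_eventually, rule allI)
    fix n
    have "infsum (b n) UNIV - infsum a UNIV = (\<Sum>\<^sub>\<infinity>x. b n x - a x)"
      using infsum_add[of "b n" UNIV "\<lambda>x. - a x"] bs as
      by (simp add: abs_summable_summable summable_on_uminus infsum_uminus)
    also have "norm \<dots> \<le> (\<Sum>\<^sub>\<infinity>x. norm (b n x - a x))"
      by (rule norm_infsum_bound[OF ds])
    finally show "norm (infsum (b n) UNIV - infsum a UNIV) \<le> (\<Sum>\<^sub>\<infinity>x. norm (b n x - a x))" .
  qed
  thus ?thesis by (simp add: LIM_zero_iff)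
qed

section \<open>Cauchy estimates and uniqueness of coefficients\<close>

lemma has_sum_sum:
  fixes f :: "'i \<Rightarrow> 'a \<Rightarrow> complex"
  assumes "\<And>i. i \<in> I \<Longrightarrow> (f i has_sum s i) A"
  shows "((\<lambda>x. \<Sum>i\<in>I. f i x) has_sum (\<Sum>i\<in>I. s i)) A"
  using assms by (induction I rule: infinite_finite_induct) (auto intro!: has_sum_add)

lemma norm_mindex_power: "cmod (mindex_power z \<eta>) = (\<Prod>i\<in>UNIV. cmod (z $ i) ^ \<eta> i)"
  by (simp add: mindex_power_def norm_power flip: prod_norm)

text \<open>Orthogonality of the characters of Z / N. The terms are the powers of one N-th root of
  unity, which equals 1 exactly when n and m agree modulo N; otherwise the geometric sum
  vanishes.\<close>

lemma sum_roots_of_unity: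
  assumes "N > 0"
  shows "(\<Sum>k<N. cis (2 * pi * real k / real N) ^ n * cnj (cis (2 * pi * real k / real N)) ^ m)
           = (if n mod N = m mod N then of_nat N else 0)"
proof -
  define t where "t = 2 * pi * (real n - real m) / real N"
  have power_eq: "cis (2 * pi * real k / real N) ^ n * cnj (cis (2 * pi * real k / real N)) ^ m = cis t ^ k" for k
    by (simp add: Complex.DeMoivre cis_cnj cis_mult t_def algebra_simps diff_divide_distrib)
  have one: "cis t = 1 \<longleftrightarrow> n mod N = m mod N"
  proof
    assume "cis t = 1"
    hence "cos t = 1" by (metis cis.sel(1) one_complex.sel(1))
    then obtain j :: int where "t = of_int j * 2 * pi"
      by (auto simp: cos_one_2pi_int)
    hence "2 * pi * (real n - real m) = 2 * pi * (real_of_int j * real N)"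
      using assms by (simp add: t_def field_simps)
    hence "real n - real m = of_int (j * int N)"
      by (subst (asm) mult_cancel_left) simp
    hence "int n - int m = j * int N"
      by (metis (mono_tags, opaque_lifting) of_int_eq_iff of_int_diff of_int_of_nat_eq)
    hence "int n mod int N = int m mod int N"
      by (simp add: mod_eq_dvd_iff)
    thus "n mod N = m mod N"
      by (metis of_nat_eq_iff of_nat_mod)
  next
    assume "n mod N = m mod N"
    hence "int n mod int N = int m mod int N"
      by (metis of_nat_mod)
    then obtain j where "int n - int m = int N * j"
      by (auto simp: mod_eq_dvd_iff elim: dvdE)
    hence "real n - real m = real N * of_int j"
      by (metis of_int_diff of_int_mult of_int_of_nat_eq)
    hence "t = 2 * pi * of_int j"
      using assms by (simp add: t_def)
    thus "cis t = 1"
      by (metis cis_multiple_2pi Ints_of_int)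
  qed
  have "cis t ^ N = cis (2 * pi * (real n - real m))"
    using assms by (simp add: Complex.DeMoivre t_def)
  also have "\<dots> = 1" by (rule cis_multiple_2pi) auto
  finally have pow: "cis t ^ N = 1" .
  show ?thesis
  proof (cases "cis t = 1")
    case True
    thus ?thesis using one by (simp add: power_eq)
  next
    case False
    thus ?thesis using one pow geometric_sum[OF False, of N] by (simp add: power_eq)
  qed
qed

text \<open>Averaging \<open>f\<close> against a monomial over \<open>N\<close>-th roots of unity isolates the
  coefficients congruent to \<open>\<eta>\<close> modulo \<open>N\<close>; only \<open>a \<eta>\<close> survives as \<open>N\<close> grows.\<close>

lemma Cauchy_coefficient_bound:
  fixes a :: "('n::finite \<Rightarrow> nat) \<Rightarrow> complex"
  assumes f: "has_power_series f a" and M: "\<And>z. (\<And>i. cmod (z $ i) = 1) \<Longrightarrow> cmod (f z) \<le> M"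
  shows "cmod (a \<eta>) \<le> M"
proof -
  define r where "r = (\<lambda>N k. cis (2 * pi * real k / real N))"
  define b where "b = (\<lambda>N \<zeta>. if \<forall>i. \<zeta> i mod N = \<eta> i mod N then a \<zeta> else 0)"
  \<comment> \<open>At the point with all coordinates 1 the series is the sum of its coefficients.
    These are thus absolutely summable and serve as the majorant for the limit in N.\<close>
  have "((\<lambda>\<zeta>. a \<zeta>) has_sum f (\<chi> i. 1)) UNIV"
    using f[unfolded has_power_series_def, rule_format, of "\<chi> i. 1"] by (simp add: mindex_power_def)
  hence asum: "(\<lambda>\<zeta>. norm (a \<zeta>)) summable_on UNIV"
    by (metis has_sum_imp_summable summable_on_iff_abs_summable_on_complex)
  have bound: "cmod (infsum (b (Suc n)) UNIV) \<le> M" for n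
  proof -
    define N where "N = Suc n"
    define G where "G = PiE (UNIV :: 'n set) (\<lambda>_. {..<N})"
    define z where "z = (\<lambda>g. \<chi> i::'n. r N (g i))"
    have G: "finite G" unfolding G_def by (intro finite_PiE) auto
    have cardG: "card G = N ^ CARD('n)"
      unfolding G_def by (subst card_PiE) auto
    have "((\<lambda>\<zeta>. \<Sum>g\<in>G. cnj (mindex_power (z g) \<eta>) * (a \<zeta> * mindex_power (z g) \<zeta>))
            has_sum (\<Sum>g\<in>G. cnj (mindex_power (z g) \<eta>) * f (z g))) UNIV"
      using f unfolding has_power_series_def by (intro has_sum_sum has_sum_cmult_right) auto
    also have "(\<lambda>\<zeta>. \<Sum>g\<in>G. cnj (mindex_power (z g) \<eta>) * (a \<zeta> * mindex_power (z g) \<zeta>))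
        = (\<lambda>\<zeta>. of_nat N ^ CARD('n) * b N \<zeta>)"
    proof
      fix \<zeta>
      have "(\<Sum>g\<in>G. cnj (mindex_power (z g) \<eta>) * (a \<zeta> * mindex_power (z g) \<zeta>))
          = a \<zeta> * (\<Sum>g\<in>G. \<Prod>i\<in>UNIV. r N (g i) ^ \<zeta> i * cnj (r N (g i)) ^ \<eta> i)"
        by (simp add: mindex_power_def z_def sum_distrib_left prod.distrib mult_ac)
      also have "(\<Sum>g\<in>G. \<Prod>i\<in>UNIV. r N (g i) ^ \<zeta> i * cnj (r N (g i)) ^ \<eta> i)
          = (\<Prod>i\<in>UNIV. \<Sum>k<N. r N k ^ \<zeta> i * cnj (r N k) ^ \<eta> i)"
        unfolding G_def by (rule prod_sum_PiE[symmetric]) auto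
      also have "\<dots> = (\<Prod>i\<in>UNIV. if \<zeta> i mod N = \<eta> i mod N then of_nat N else 0)"
        unfolding r_def by (subst sum_roots_of_unity) (auto simp: N_def)
      also have "\<dots> = (if \<forall>i. \<zeta> i mod N = \<eta> i mod N then of_nat N ^ CARD('n) else 0)"
        by (auto intro: prod_zero)
      finally show "(\<Sum>g\<in>G. cnj (mindex_power (z g) \<eta>) * (a \<zeta> * mindex_power (z g) \<zeta>))
        = of_nat N ^ CARD('n) * b N \<zeta>"
        by (simp add: b_def)
    qed
    finally have "infsum (\<lambda>\<zeta>. of_nat N ^ CARD('n) * b N \<zeta>) UNIV
        = (\<Sum>g\<in>G. cnj (mindex_power (z g) \<eta>) * f (z g))"
      by (rule infsumI)
    hence eq: "of_nat N ^ CARD('n) * infsum (b N) UNIV = (\<Sum>g\<in>G. cnj (mindex_power (z g) \<eta>) * f (z g))"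
      by (subst infsum_cmult_right'[symmetric])
    have "cmod (\<Sum>g\<in>G. cnj (mindex_power (z g) \<eta>) * f (z g)) \<le> (\<Sum>g\<in>G. M)"
    proof (intro sum_norm_le)
      fix g
      have "cmod (mindex_power (z g) \<eta>) = 1"
        by (simp add: norm_mindex_power z_def r_def)
      thus "cmod (cnj (mindex_power (z g) \<eta>) * f (z g)) \<le> M"
        using M[of "z g"] by (simp add: norm_mult z_def r_def)
    qed
    hence "real N ^ CARD('n) * cmod (infsum (b N) UNIV) \<le> real N ^ CARD('n) * M"
      unfolding eq[symmetric] by (simp add: norm_mult norm_power cardG)
    thus ?thesis by (simp add: N_def)
  qed
  have "(\<lambda>n. infsum (b n) UNIV) \<longlonglongrightarrow> infsum (\<lambda>\<zeta>. if \<zeta> = \<eta> then a \<zeta> else 0) UNIV"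
  proof (rule infsum_tendsto_dominated[OF asum])
    show "norm (b n \<zeta>) \<le> norm (a \<zeta>)" for n \<zeta> by (simp add: b_def)
    fix \<zeta>
    \<comment> \<open>Once the modulus exceeds every entry of both multi-indices, congruence means
      equality.\<close>
    define L where "L = Max (range (\<lambda>i. \<zeta> i + \<eta> i))"
    have "\<zeta> i + \<eta> i \<le> L" for i
      unfolding L_def by (rule Max_ge) auto
    hence L: "\<zeta> i \<le> L" "\<eta> i \<le> L" for i
      by (meson add_leE)+
    have "\<forall>\<^sub>F n in sequentially. n > L" by (rule eventually_gt_at_top)
    hence "\<forall>\<^sub>F n in sequentially. b n \<zeta> = (if \<zeta> = \<eta> then a \<zeta> else 0)"
    proof eventually_elim
      case (elim n)
      hence "\<zeta> i mod n = \<zeta> i" "\<eta> i mod n = \<eta> i" for i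
        using L[of i] by auto
      thus ?case by (simp add: b_def fun_eq_iff)
    qed
    thus "(\<lambda>n. b n \<zeta>) \<longlonglongrightarrow> (if \<zeta> = \<eta> then a \<zeta> else 0)"
      by (rule tendsto_eventually)
  qed
  also have "infsum (\<lambda>\<zeta>. if \<zeta> = \<eta> then a \<zeta> else 0) UNIV = infsum (\<lambda>\<zeta>. if \<zeta> = \<eta> then a \<zeta> else 0) {\<eta>}"
    by (intro infsum_cong_neutral) auto
  also have "\<dots> = a \<eta>" by simp
  finally have "(\<lambda>n. infsum (b (Suc n)) UNIV) \<longlonglongrightarrow> a \<eta>"
    by (rule LIMSEQ_Suc)
  from tendsto_norm[OF this] show ?thesis
    by (rule LIMSEQ_le_const2) (use bound in auto)
qed

lemma has_power_series_diff:
  assumes "has_power_series f a" "has_power_series g b"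
  shows "has_power_series (\<lambda>z. f z - g z) (\<lambda>\<eta>. a \<eta> - b \<eta>)"
  unfolding has_power_series_def
proof
  fix z
  have "((\<lambda>\<eta>. a \<eta> * mindex_power z \<eta> + - (b \<eta> * mindex_power z \<eta>)) has_sum (f z + - g z)) UNIV"
    using assms unfolding has_power_series_def by (intro has_sum_add has_sum_uminusI) auto
  thus "((\<lambda>\<eta>. (a \<eta> - b \<eta>) * mindex_power z \<eta>) has_sum (f z - g z)) UNIV"
    by (simp add: algebra_simps)
qed

text \<open>The Cauchy bound with M = 0, applied to the difference. This is what gives the definite
  description in \<open>power_series_coeff\<close> its meaning.\<close>

lemma has_power_series_unique:
  assumes "has_power_series f a" "has_power_series f b"
  shows "a = b"
proof
  fix \<eta>
  have "cmod (a \<eta> - b \<eta>) \<le> 0"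
    by (rule Cauchy_coefficient_bound[OF has_power_series_diff[OF assms]]) auto
  thus "a \<eta> = b \<eta>" by simp
qed

lemma power_series_coeff_eq:
  assumes "has_power_series f a"
  shows "power_series_coeff f = a"
  unfolding power_series_coeff_def
  using assms has_power_series_unique by blast

section \<open>Polynomial functions in several variables\<close>

lemma polynomial_fun_sum_monomials:
  fixes C :: "'s \<Rightarrow> complex" and E :: "'s \<Rightarrow> 'n::finite \<Rightarrow> nat"
  assumes fin: "finite S"
  shows "polynomial_fun (\<lambda>z. \<Sum>s\<in>S. C s * mindex_power z (E s))"
  unfolding polynomial_fun_def
proof (intro exI conjI ext)
  show "finite (E ` S)" using fin by simp
  fix z
  show "(\<Sum>s\<in>S. C s * mindex_power z (E s))
      = (\<Sum>\<eta>\<in>E ` S. (\<Sum>s | s \<in> S \<and> E s = \<eta>. C s) * mindex_power z \<eta>)"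
    by (subst sum.image_gen[OF fin, of _ E]) (auto simp: sum_distrib_right intro!: sum.cong)
qed

lemma polynomial_fun_const: "polynomial_fun (\<lambda>z. c)"
  using polynomial_fun_sum_monomials[of "{()}" "\<lambda>_. c" "\<lambda>_ _. 0"]
  by (simp add: mindex_power_def)

lemma polynomial_fun_coord: "polynomial_fun (\<lambda>z :: complex ^ 'n::finite. z $ i)"
proof -
  have "mindex_power z (\<lambda>j. if j = i then 1 else 0) = z $ i" for z :: "complex ^ 'n"
    by (simp add: mindex_power_def if_distrib cong: if_cong)
  thus ?thesis
    using polynomial_fun_sum_monomials[of "{()}" "\<lambda>_. 1" "\<lambda>_ j. if j = i then 1 else 0"] by simp
qed

lemma polynomial_fun_add:
  assumes "polynomial_fun p" "polynomial_fun q"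
  shows "polynomial_fun (\<lambda>z. p z + q z)"
proof -
  from assms obtain A c B d where fin: "finite A" "finite B"
    and pq: "p = (\<lambda>z. \<Sum>\<eta>\<in>A. c \<eta> * mindex_power z \<eta>)" "q = (\<lambda>z. \<Sum>\<eta>\<in>B. d \<eta> * mindex_power z \<eta>)"
    unfolding polynomial_fun_def by auto
  have "(\<lambda>z. p z + q z) = (\<lambda>z. \<Sum>s\<in>A <+> B. case_sum c d s * mindex_power z (case_sum id id s))"
    using fin by (simp add: pq sum.Plus)
  thus ?thesis
    using polynomial_fun_sum_monomials[of "A <+> B" "case_sum c d" "case_sum id id"] fin by simp
qed

lemma mindex_power_add: "mindex_power z (\<lambda>i. \<eta> i + \<zeta> i) = mindex_power z \<eta> * mindex_power z \<zeta>"
  by (simp add: mindex_power_def power_add prod.distrib)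

lemma polynomial_fun_mult:
  assumes "polynomial_fun p" "polynomial_fun q"
  shows "polynomial_fun (\<lambda>z. p z * q z)"
proof -
  from assms obtain A c B d where fin: "finite A" "finite B"
    and pq: "p = (\<lambda>z. \<Sum>\<eta>\<in>A. c \<eta> * mindex_power z \<eta>)" "q = (\<lambda>z. \<Sum>\<eta>\<in>B. d \<eta> * mindex_power z \<eta>)"
    unfolding polynomial_fun_def by auto
  have "(\<lambda>z. p z * q z)
      = (\<lambda>z. \<Sum>s\<in>A \<times> B. (c (fst s) * d (snd s)) * mindex_power z (\<lambda>i. fst s i + snd s i))"
    by (simp add: pq sum_product sum.cartesian_product mindex_power_add case_prod_unfold mult_ac)
  thus ?thesis
    using polynomial_fun_sum_monomials[of "A \<times> B" "\<lambda>s. c (fst s) * d (snd s)" "\<lambda>s i. fst s i + snd s i"]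
      fin by simp
qed

lemma polynomial_fun_sum:
  assumes "\<And>i. i \<in> I \<Longrightarrow> polynomial_fun (p i)"
  shows "polynomial_fun (\<lambda>z. \<Sum>i\<in>I. p i z)"
  using assms
  by (induction I rule: infinite_finite_induct) (auto intro: polynomial_fun_const polynomial_fun_add)

lemma polynomial_fun_power: "polynomial_fun p \<Longrightarrow> polynomial_fun (\<lambda>z. p z ^ k)"
  by (induction k) (auto intro: polynomial_fun_const polynomial_fun_mult)

lemma polynomial_fun_prod:
  assumes "\<And>i. i \<in> I \<Longrightarrow> polynomial_fun (p i)"
  shows "polynomial_fun (\<lambda>z. \<Prod>i\<in>I. p i z)"
  using assms
  by (induction I rule: infinite_finite_induct) (auto intro: polynomial_fun_const polynomial_fun_mult)

lemma polynomial_fun_subst: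
  assumes "polynomial_fun p" and "\<And>i. polynomial_fun (g i)"
  shows "polynomial_fun (\<lambda>w. p (\<chi> i. g i w))"
proof -
  from assms obtain A c where "finite A" and p: "p = (\<lambda>z. \<Sum>\<eta>\<in>A. c \<eta> * mindex_power z \<eta>)"
    unfolding polynomial_fun_def by auto
  show ?thesis unfolding p mindex_power_def vec_lambda_beta
    by (intro polynomial_fun_sum polynomial_fun_mult polynomial_fun_const polynomial_fun_prod
        polynomial_fun_power assms)
qed

lemma has_power_series_finite:
  assumes fin: "finite A" and c: "\<And>\<eta>. \<eta> \<notin> A \<Longrightarrow> c \<eta> = 0"
  shows "has_power_series (\<lambda>z. \<Sum>\<eta>\<in>A. c \<eta> * mindex_power z \<eta>) c"
  unfolding has_power_series_def
  using assms by (auto intro!: has_sum_finite_neutralI)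

lemma polynomial_fun_obtain_coeffs:
  assumes "polynomial_fun p"
  obtains A c where "finite A" "\<And>\<eta>. \<eta> \<notin> A \<Longrightarrow> c \<eta> = 0" "\<And>z. p z = (\<Sum>\<eta>\<in>A. c \<eta> * mindex_power z \<eta>)"
    "has_power_series p c"
proof -
  from assms obtain A c where A: "finite A" and p: "p = (\<lambda>z. \<Sum>\<eta>\<in>A. c \<eta> * mindex_power z \<eta>)"
    unfolding polynomial_fun_def by auto
  \<comment> \<open>Set to 0 off A, so that it is the full coefficient family of p and comparable
    with other power series.\<close>
  define c' where "c' = (\<lambda>\<eta>. if \<eta> \<in> A then c \<eta> else 0)"
  have p': "p = (\<lambda>z. \<Sum>\<eta>\<in>A. c' \<eta> * mindex_power z \<eta>)"
    unfolding p c'_def by (intro ext sum.cong) auto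
  show ?thesis
    by (rule that[of A c'])
       (use A p' has_power_series_finite[OF A, of c'] in \<open>auto simp: c'_def\<close>)
qed

lemma continuous_on_polynomial_fun:
  assumes "polynomial_fun p"
  shows "continuous_on S p"
proof -
  from assms obtain A c where "p = (\<lambda>z. \<Sum>\<eta>\<in>A. c \<eta> * mindex_power z \<eta>)"
    unfolding polynomial_fun_def by auto
  thus ?thesis
    by (auto simp: mindex_power_def intro!: continuous_intros)
qed

section \<open>Polydiscs and approximants with a margin\<close>

lemma norm_vec_le_sum: "norm (z :: 'a::real_normed_vector ^ 'n::finite) \<le> (\<Sum>i\<in>UNIV. norm (z $ i))"
  unfolding norm_vec_def by (rule L2_set_le_sum) auto

definition polydisc :: "real \<Rightarrow> (complex ^ 'n::finite) set" where
  "polydisc R = {z. \<forall>i. cmod (z $ i) \<le> R}"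

lemma compact_polydisc: "compact (polydisc R :: (complex ^ 'n::finite) set)"
proof -
  have "bounded (polydisc R :: (complex ^ 'n) set)"
  proof (rule boundedI)
    fix z :: "complex ^ 'n" assume "z \<in> polydisc R"
    hence "(\<Sum>i\<in>UNIV. norm (z $ i)) \<le> (\<Sum>i\<in>(UNIV :: 'n set). R)"
      by (intro sum_mono) (auto simp: polydisc_def)
    thus "norm z \<le> (\<Sum>i\<in>(UNIV :: 'n set). R)"
      using norm_vec_le_sum[of z] by linarith
  qed
  moreover have "closed (polydisc R :: (complex ^ 'n) set)"
    unfolding polydisc_def by (intro closed_Collect_all closed_Collect_le continuous_intros)
  ultimately show ?thesis by (simp add: compact_eq_bounded_closed)
qed

lemma compact_subset_polydisc:
  fixes K :: "(complex ^ 'n::finite) set"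
  assumes "compact K"
  obtains R where "R \<ge> 0" "K \<subseteq> polydisc R"
proof -
  obtain B where B: "\<And>z. z \<in> K \<Longrightarrow> norm z \<le> B"
    using compact_imp_bounded[OF assms] by (auto simp: bounded_iff)
  have "K \<subseteq> polydisc \<bar>B\<bar>"
  proof
    fix z assume "z \<in> K"
    have "cmod (z $ i) \<le> \<bar>B\<bar>" for i
      using Finite_Cartesian_Product.norm_nth_le[of z i] B[OF \<open>z \<in> K\<close>] by linarith
    thus "z \<in> polydisc \<bar>B\<bar>" by (simp add: polydisc_def)
  qed
  thus ?thesis using that[of "\<bar>B\<bar>"] by simp
qed

text \<open>Evaluating the approximants at z + 1 / Suc j extends their zero-free region beyond the
  imaginary axis, as truncation requires. The translates still converge to f uniformly on the unit
  torus, because f is uniformly continuous on compact sets, and the Cauchy bound passes this on to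
  the coefficients.\<close>

lemma LY_strict_approximation:
  fixes f :: "complex ^ 'n::finite \<Rightarrow> complex"
  assumes "f \<in> LY" and f: "has_power_series f a"
  obtains A :: "nat \<Rightarrow> ('n \<Rightarrow> nat) set" and c :: "nat \<Rightarrow> ('n \<Rightarrow> nat) \<Rightarrow> complex"
  where "\<And>j. finite (A j)" "\<And>j \<eta>. \<eta> \<notin> A j \<Longrightarrow> c j \<eta> = 0"
    "\<And>j z. \<forall>i. Re (z i) > - (1 / real (Suc j)) \<Longrightarrow> (\<Sum>\<eta>\<in>A j. c j \<eta> * (\<Prod>i\<in>UNIV. z i ^ \<eta> i)) \<noteq> 0"
    "\<And>\<eta>. (\<lambda>j. c j \<eta>) \<longlonglongrightarrow> a \<eta>"
proof -
  from \<open>f \<in> LY\<close> obtain p :: "nat \<Rightarrow> complex ^ 'n \<Rightarrow> complex"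
    where p: "\<And>j. polynomial_fun (p j)" "\<And>j z. (\<forall>i. Re (z $ i) > 0) \<Longrightarrow> p j z \<noteq> 0"
      "\<And>K. compact K \<Longrightarrow> uniform_limit K p f sequentially"
    unfolding LY_def by blast
  define e where "e = (\<lambda>j. 1 / real (Suc j))"
  define sh where "sh = (\<lambda>j (z :: complex ^ 'n). (\<chi> i. z $ i + of_real (e j)) :: complex ^ 'n)"
  define q where "q = (\<lambda>j z. p j (sh j z))"
  have q: "polynomial_fun (q j)" for j
    unfolding q_def sh_def
    by (rule polynomial_fun_subst[OF p(1)])
       (rule polynomial_fun_add[OF polynomial_fun_coord polynomial_fun_const])
  have "\<forall>j. \<exists>A c. finite A \<and> (\<forall>\<eta>. \<eta> \<notin> A \<longrightarrow> c \<eta> = 0)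
      \<and> (\<forall>z. q j z = (\<Sum>\<eta>\<in>A. c \<eta> * mindex_power z \<eta>)) \<and> has_power_series (q j) c"
    (is "\<forall>j. \<exists>A c. ?P j A c")
  proof
    fix j
    obtain A c where "?P j A c"
      by (rule polynomial_fun_obtain_coeffs[OF q[of j]]) auto
    thus "\<exists>A c. ?P j A c" by blast
  qed
  from choice[OF this] obtain A where "\<forall>j. \<exists>c. ?P j (A j) c" ..
  from choice[OF this] obtain c where "\<forall>j. ?P j (A j) (c j)" ..
  hence Ac: "\<And>j. finite (A j)" "\<And>j \<eta>. \<eta> \<notin> A j \<Longrightarrow> c j \<eta> = 0"
      "\<And>j z. q j z = (\<Sum>\<eta>\<in>A j. c j \<eta> * mindex_power z \<eta>)" "\<And>j. has_power_series (q j) (c j)"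
    by auto
  \<comment> \<open>Radius 2 leaves room for the unit torus translated by at most 1.\<close>
  have cont: "continuous_on (polydisc 2) f"
  proof (rule uniform_limit_theorem[OF _ p(3)[OF compact_polydisc]])
    show "\<forall>\<^sub>F j in sequentially. continuous_on (polydisc 2) (p j)"
      by (intro always_eventually allI continuous_on_polynomial_fun p)
  qed auto
  have "(\<lambda>j. c j \<eta>) \<longlonglongrightarrow> a \<eta>" for \<eta>
  proof (rule LIMSEQ_I)
    fix \<epsilon> :: real assume \<epsilon>: "\<epsilon> > 0"
    have "uniformly_continuous_on (polydisc 2) f"
      by (rule compact_uniformly_continuous[OF cont compact_polydisc])
    then obtain d where d: "d > 0" "\<And>x y. x \<in> polydisc 2 \<Longrightarrow> y \<in> polydisc 2 \<Longrightarrow> dist y x < d \<Longrightarrow>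
        dist (f y) (f x) < \<epsilon> / 4"
      unfolding uniformly_continuous_on_def using \<epsilon> by (metis zero_less_divide_iff zero_less_numeral)
    have ev1: "\<forall>\<^sub>F j in sequentially. \<forall>z\<in>polydisc 2. dist (p j z) (f z) < \<epsilon> / 4"
      using p(3)[OF compact_polydisc] \<epsilon> by (intro uniform_limitD) auto
    have "(\<lambda>j. real CARD('n) * e j) \<longlonglongrightarrow> 0"
      unfolding e_def by real_asymp
    hence ev2: "\<forall>\<^sub>F j in sequentially. real CARD('n) * e j < d"
      using d(1) by (rule order_tendstoD)
    have "\<forall>\<^sub>F j in sequentially. norm (c j \<eta> - a \<eta>) < \<epsilon>"
      using ev1 ev2
    proof eventually_elim
      case (elim j)
      have "cmod (c j \<eta> - a \<eta>) \<le> \<epsilon> / 2"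
      proof (rule Cauchy_coefficient_bound[OF has_power_series_diff[OF Ac(4) f]])
        fix z :: "complex ^ 'n" assume z: "\<And>i. cmod (z $ i) = 1"
        have e: "0 \<le> e j" "e j \<le> 1" by (auto simp: e_def)
        have z2: "z \<in> polydisc 2" using z by (simp add: polydisc_def)
        have "cmod (z $ i + of_real (e j)) \<le> 2" for i
          using norm_triangle_ineq[of "z $ i" "of_real (e j)"] z[of i] e by simp
        hence s2: "sh j z \<in> polydisc 2" by (simp add: polydisc_def sh_def)
        have "norm (sh j z - z) \<le> (\<Sum>i\<in>UNIV. norm ((sh j z - z) $ i))"
          by (rule norm_vec_le_sum)
        also have "\<dots> = real CARD('n) * e j" using e by (simp add: sh_def)
        finally have "dist (sh j z) z < d" using elim by (simp add: dist_norm)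
        hence "dist (f (sh j z)) (f z) < \<epsilon> / 4" using d(2) z2 s2 by blast
        moreover have "dist (q j z) (f (sh j z)) < \<epsilon> / 4"
          using elim s2 by (simp add: q_def)
        ultimately have "dist (q j z) (f z) < \<epsilon> / 2"
          using dist_triangle[of "q j z" "f z" "f (sh j z)"] by linarith
        thus "cmod (q j z - f z) \<le> \<epsilon> / 2" by (simp add: dist_norm)
      qed
      thus ?case using \<epsilon> by simp
    qed
    thus "\<exists>n0. \<forall>j\<ge>n0. norm (c j \<eta> - a \<eta>) < \<epsilon>"
      by (simp add: eventually_sequentially)
  qed
  moreover have "(\<Sum>\<eta>\<in>A j. c j \<eta> * (\<Prod>i\<in>UNIV. z i ^ \<eta> i)) \<noteq> 0"
    if "\<forall>i. Re (z i) > - (1 / real (Suc j))" for j z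
  proof -
    have "Re (z i) + e j > 0" for i
      using that[rule_format, of i] unfolding e_def by linarith
    hence "q j (\<chi> i. z i) \<noteq> 0"
      unfolding q_def by (intro p) (auto simp: sh_def)
    thus ?thesis by (simp add: Ac(3) mindex_power_def)
  qed
  ultimately show ?thesis
    using that[of A c] Ac by blast
qed

section \<open>Contraction in the Lee--Yang class\<close>

lemma prod_UNIV_sum_type:
  fixes f :: "'a::finite + 'b::finite \<Rightarrow> 'c::comm_monoid_mult"
  shows "(\<Prod>i\<in>UNIV. f i) = (\<Prod>i\<in>UNIV. f (Inl i)) * (\<Prod>j\<in>UNIV. f (Inr j))"
  by (simp add: prod.Plus flip: UNIV_Plus_UNIV)

text \<open>The sum over multi-indices factors into one-variable sums; multi-indices are viewed as a
  product of copies of the natural numbers over the finite index type.\<close>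

lemma summable_on_multi_index_prod:
  fixes \<phi> :: "'n::finite \<Rightarrow> nat \<Rightarrow> real"
  assumes "\<And>i. summable (\<phi> i)" and "\<And>i k. 0 \<le> \<phi> i k"
  shows "(\<lambda>\<eta>. \<Prod>i\<in>UNIV. \<phi> i (\<eta> i)) summable_on UNIV"
proof -
  have "Infinite_Set_Sum.abs_summable_on (\<phi> i) UNIV" for i
    using assms by (simp add: abs_summable_on_nat_iff')
  hence "Infinite_Set_Sum.abs_summable_on (\<lambda>\<eta>. \<Prod>i\<in>UNIV. \<phi> i (\<eta> i)) (PiE UNIV (\<lambda>_. UNIV))"
    by (intro abs_summable_on_prod_PiE) auto
  moreover have "PiE (UNIV :: 'n set) (\<lambda>_. UNIV :: nat set) = UNIV" by simp
  ultimately have "Infinite_Set_Sum.abs_summable_on (\<lambda>\<eta>. \<Prod>i\<in>UNIV. \<phi> i (\<eta> i)) UNIV"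
    by simp
  hence "(\<lambda>\<eta>. norm (\<Prod>i\<in>UNIV. \<phi> i (\<eta> i))) summable_on UNIV"
    by (rule abs_summable_equivalent[THEN iffD2])
  thus ?thesis using assms by (simp add: prod_nonneg)
qed

text \<open>On a polydisc of radius R the two functions differ by at most the sum of |b j \<eta> - a
  \<eta>| R^\<eta>, which tends to 0 by dominated convergence. Membership in the class can thus be
  proved from limits and bounds of single coefficients.\<close>

lemma LY_I:
  fixes f :: "complex ^ 'n::finite \<Rightarrow> complex" and p :: "nat \<Rightarrow> complex ^ 'n \<Rightarrow> complex"
  assumes f: "has_power_series f a" and p: "\<And>j. has_power_series (p j) (b j)"
    and poly: "\<And>j. polynomial_fun (p j)"
    and nz: "\<And>j z. (\<forall>i. Re (z $ i) > 0) \<Longrightarrow> p j z \<noteq> 0"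
    and bound: "\<And>j \<eta>. cmod (b j \<eta>) \<le> g \<eta>"
    and g: "\<And>R. R \<ge> 0 \<Longrightarrow> (\<lambda>\<eta>. g \<eta> * (\<Prod>i\<in>UNIV. R ^ \<eta> i)) summable_on UNIV"
    and lim: "\<And>\<eta>. (\<lambda>j. b j \<eta>) \<longlonglongrightarrow> a \<eta>"
  shows "f \<in> LY"
proof -
  have a: "cmod (a \<eta>) \<le> g \<eta>" for \<eta>
    by (rule LIMSEQ_le_const2[OF tendsto_norm[OF lim]]) (use bound in auto)
  have "uniform_limit K p f sequentially" if K: "compact K" for K
  proof -
    obtain R where R: "R \<ge> 0" "K \<subseteq> polydisc R"
      by (rule compact_subset_polydisc[OF K])
    define r where "r = (\<lambda>\<eta> :: 'n \<Rightarrow> nat. \<Prod>i\<in>UNIV. R ^ \<eta> i)"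
    have r: "r \<eta> \<ge> 0" for \<eta> using R by (simp add: r_def prod_nonneg)
    have le: "cmod (b j \<eta> - a \<eta>) * r \<eta> \<le> 2 * (g \<eta> * r \<eta>)" for j \<eta>
    proof -
      have "cmod (b j \<eta> - a \<eta>) \<le> 2 * g \<eta>"
        using norm_triangle_ineq4[of "b j \<eta>" "a \<eta>"] bound[of j \<eta>] a[of \<eta>] by linarith
      from mult_right_mono[OF this r[of \<eta>]] show ?thesis by simp
    qed
    have g2: "(\<lambda>\<eta>. 2 * (g \<eta> * r \<eta>)) summable_on UNIV"
      unfolding r_def by (intro summable_on_cmult_right g R)
    have d: "(\<lambda>\<eta>. cmod (b j \<eta> - a \<eta>) * r \<eta>) summable_on UNIV" for j
      by (rule summable_on_comparison_test[OF g2]) (use le r in auto)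
    have lim0: "(\<lambda>j. \<Sum>\<^sub>\<infinity>\<eta>. cmod (b j \<eta> - a \<eta>) * r \<eta>) \<longlonglongrightarrow> 0"
    proof (rule infsum_tendsto_0_dominated[OF g2 _ le])
      fix \<eta>
      have "(\<lambda>j. cmod (b j \<eta> - a \<eta>) * r \<eta>) \<longlonglongrightarrow> cmod (a \<eta> - a \<eta>) * r \<eta>"
        by (intro tendsto_intros lim)
      thus "(\<lambda>j. cmod (b j \<eta> - a \<eta>) * r \<eta>) \<longlonglongrightarrow> 0" by simp
    qed (use r in auto)
    have est: "cmod (p j z - f z) \<le> (\<Sum>\<^sub>\<infinity>\<eta>. cmod (b j \<eta> - a \<eta>) * r \<eta>)" if "z \<in> K" for j z
    proof -
      have "has_power_series (\<lambda>z. p j z - f z) (\<lambda>\<eta>. b j \<eta> - a \<eta>)"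
        by (rule has_power_series_diff[OF p f])
      hence *: "((\<lambda>\<eta>. (b j \<eta> - a \<eta>) * mindex_power z \<eta>) has_sum (p j z - f z)) UNIV"
        by (simp add: has_power_series_def)
      have "cmod (mindex_power z \<eta>) \<le> r \<eta>" for \<eta>
        unfolding norm_mindex_power r_def
        using R \<open>z \<in> K\<close> by (intro prod_mono) (auto simp: polydisc_def intro!: power_mono)
      hence le2: "cmod ((b j \<eta> - a \<eta>) * mindex_power z \<eta>) \<le> cmod (b j \<eta> - a \<eta>) * r \<eta>" for \<eta>
        by (simp add: norm_mult mult_left_mono)
      have s: "(\<lambda>\<eta>. cmod ((b j \<eta> - a \<eta>) * mindex_power z \<eta>)) summable_on UNIV"
        by (rule summable_on_comparison_test[OF d]) (use le2 in auto)
      have "cmod (p j z - f z) \<le> (\<Sum>\<^sub>\<infinity>\<eta>. cmod ((b j \<eta> - a \<eta>) * mindex_power z \<eta>))"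
        using norm_infsum_bound[OF s] infsumI[OF *] by simp
      also have "\<dots> \<le> (\<Sum>\<^sub>\<infinity>\<eta>. cmod (b j \<eta> - a \<eta>) * r \<eta>)"
        by (intro infsum_mono s d le2)
      finally show ?thesis .
    qed
    show ?thesis
    proof (rule uniform_limitI)
      fix e :: real assume "e > 0"
      with lim0 have "\<forall>\<^sub>F j in sequentially. (\<Sum>\<^sub>\<infinity>\<eta>. cmod (b j \<eta> - a \<eta>) * r \<eta>) < e"
        by (intro order_tendstoD) auto
      thus "\<forall>\<^sub>F j in sequentially. \<forall>z\<in>K. dist (p j z) (f z) < e"
        by eventually_elim (auto simp: dist_norm intro: le_less_trans[OF est])
    qed
  qed
  moreover have "entire f" using f by (auto simp: entire_def)
  ultimately show ?thesis
    unfolding LY_def using poly nz by (intro CollectI conjI exI[of _ p]) auto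
qed

section \<open>Multi-index boxes and the contracted polynomial\<close>

definition mindex_box :: "nat \<Rightarrow> ('n::finite \<Rightarrow> nat) set" where
  "mindex_box N = {\<eta>. \<forall>i. \<eta> i \<le> N}"

lemma finite_mindex_box: "finite (mindex_box N :: ('n::finite \<Rightarrow> nat) set)"
proof -
  have "(mindex_box N :: ('n \<Rightarrow> nat) set) = PiE UNIV (\<lambda>_. {..N})"
    by (auto simp: mindex_box_def PiE_UNIV_domain)
  thus ?thesis by (simp add: finite_PiE)
qed

lemma case_sum_comp_Inl_Inr: "case_sum (\<zeta> \<circ> Inl) (\<zeta> \<circ> Inr) = \<zeta>"
  unfolding o_def by (rule surjective_sum)

lemma mem_mindex_box_sum_type:
  "\<zeta> \<in> mindex_box N \<longleftrightarrow> \<zeta> \<circ> Inl \<in> mindex_box N \<and> \<zeta> \<circ> Inr \<in> mindex_box N"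
  unfolding mindex_box_def by (auto simp: split_sum_all)

lemma sum_mindex_box_sum_type:
  fixes F :: "('a::finite + 'b::finite \<Rightarrow> nat) \<Rightarrow> 'c::comm_monoid_add"
  shows "(\<Sum>\<zeta>\<in>mindex_box N. F \<zeta>) = (\<Sum>\<kappa>\<in>mindex_box N. \<Sum>\<xi>\<in>mindex_box N. F (case_sum \<kappa> \<xi>))"
proof -
  have "(\<Sum>\<zeta>\<in>mindex_box N. F \<zeta>)
      = (\<Sum>s\<in>mindex_box N \<times> mindex_box N. F (case_sum (fst s) (snd s)))"
    by (rule sum.reindex_bij_witness[of _ "\<lambda>s. case_sum (fst s) (snd s)" "\<lambda>\<zeta>. (\<zeta> \<circ> Inl, \<zeta> \<circ> Inr)"])
       (auto simp: mindex_box_def case_sum_comp_Inl_Inr split: sum.splits)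
  thus ?thesis by (simp add: sum.cartesian_product case_prod_unfold)
qed

definition mindex_weight :: "nat \<Rightarrow> ('n::finite \<Rightarrow> nat) \<Rightarrow> real" where
  "mindex_weight N \<eta> = (\<Prod>i\<in>UNIV. trunc_weight N (\<eta> i))"

lemma mindex_weight_nonneg: "0 \<le> mindex_weight N \<eta>"
  by (simp add: mindex_weight_def prod_nonneg trunc_weight_nonneg)

lemma mindex_weight_le_1: "mindex_weight N \<eta> \<le> 1"
  by (simp add: mindex_weight_def prod_le_1 trunc_weight_nonneg trunc_weight_le_1)

lemma mindex_weight_eq_0: "\<eta> \<notin> mindex_box N \<Longrightarrow> mindex_weight N \<eta> = 0"
  unfolding mindex_weight_def mindex_box_def
  by (auto simp: not_le intro!: prod_zero trunc_weight_eq_0)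

lemma mindex_weight_tendsto: "(\<lambda>N. mindex_weight N \<eta>) \<longlonglongrightarrow> 1"
proof -
  have "(\<lambda>N. mindex_weight N \<eta>) \<longlonglongrightarrow> (\<Prod>i\<in>(UNIV :: 'a set). 1)"
    unfolding mindex_weight_def by (intro tendsto_prod trunc_weight_tendsto)
  thus ?thesis by simp
qed

lemma mindex_weight_case_sum:
  "mindex_weight N (case_sum \<kappa> \<xi>) = mindex_weight N \<kappa> * mindex_weight N \<xi>"
  by (simp add: mindex_weight_def prod_UNIV_sum_type)

text \<open>Both factors are truncated to exponents at most \<open>N\<close>; then the variables of the middle
  block are contracted, with the shift \<open>\<delta>\<close> in place of evaluation at \<open>0\<close>.\<close>

definition contracted_coeff ::
  "nat \<Rightarrow> complex \<Rightarrow> (('k::finite + 'm::finite \<Rightarrow> nat) \<Rightarrow> complex) \<Rightarrow> (('m + 'n::finite \<Rightarrow> nat) \<Rightarrow> complex) \<Rightarrow>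
     ('k + 'n \<Rightarrow> nat) \<Rightarrow> complex" where
  "contracted_coeff N \<delta> c d \<zeta> = (\<Sum>\<eta>\<in>mindex_box N. \<Sum>\<theta>\<in>mindex_box N.
      c (case_sum (\<zeta> \<circ> Inl) \<eta>) * of_real (mindex_weight N (case_sum (\<zeta> \<circ> Inl) \<eta>)) *
      (d (case_sum \<theta> (\<zeta> \<circ> Inr)) * of_real (mindex_weight N (case_sum \<theta> (\<zeta> \<circ> Inr)))) *
      (\<Prod>i\<in>UNIV. pairing_weight \<delta> (\<eta> i) (\<theta> i)))"

lemma contracted_coeff_outside:
  assumes "\<zeta> \<notin> mindex_box N"
  shows "contracted_coeff N \<delta> c d \<zeta> = 0"
proof -
  have "mindex_weight N (\<zeta> \<circ> Inl) = 0 \<or> mindex_weight N (\<zeta> \<circ> Inr) = 0"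
    using assms mindex_weight_eq_0[of "\<zeta> \<circ> Inl" N] mindex_weight_eq_0[of "\<zeta> \<circ> Inr" N]
    unfolding mem_mindex_box_sum_type by blast
  thus ?thesis
    unfolding contracted_coeff_def mindex_weight_case_sum by (intro sum.neutral ballI) auto
qed

text \<open>The coefficients are supported in D and the weights in the box, so the truncated sum may
  be taken over either; with the box, the index set no longer depends on the polynomial.\<close>

lemma mindex_truncation_nonzero:
  fixes a :: "('n::finite \<Rightarrow> nat) \<Rightarrow> complex"
  assumes fin: "finite D" and a0: "\<And>\<eta>. \<eta> \<notin> D \<Longrightarrow> a \<eta> = 0"
    and \<epsilon>: "\<epsilon> > 0" and N: "N > 0"
    and a: "\<And>z. (\<And>i. Re (z i) > - \<epsilon>) \<Longrightarrow> (\<Sum>\<eta>\<in>D. a \<eta> * (\<Prod>i\<in>UNIV. z i ^ \<eta> i)) \<noteq> 0"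
    and v: "\<And>i. Re (v i) > 0"
  shows "(\<Sum>\<eta>\<in>mindex_box N. a \<eta> * of_real (mindex_weight N \<eta>) * (\<Prod>i\<in>UNIV. v i ^ \<eta> i)) \<noteq> 0"
proof -
  have "(\<Sum>\<eta>\<in>D. a \<eta> * of_real (mindex_weight N \<eta>) * (\<Prod>i\<in>UNIV. v i ^ \<eta> i)) \<noteq> 0"
    unfolding mindex_weight_def by (rule multi_truncation_nonzero[OF fin \<epsilon> N a v])
  also have "(\<Sum>\<eta>\<in>D. a \<eta> * of_real (mindex_weight N \<eta>) * (\<Prod>i\<in>UNIV. v i ^ \<eta> i))
      = (\<Sum>\<eta>\<in>D \<union> mindex_box N. a \<eta> * of_real (mindex_weight N \<eta>) * (\<Prod>i\<in>UNIV. v i ^ \<eta> i))"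
    using fin a0 by (intro sum.mono_neutral_left) (auto simp: finite_mindex_box)
  also have "\<dots> = (\<Sum>\<eta>\<in>mindex_box N. a \<eta> * of_real (mindex_weight N \<eta>) * (\<Prod>i\<in>UNIV. v i ^ \<eta> i))"
    using fin by (intro sum.mono_neutral_right) (auto simp: finite_mindex_box mindex_weight_eq_0)
  finally show ?thesis .
qed

text \<open>The product of the two truncated polynomials, with separate copies x and y of the middle
  block, is zero-free because each factor is. The outer variables are frozen at z and go into the
  coefficients; pairing x i with y i then contracts the middle block.\<close>

lemma contracted_nonzero:
  fixes c :: "('k::finite + 'm::finite \<Rightarrow> nat) \<Rightarrow> complex" and d :: "('m + 'n::finite \<Rightarrow> nat) \<Rightarrow> complex"
  assumes A: "finite A" "\<And>\<eta>. \<eta> \<notin> A \<Longrightarrow> c \<eta> = 0" and B: "finite B" "\<And>\<eta>. \<eta> \<notin> B \<Longrightarrow> d \<eta> = 0"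
    and \<epsilon>: "\<epsilon> > 0" and N: "N > 0" and \<delta>: "\<delta> > 0"
    and c: "\<And>z. (\<And>i. Re (z i) > - \<epsilon>) \<Longrightarrow> (\<Sum>\<eta>\<in>A. c \<eta> * (\<Prod>i\<in>UNIV. z i ^ \<eta> i)) \<noteq> 0"
    and d: "\<And>z. (\<And>i. Re (z i) > - \<epsilon>) \<Longrightarrow> (\<Sum>\<eta>\<in>B. d \<eta> * (\<Prod>i\<in>UNIV. z i ^ \<eta> i)) \<noteq> 0"
    and z: "\<And>i. Re (z $ i) > 0"
  shows "(\<Sum>\<zeta>\<in>mindex_box N. contracted_coeff N (of_real \<delta>) c d \<zeta> * mindex_power z \<zeta>) \<noteq> 0"
proof -
  define S where "S = (mindex_box N :: ('k + 'm \<Rightarrow> nat) set) \<times> (mindex_box N :: ('m + 'n \<Rightarrow> nat) set)"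
  define u where "u = (\<lambda>\<kappa>. \<Prod>i\<in>UNIV. z $ Inl i ^ \<kappa> i)"
  define w where "w = (\<lambda>\<xi>. \<Prod>i\<in>UNIV. z $ Inr i ^ \<xi> i)"
  define c' where "c' = (\<lambda>\<mu>. c \<mu> * of_real (mindex_weight N \<mu>))"
  define d' where "d' = (\<lambda>\<nu>. d \<nu> * of_real (mindex_weight N \<nu>))"
  define C where "C = (\<lambda>s :: ('k + 'm \<Rightarrow> nat) \<times> ('m + 'n \<Rightarrow> nat).
      c' (fst s) * d' (snd s) * (u (fst s \<circ> Inl) * w (snd s \<circ> Inr)))"
  have "(\<Sum>s\<in>S. C s * (\<Prod>i\<in>UNIV. pairing_weight (of_real \<delta>) (fst s (Inr i)) (snd s (Inl i)))) \<noteq> 0"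
  proof (rule multi_pairing_nonzero[OF _ \<delta>])
    show "finite S" by (simp add: S_def finite_mindex_box)
    fix x y :: "'m \<Rightarrow> complex" assume x: "\<And>i. Re (x i) > 0" and y: "\<And>i. Re (y i) > 0"
    define x' where "x' = case_sum (\<lambda>i. z $ Inl i) x"
    define y' where "y' = case_sum y (\<lambda>i. z $ Inr i)"
    have "Re (x' i) > 0" for i using x z by (auto simp: x'_def split: sum.splits)
    hence 1: "(\<Sum>\<mu>\<in>mindex_box N. c' \<mu> * (\<Prod>i\<in>UNIV. x' i ^ \<mu> i)) \<noteq> 0"
      unfolding c'_def by (intro mindex_truncation_nonzero[OF A \<epsilon> N c])
    have "Re (y' i) > 0" for i using y z by (auto simp: y'_def split: sum.splits)
    hence 2: "(\<Sum>\<nu>\<in>mindex_box N. d' \<nu> * (\<Prod>i\<in>UNIV. y' i ^ \<nu> i)) \<noteq> 0"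
      unfolding d'_def by (intro mindex_truncation_nonzero[OF B \<epsilon> N d])
    have "(\<Sum>s\<in>S. C s * (\<Prod>i\<in>UNIV. x i ^ fst s (Inr i)) * (\<Prod>i\<in>UNIV. y i ^ snd s (Inl i)))
        = (\<Sum>\<mu>\<in>mindex_box N. c' \<mu> * (\<Prod>i\<in>UNIV. x' i ^ \<mu> i)) *
          (\<Sum>\<nu>\<in>mindex_box N. d' \<nu> * (\<Prod>i\<in>UNIV. y' i ^ \<nu> i))"
      unfolding sum_product sum.cartesian_product S_def
      by (intro sum.cong) (auto simp: C_def prod_UNIV_sum_type x'_def y'_def u_def w_def)
    thus "(\<Sum>s\<in>S. C s * (\<Prod>i\<in>UNIV. x i ^ fst s (Inr i)) * (\<Prod>i\<in>UNIV. y i ^ snd s (Inl i))) \<noteq> 0"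
      using 1 2 by simp
  qed
  also have "(\<Sum>s\<in>S. C s * (\<Prod>i\<in>UNIV. pairing_weight (of_real \<delta>) (fst s (Inr i)) (snd s (Inl i))))
      = (\<Sum>\<kappa>\<in>mindex_box N. \<Sum>\<eta>\<in>mindex_box N. \<Sum>\<theta>\<in>mindex_box N. \<Sum>\<xi>\<in>mindex_box N.
          c' (case_sum \<kappa> \<eta>) * d' (case_sum \<theta> \<xi>) * (u \<kappa> * w \<xi>) *
            (\<Prod>i\<in>UNIV. pairing_weight (of_real \<delta>) (\<eta> i) (\<theta> i)))" (is "_ = ?quad")
    by (simp add: S_def C_def sum.cartesian_product' sum_mindex_box_sum_type o_def)
  \<comment> \<open>The exponents \<kappa> and \<xi> that survive the contraction are brought to the
    front.\<close>
  also have "?quad = (\<Sum>\<kappa>\<in>mindex_box N. \<Sum>\<xi>\<in>mindex_box N. \<Sum>\<eta>\<in>mindex_box N. \<Sum>\<theta>\<in>mindex_box N.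
          c' (case_sum \<kappa> \<eta>) * d' (case_sum \<theta> \<xi>) * (u \<kappa> * w \<xi>) *
            (\<Prod>i\<in>UNIV. pairing_weight (of_real \<delta>) (\<eta> i) (\<theta> i)))"
  proof (intro sum.cong refl)
    fix \<kappa>
    define F where "F = (\<lambda>\<eta> \<theta> \<xi>. c' (case_sum \<kappa> \<eta>) * d' (case_sum \<theta> \<xi>) * (u \<kappa> * w \<xi>) *
            (\<Prod>i\<in>UNIV. pairing_weight (of_real \<delta>) (\<eta> i) (\<theta> i)))"
    have "(\<Sum>\<eta>\<in>mindex_box N. \<Sum>\<theta>\<in>mindex_box N. \<Sum>\<xi>\<in>mindex_box N. F \<eta> \<theta> \<xi>)
        = (\<Sum>\<eta>\<in>mindex_box N. \<Sum>\<xi>\<in>mindex_box N. \<Sum>\<theta>\<in>mindex_box N. F \<eta> \<theta> \<xi>)"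
      by (intro sum.cong refl sum.swap)
    also have "\<dots> = (\<Sum>\<xi>\<in>mindex_box N. \<Sum>\<eta>\<in>mindex_box N. \<Sum>\<theta>\<in>mindex_box N. F \<eta> \<theta> \<xi>)"
      by (rule sum.swap)
    finally show "(\<Sum>\<eta>\<in>mindex_box N. \<Sum>\<theta>\<in>mindex_box N. \<Sum>\<xi>\<in>mindex_box N. F \<eta> \<theta> \<xi>)
        = (\<Sum>\<xi>\<in>mindex_box N. \<Sum>\<eta>\<in>mindex_box N. \<Sum>\<theta>\<in>mindex_box N. F \<eta> \<theta> \<xi>)" .
  qed
  also have "\<dots> = (\<Sum>\<zeta>\<in>mindex_box N. contracted_coeff N (of_real \<delta>) c d \<zeta> * mindex_power z \<zeta>)"
    by (simp add: sum_mindex_box_sum_type contracted_coeff_def sum_distrib_left sum_distrib_right c'_def d'_def o_def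
        mindex_power_def prod_UNIV_sum_type u_def w_def mult_ac)
  finally show ?thesis .
qed

text \<open>For fixed N the sums are finite, so the limit is taken term by term. The pairing weights
  keep only \<eta> = \<theta>, with value \<eta>!, and the middle weight is squared because both
  factors were truncated in that block.\<close>

lemma contracted_coeff_tendsto:
  assumes c: "\<And>\<eta>. (\<lambda>j. c j \<eta>) \<longlonglongrightarrow> s \<eta>" and d: "\<And>\<eta>. (\<lambda>j. d j \<eta>) \<longlonglongrightarrow> t \<eta>"
    and \<delta>: "\<delta> \<longlonglongrightarrow> 0"
  shows "(\<lambda>j. contracted_coeff N (\<delta> j) (c j) (d j) \<zeta>) \<longlonglongrightarrow>
    of_real (mindex_weight N (\<zeta> \<circ> Inl) * mindex_weight N (\<zeta> \<circ> Inr)) *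
    (\<Sum>\<eta>\<in>mindex_box N. of_real ((mindex_weight N \<eta>)\<^sup>2 * mindex_fact \<eta>) *
        (s (case_sum (\<zeta> \<circ> Inl) \<eta>) * t (case_sum \<eta> (\<zeta> \<circ> Inr))))"
proof -
  have "(\<lambda>j. contracted_coeff N (\<delta> j) (c j) (d j) \<zeta>) \<longlonglongrightarrow>
    (\<Sum>\<eta>\<in>mindex_box N. \<Sum>\<theta>\<in>mindex_box N.
      s (case_sum (\<zeta> \<circ> Inl) \<eta>) * of_real (mindex_weight N (case_sum (\<zeta> \<circ> Inl) \<eta>)) *
      (t (case_sum \<theta> (\<zeta> \<circ> Inr)) * of_real (mindex_weight N (case_sum \<theta> (\<zeta> \<circ> Inr)))) *
      (\<Prod>i\<in>UNIV. if \<eta> i = \<theta> i then fact (\<eta> i) else 0))"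
    unfolding contracted_coeff_def
    by (intro tendsto_sum tendsto_mult tendsto_prod c d tendsto_const pairing_weight_tendsto[OF \<delta>])
  also have "(\<Sum>\<eta>\<in>mindex_box N. \<Sum>\<theta>\<in>mindex_box N.
      s (case_sum (\<zeta> \<circ> Inl) \<eta>) * of_real (mindex_weight N (case_sum (\<zeta> \<circ> Inl) \<eta>)) *
      (t (case_sum \<theta> (\<zeta> \<circ> Inr)) * of_real (mindex_weight N (case_sum \<theta> (\<zeta> \<circ> Inr)))) *
      (\<Prod>i\<in>UNIV. if \<eta> i = \<theta> i then fact (\<eta> i) else 0))
    = (\<Sum>\<eta>\<in>mindex_box N. \<Sum>\<theta>\<in>mindex_box N. if \<theta> = \<eta> then
        of_real (mindex_weight N (\<zeta> \<circ> Inl) * mindex_weight N (\<zeta> \<circ> Inr)) *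
        (of_real ((mindex_weight N \<eta>)\<^sup>2 * mindex_fact \<eta>) *
        (s (case_sum (\<zeta> \<circ> Inl) \<eta>) * t (case_sum \<eta> (\<zeta> \<circ> Inr)))) else 0)"
  proof (intro sum.cong refl)
    fix \<eta> \<theta> :: "'b \<Rightarrow> nat"
    have "(\<Prod>i\<in>UNIV. if \<eta> i = \<theta> i then fact (\<eta> i) else 0) =
        (if \<theta> = \<eta> then of_real (mindex_fact \<eta>) else (0 :: complex))"
      by (cases "\<theta> = \<eta>") (auto simp: mindex_fact_def fun_eq_iff, metis)
    thus "s (case_sum (\<zeta> \<circ> Inl) \<eta>) * of_real (mindex_weight N (case_sum (\<zeta> \<circ> Inl) \<eta>)) *
      (t (case_sum \<theta> (\<zeta> \<circ> Inr)) * of_real (mindex_weight N (case_sum \<theta> (\<zeta> \<circ> Inr)))) *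
      (\<Prod>i\<in>UNIV. if \<eta> i = \<theta> i then fact (\<eta> i) else 0) = (if \<theta> = \<eta> then
        of_real (mindex_weight N (\<zeta> \<circ> Inl) * mindex_weight N (\<zeta> \<circ> Inr)) *
        (of_real ((mindex_weight N \<eta>)\<^sup>2 * mindex_fact \<eta>) *
        (s (case_sum (\<zeta> \<circ> Inl) \<eta>) * t (case_sum \<eta> (\<zeta> \<circ> Inr)))) else 0)"
      by (simp add: mindex_weight_case_sum power2_eq_square mult_ac)
  qed
  also have "\<dots> = of_real (mindex_weight N (\<zeta> \<circ> Inl) * mindex_weight N (\<zeta> \<circ> Inr)) *
    (\<Sum>\<eta>\<in>mindex_box N. of_real ((mindex_weight N \<eta>)\<^sup>2 * mindex_fact \<eta>) *
        (s (case_sum (\<zeta> \<circ> Inl) \<eta>) * t (case_sum \<eta> (\<zeta> \<circ> Inr))))"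
    by (simp add: sum.delta finite_mindex_box sum_distrib_left)
  finally show ?thesis .
qed

lemma mindex_fact_pos: "mindex_fact \<eta> > 0"
  by (simp add: mindex_fact_def prod_pos)

lemma summable_on_power_over_mindex_fact:
  fixes x :: "'n::finite \<Rightarrow> real"
  assumes "\<And>i. x i \<ge> 0"
  shows "(\<lambda>\<eta>. (\<Prod>i\<in>UNIV. x i ^ \<eta> i) / mindex_fact \<eta>) summable_on UNIV"
proof -
  have "(\<lambda>\<eta>. \<Prod>i\<in>UNIV. x i ^ \<eta> i / fact (\<eta> i)) summable_on UNIV"
  proof (rule summable_on_multi_index_prod)
    show "summable (\<lambda>k. x i ^ k / fact k)" for i
      using summable_exp_generic[of "x i"] by (simp add: scaleR_conv_of_real divide_inverse mult.commute)
  qed (use assms in auto)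
  thus ?thesis by (simp add: prod_dividef mindex_fact_def)
qed

text \<open>Two limits are nested: letting j grow at fixed N gives the coefficients
  \<open>L N\<close>, and these tend to the coefficients of h by dominated convergence. A diagonal
  choice of j makes a single sequence of polynomials. Its distance from \<open>L N\<close>, at most
  1 / (Suc N \<zeta>!), tends to 0 and stays below 1 / \<zeta>!, which is summable against every
  R^\<zeta>; this yields the majorant M + 1 / \<zeta>! for \<open>LY_I\<close>.\<close>

lemma LY_contraction:
  fixes f :: "complex ^ ('k::finite + 'm::finite) \<Rightarrow> complex" and g :: "complex ^ ('m + 'n::finite) \<Rightarrow> complex"
    and h :: "complex ^ ('k + 'n) \<Rightarrow> complex"
  assumes f: "f \<in> LY" "has_power_series f s" and g: "g \<in> LY" "has_power_series g t"
    and h: "has_power_series h (\<lambda>\<zeta>. \<Sum>\<^sub>\<infinity>\<eta>. of_real (mindex_fact \<eta>) *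
              (s (case_sum (\<zeta> \<circ> Inl) \<eta>) * t (case_sum \<eta> (\<zeta> \<circ> Inr))))"
    and summ: "\<And>\<zeta>. (\<lambda>\<eta>. mindex_fact \<eta> * (cmod (s (case_sum (\<zeta> \<circ> Inl) \<eta>)) *
              cmod (t (case_sum \<eta> (\<zeta> \<circ> Inr))))) summable_on UNIV"
    and bound: "\<And>\<zeta>. (\<Sum>\<^sub>\<infinity>\<eta>. mindex_fact \<eta> * (cmod (s (case_sum (\<zeta> \<circ> Inl) \<eta>)) *
              cmod (t (case_sum \<eta> (\<zeta> \<circ> Inr))))) \<le> M \<zeta>"
    and M: "\<And>R. R \<ge> 0 \<Longrightarrow> (\<lambda>\<zeta>. M \<zeta> * (\<Prod>i\<in>UNIV. R ^ \<zeta> i)) summable_on UNIV"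
  shows "h \<in> LY"
proof -
  obtain A c where A: "\<And>j. finite (A j)" "\<And>j \<eta>. \<eta> \<notin> A j \<Longrightarrow> c j \<eta> = 0"
    "\<And>j z. \<forall>i. Re (z i) > - (1 / real (Suc j)) \<Longrightarrow> (\<Sum>\<eta>\<in>A j. c j \<eta> * (\<Prod>i\<in>UNIV. z i ^ \<eta> i)) \<noteq> 0"
    "\<And>\<eta>. (\<lambda>j. c j \<eta>) \<longlonglongrightarrow> s \<eta>"
    by (rule LY_strict_approximation[OF f]) (rule that)
  obtain B d where B: "\<And>j. finite (B j)" "\<And>j \<eta>. \<eta> \<notin> B j \<Longrightarrow> d j \<eta> = 0"
    "\<And>j z. \<forall>i. Re (z i) > - (1 / real (Suc j)) \<Longrightarrow> (\<Sum>\<eta>\<in>B j. d j \<eta> * (\<Prod>i\<in>UNIV. z i ^ \<eta> i)) \<noteq> 0"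
    "\<And>\<eta>. (\<lambda>j. d j \<eta>) \<longlonglongrightarrow> t \<eta>"
    by (rule LY_strict_approximation[OF g]) (rule that)
  define st where "st = (\<lambda>\<zeta> \<eta>. s (case_sum (\<zeta> \<circ> Inl) \<eta>) * t (case_sum \<eta> (\<zeta> \<circ> Inr)))"
  define a where "a = (\<lambda>\<zeta>. \<Sum>\<^sub>\<infinity>\<eta>. of_real (mindex_fact \<eta>) * st \<zeta> \<eta>)"
  \<comment> \<open>The same null sequence 1 / Suc j is used for the margin of the approximants and
    for the shift in the pairing.\<close>
  define H where "H = (\<lambda>N j. contracted_coeff N (of_real (1 / real (Suc j))) (c j) (d j))"
  define L where "L = (\<lambda>N \<zeta>. of_real (mindex_weight N (\<zeta> \<circ> Inl) * mindex_weight N (\<zeta> \<circ> Inr)) *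
    (\<Sum>\<^sub>\<infinity>\<eta>. of_real ((mindex_weight N \<eta>)\<^sup>2 * mindex_fact \<eta>) * st \<zeta> \<eta>))"
  have st_norm: "cmod (of_real ((mindex_weight N \<eta>)\<^sup>2 * mindex_fact \<eta>) * st \<zeta> \<eta>)
      \<le> mindex_fact \<eta> * (cmod (s (case_sum (\<zeta> \<circ> Inl) \<eta>)) * cmod (t (case_sum \<eta> (\<zeta> \<circ> Inr))))" for N \<eta> \<zeta>
  proof -
    have "(mindex_weight N \<eta>)\<^sup>2 \<le> 1"
      by (simp add: power_le_one mindex_weight_nonneg mindex_weight_le_1)
    moreover have "0 \<le> mindex_fact \<eta> * (cmod (s (case_sum (\<zeta> \<circ> Inl) \<eta>)) * cmod (t (case_sum \<eta> (\<zeta> \<circ> Inr))))"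
      using mindex_fact_pos[of \<eta>] by simp
    ultimately show ?thesis
      using mindex_fact_pos[of \<eta>]
      by (simp add: st_def norm_mult mult_left_le_one_le mult.assoc del: of_real_mult of_real_power)
  qed
  have HL: "(\<lambda>j. H N j \<zeta>) \<longlonglongrightarrow> L N \<zeta>" for N \<zeta>
  proof -
    have "(\<lambda>j. complex_of_real (1 / real (Suc j))) \<longlonglongrightarrow> of_real 0"
      by (intro tendsto_of_real LIMSEQ_Suc[OF lim_1_over_n])
    hence "(\<lambda>j. H N j \<zeta>) \<longlonglongrightarrow> of_real (mindex_weight N (\<zeta> \<circ> Inl) * mindex_weight N (\<zeta> \<circ> Inr)) *
      (\<Sum>\<eta>\<in>mindex_box N. of_real ((mindex_weight N \<eta>)\<^sup>2 * mindex_fact \<eta>) * st \<zeta> \<eta>)"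
      unfolding H_def st_def by (intro contracted_coeff_tendsto A(4) B(4)) simp
    also have "(\<Sum>\<eta>\<in>mindex_box N. of_real ((mindex_weight N \<eta>)\<^sup>2 * mindex_fact \<eta>) * st \<zeta> \<eta>)
        = (\<Sum>\<^sub>\<infinity>\<eta>\<in>mindex_box N. of_real ((mindex_weight N \<eta>)\<^sup>2 * mindex_fact \<eta>) * st \<zeta> \<eta>)"
      by (simp add: finite_mindex_box)
    \<comment> \<open>The weights vanish outside the box, so the range of summation can be made
      independent of N, which the limit in N requires.\<close>
    also have "\<dots> = (\<Sum>\<^sub>\<infinity>\<eta>. of_real ((mindex_weight N \<eta>)\<^sup>2 * mindex_fact \<eta>) * st \<zeta> \<eta>)"
      by (intro infsum_cong_neutral) (auto simp: mindex_weight_eq_0)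
    finally show ?thesis by (simp only: L_def)
  qed
  have La: "(\<lambda>n. L (Suc n) \<zeta>) \<longlonglongrightarrow> a \<zeta>" for \<zeta>
  proof -
    have "(\<lambda>N. L N \<zeta>) \<longlonglongrightarrow> of_real (1 * 1) * (\<Sum>\<^sub>\<infinity>\<eta>. of_real (1\<^sup>2 * mindex_fact \<eta>) * st \<zeta> \<eta>)"
      unfolding L_def
      by (intro tendsto_mult tendsto_of_real tendsto_power mindex_weight_tendsto
          infsum_tendsto_dominated[OF summ st_norm] tendsto_const)
    from LIMSEQ_Suc[OF this] show ?thesis by (simp add: a_def)
  qed
  have L_bound: "cmod (L N \<zeta>) \<le> M \<zeta>" for N \<zeta>
  proof -
    have s1: "(\<lambda>\<eta>. cmod (of_real ((mindex_weight N \<eta>)\<^sup>2 * mindex_fact \<eta>) * st \<zeta> \<eta>)) summable_on UNIV"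
      by (rule summable_on_comparison_test[OF summ st_norm]) auto
    have w: "\<bar>mindex_weight N (\<zeta> \<circ> Inl) * mindex_weight N (\<zeta> \<circ> Inr)\<bar> \<le> 1"
      by (simp add: abs_mult mult_le_one mindex_weight_nonneg mindex_weight_le_1)
    have "cmod (L N \<zeta>) = \<bar>mindex_weight N (\<zeta> \<circ> Inl) * mindex_weight N (\<zeta> \<circ> Inr)\<bar> *
        cmod (\<Sum>\<^sub>\<infinity>\<eta>. of_real ((mindex_weight N \<eta>)\<^sup>2 * mindex_fact \<eta>) * st \<zeta> \<eta>)"
      by (simp only: L_def norm_mult norm_of_real)
    also have "\<dots> \<le> cmod (\<Sum>\<^sub>\<infinity>\<eta>. of_real ((mindex_weight N \<eta>)\<^sup>2 * mindex_fact \<eta>) * st \<zeta> \<eta>)"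
      using w by (rule mult_left_le_one_le[rotated 2]) auto
    also have "\<dots> \<le> (\<Sum>\<^sub>\<infinity>\<eta>. cmod (of_real ((mindex_weight N \<eta>)\<^sup>2 * mindex_fact \<eta>) * st \<zeta> \<eta>))"
      by (rule norm_infsum_bound[OF s1])
    also have "\<dots> \<le> M \<zeta>"
      using infsum_mono[OF s1 summ st_norm] bound[of \<zeta>] by linarith
    finally show ?thesis .
  qed
  \<comment> \<open>The box is finite, so a single j serves all its exponents; outside the box both
    sides of the comparison are 0.\<close>
  have "\<exists>j. \<forall>\<zeta>\<in>mindex_box N. cmod (H N j \<zeta> - L N \<zeta>) < 1 / (real (Suc N) * mindex_fact \<zeta>)" for N
  proof -
    have "\<forall>\<^sub>F j in sequentially. \<forall>\<zeta>\<in>mindex_box N. dist (H N j \<zeta>) (L N \<zeta>) < 1 / (real (Suc N) * mindex_fact \<zeta>)"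
      by (intro eventually_ball_finite finite_mindex_box ballI tendstoD[OF HL])
         (simp add: mindex_fact_pos)
    thus ?thesis unfolding dist_norm by (rule eventually_happens'[OF sequentially_bot])
  qed
  then obtain j where j: "\<And>N \<zeta>. \<zeta> \<in> mindex_box N \<Longrightarrow>
      cmod (H N (j N) \<zeta> - L N \<zeta>) < 1 / (real (Suc N) * mindex_fact \<zeta>)"
    by metis
  have HLj: "cmod (H N (j N) \<zeta> - L N \<zeta>) \<le> 1 / (real (Suc N) * mindex_fact \<zeta>)" for N \<zeta>
  proof (cases "\<zeta> \<in> mindex_box N")
    case False
    have "H N j \<zeta> = 0" for j unfolding H_def by (rule contracted_coeff_outside[OF False])
    moreover from this have "L N \<zeta> = 0" using HL[of N \<zeta>] by (simp add: LIMSEQ_const_iff)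
    ultimately show ?thesis using mindex_fact_pos[of \<zeta>] by simp
  qed (use j in force)
  \<comment> \<open>The sequence starts at \<open>Suc n\<close> because
    \<open>contracted_nonzero\<close> asks for N > 0.\<close>
  define b where "b = (\<lambda>n. H (Suc n) (j (Suc n)))"
  define p where "p = (\<lambda>n z. \<Sum>\<zeta>\<in>mindex_box (Suc n). b n \<zeta> * mindex_power z \<zeta>)"
  show ?thesis
  proof (rule LY_I[where p = p and b = b and g = "\<lambda>\<zeta>. M \<zeta> + 1 / mindex_fact \<zeta>" and a = a])
    show "has_power_series h a" using h by (simp only: a_def st_def)
    show "has_power_series (p n) (b n)" for n
      unfolding p_def b_def H_def
      by (rule has_power_series_finite[OF finite_mindex_box contracted_coeff_outside])
    show "polynomial_fun (p n)" for n
      unfolding p_def polynomial_fun_def using finite_mindex_box by blast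
    show "p n z \<noteq> 0" if "\<forall>i. Re (z $ i) > 0" for n z
      unfolding p_def b_def H_def
      by (rule contracted_nonzero[OF A(1,2) B(1,2), where \<epsilon> = "1 / real (Suc (j (Suc n)))"])
         (use that A(3) B(3) in auto)
    show "cmod (b n \<zeta>) \<le> M \<zeta> + 1 / mindex_fact \<zeta>" for n \<zeta>
    proof -
      have "1 / (real (Suc (Suc n)) * mindex_fact \<zeta>) \<le> 1 / mindex_fact \<zeta>"
        using mindex_fact_pos[of \<zeta>] by (simp add: divide_simps)
      thus ?thesis
        using HLj[of "Suc n" \<zeta>] L_bound[of "Suc n" \<zeta>] norm_triangle_sub[of "b n \<zeta>" "L (Suc n) \<zeta>"]
        unfolding b_def by linarith
    qed
    show "(\<lambda>\<zeta>. (M \<zeta> + 1 / mindex_fact \<zeta>) * (\<Prod>i\<in>UNIV. R ^ \<zeta> i)) summable_on UNIV" if "R \<ge> 0" for R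
      using summable_on_add[OF M[OF that] summable_on_power_over_mindex_fact[of "\<lambda>_. R"]] that
      by (simp add: algebra_simps)
    show "(\<lambda>n. b n \<zeta>) \<longlonglongrightarrow> a \<zeta>" for \<zeta>
    proof (rule Lim_transform[OF La])
      have "(\<lambda>n. 1 / (real (Suc (Suc n)) * x)) \<longlonglongrightarrow> 0" if "x > 0" for x :: real
        using that by real_asymp
      from this[OF mindex_fact_pos]
      have "(\<lambda>n. 1 / (real (Suc (Suc n)) * mindex_fact \<zeta>)) \<longlonglongrightarrow> 0" .
      thus "(\<lambda>n. b n \<zeta> - L (Suc n) \<zeta>) \<longlonglongrightarrow> 0"
        unfolding b_def by (rule Lim_null_comparison[OF always_eventually[OF allI[OF HLj]]])
    qed
  qed
qed

section \<open>Fock spaces\<close>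

abbreviation fock_weight :: "real ^ ('n::finite) \<Rightarrow> ('n \<Rightarrow> nat) \<Rightarrow> real" where
  "fock_weight \<beta> \<eta> \<equiv> mindex_fact \<eta> / mindex_power \<beta> \<eta>"

lemma mindex_power_pos: "\<forall>i. (\<beta> :: real ^ 'n::finite) $ i > 0 \<Longrightarrow> mindex_power \<beta> \<eta> > 0"
  by (simp add: mindex_power_def prod_pos)

lemma fock_weight_pos: "\<forall>i. \<beta> $ i > 0 \<Longrightarrow> fock_weight \<beta> \<eta> > 0"
  by (simp add: mindex_power_pos mindex_fact_pos)

lemma fock_space_I:
  assumes "has_power_series f a" "(\<lambda>\<eta>. fock_weight \<beta> \<eta> * (cmod (a \<eta>))\<^sup>2) summable_on UNIV"
  shows "f \<in> fock_space \<beta>"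
  using assms power_series_coeff_eq[OF assms(1)]
  by (auto simp: fock_space_def entire_def fock_term_def[abs_def])

lemma fock_space_D:
  assumes "f \<in> fock_space \<beta>"
  shows "has_power_series f (power_series_coeff f)"
    and "(\<lambda>\<eta>. fock_weight \<beta> \<eta> * (cmod (power_series_coeff f \<eta>))\<^sup>2) summable_on UNIV"
  using assms power_series_coeff_eq by (auto simp: fock_space_def entire_def fock_term_def[abs_def])

lemma fock_norm_sq:
  assumes "\<forall>i. \<beta> $ i > 0"
  shows "(fock_norm \<beta> f)\<^sup>2 = (\<Sum>\<^sub>\<infinity>\<eta>. fock_weight \<beta> \<eta> * (cmod (power_series_coeff f \<eta>))\<^sup>2)"
proof -
  have "0 \<le> (\<Sum>\<^sub>\<infinity>\<eta>. fock_term \<beta> f \<eta>)"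
    using fock_weight_pos[OF assms] unfolding fock_term_def
    by (intro infsum_nonneg mult_nonneg_nonneg) (auto simp: less_imp_le)
  thus ?thesis by (simp add: fock_norm_def fock_term_def)
qed

lemma fock_norm_nonneg:
  assumes "\<forall>i. \<beta> $ i > 0"
  shows "0 \<le> fock_norm \<beta> f"
  using fock_weight_pos[OF assms] unfolding fock_norm_def fock_term_def
  by (intro real_sqrt_ge_zero infsum_nonneg mult_nonneg_nonneg) (auto simp: less_imp_le)

lemma fock_norm_eq:
  assumes "has_power_series f a"
  shows "fock_norm \<beta> f = sqrt (\<Sum>\<^sub>\<infinity>\<eta>. fock_weight \<beta> \<eta> * (cmod (a \<eta>))\<^sup>2)"
  by (simp add: fock_norm_def fock_term_def power_series_coeff_eq[OF assms])

lemma has_power_series_add: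
  assumes "has_power_series f a" "has_power_series g b"
  shows "has_power_series (\<lambda>z. f z + g z) (\<lambda>\<eta>. a \<eta> + b \<eta>)"
  using assms unfolding has_power_series_def by (auto simp: algebra_simps intro!: has_sum_add)

lemma has_power_series_cmult:
  assumes "has_power_series f a"
  shows "has_power_series (\<lambda>z. c * f z) (\<lambda>\<eta>. c * a \<eta>)"
  using assms unfolding has_power_series_def by (auto simp: mult.assoc intro!: has_sum_cmult_right)

lemma fock_space_add:
  assumes "\<forall>i. \<beta> $ i > 0" "f \<in> fock_space \<beta>" "g \<in> fock_space \<beta>"
  shows "(\<lambda>z. f z + g z) \<in> fock_space \<beta>"
proof (rule fock_space_I[OF has_power_series_add[OF fock_space_D(1)[OF assms(2)] fock_space_D(1)[OF assms(3)]]])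
  let ?a = "power_series_coeff f" and ?b = "power_series_coeff g"
  show "(\<lambda>\<eta>. fock_weight \<beta> \<eta> * (cmod (?a \<eta> + ?b \<eta>))\<^sup>2) summable_on UNIV"
  proof (rule summable_on_comparison_test)
    show "(\<lambda>\<eta>. 2 * (fock_weight \<beta> \<eta> * (cmod (?a \<eta>))\<^sup>2) + 2 * (fock_weight \<beta> \<eta> * (cmod (?b \<eta>))\<^sup>2))
        summable_on UNIV"
      by (intro summable_on_add summable_on_cmult_right fock_space_D assms)
    fix \<eta>
    have "(cmod (?a \<eta> + ?b \<eta>))\<^sup>2 \<le> (cmod (?a \<eta>) + cmod (?b \<eta>))\<^sup>2"
      by (simp add: norm_triangle_ineq power_mono)
    also have "\<dots> \<le> 2 * (cmod (?a \<eta>))\<^sup>2 + 2 * (cmod (?b \<eta>))\<^sup>2"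
      using sum_squares_bound[of "cmod (?a \<eta>)" "cmod (?b \<eta>)"] by (simp add: power2_sum)
    finally have "fock_weight \<beta> \<eta> * (cmod (?a \<eta> + ?b \<eta>))\<^sup>2
        \<le> fock_weight \<beta> \<eta> * (2 * (cmod (?a \<eta>))\<^sup>2 + 2 * (cmod (?b \<eta>))\<^sup>2)"
      using fock_weight_pos[OF assms(1), of \<eta>] by (intro mult_left_mono) auto
    thus "fock_weight \<beta> \<eta> * (cmod (?a \<eta> + ?b \<eta>))\<^sup>2
        \<le> 2 * (fock_weight \<beta> \<eta> * (cmod (?a \<eta>))\<^sup>2) + 2 * (fock_weight \<beta> \<eta> * (cmod (?b \<eta>))\<^sup>2)"
      by (simp add: algebra_simps)
    show "0 \<le> fock_weight \<beta> \<eta> * (cmod (?a \<eta> + ?b \<eta>))\<^sup>2"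
      using fock_weight_pos[OF assms(1), of \<eta>] by (intro mult_nonneg_nonneg) auto
  qed
qed

lemma fock_space_cmult:
  assumes "f \<in> fock_space \<beta>"
  shows "(\<lambda>z. c * f z) \<in> fock_space \<beta>"
proof (rule fock_space_I[OF has_power_series_cmult[OF fock_space_D(1)[OF assms]]])
  have "(\<lambda>\<eta>. (cmod c)\<^sup>2 * (fock_weight \<beta> \<eta> * (cmod (power_series_coeff f \<eta>))\<^sup>2)) summable_on UNIV"
    by (intro summable_on_cmult_right fock_space_D assms)
  thus "(\<lambda>\<eta>. fock_weight \<beta> \<eta> * (cmod (c * power_series_coeff f \<eta>))\<^sup>2) summable_on UNIV"
    by (simp add: norm_mult power_mult_distrib mult_ac)
qed

lemma fock_norm_cmult:
  assumes "f \<in> fock_space \<beta>"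
  shows "fock_norm \<beta> (\<lambda>z. c * f z) = cmod c * fock_norm \<beta> f"
proof -
  have "(\<Sum>\<^sub>\<infinity>\<eta>. fock_weight \<beta> \<eta> * (cmod (c * power_series_coeff f \<eta>))\<^sup>2)
      = (cmod c)\<^sup>2 * (\<Sum>\<^sub>\<infinity>\<eta>. fock_weight \<beta> \<eta> * (cmod (power_series_coeff f \<eta>))\<^sup>2)"
    by (subst infsum_cmult_right'[symmetric]) (simp add: norm_mult power_mult_distrib mult_ac)
  thus ?thesis
    using fock_norm_eq[OF has_power_series_cmult[OF fock_space_D(1)[OF assms]]]
      fock_norm_eq[OF fock_space_D(1)[OF assms]] by (simp add: real_sqrt_mult)
qed

lemma has_power_series_monomials:
  assumes "finite A"
  shows "has_power_series (\<lambda>z. \<Sum>\<eta>\<in>A. c \<eta> * mindex_power z \<eta>) (\<lambda>\<eta>. if \<eta> \<in> A then c \<eta> else 0)"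
  using has_power_series_finite[OF assms, of "\<lambda>\<eta>. if \<eta> \<in> A then c \<eta> else 0"] by simp

lemma monomials_in_fock_space:
  assumes "finite A"
  shows "(\<lambda>z. \<Sum>\<eta>\<in>A. c \<eta> * mindex_power z \<eta>) \<in> fock_space \<beta>"
  by (rule fock_space_I[OF has_power_series_monomials[OF assms]],
      rule summable_on_cong_neutral[THEN iffD1, OF _ _ _ summable_on_finite[OF assms]]) auto

lemma fock_norm_monomials:
  assumes "finite A"
  shows "fock_norm \<beta> (\<lambda>z. \<Sum>\<eta>\<in>A. c \<eta> * mindex_power z \<eta>)
           = sqrt (\<Sum>\<eta>\<in>A. fock_weight \<beta> \<eta> * (cmod (c \<eta>))\<^sup>2)"
proof -
  have "(\<Sum>\<^sub>\<infinity>\<eta>. fock_weight \<beta> \<eta> * (cmod (if \<eta> \<in> A then c \<eta> else 0))\<^sup>2)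
      = (\<Sum>\<^sub>\<infinity>\<eta>\<in>A. fock_weight \<beta> \<eta> * (cmod (c \<eta>))\<^sup>2)"
    by (rule infsum_cong_neutral) auto
  thus ?thesis
    using assms fock_norm_eq[OF has_power_series_monomials[OF assms]] by simp
qed

lemma monomial_in_fock_space: "(\<lambda>z. mindex_power z \<eta>) \<in> fock_space \<beta>"
  using monomials_in_fock_space[of "{\<eta>}" "\<lambda>_. 1"] by simp

lemma fock_norm_monomial: "fock_norm \<beta> (\<lambda>z. mindex_power z \<eta>) = sqrt (fock_weight \<beta> \<eta>)"
  using fock_norm_monomials[of "{\<eta>}" \<beta> "\<lambda>_. 1"] by simp

text \<open>One term of a nonnegative sum is at most the whole, so reading off a coefficient is a
  bounded functional.\<close>

lemma sqrt_weight_coeff_le_fock_norm: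
  assumes "\<forall>i. \<beta> $ i > 0" "f \<in> fock_space \<beta>"
  shows "sqrt (fock_weight \<beta> \<eta>) * cmod (power_series_coeff f \<eta>) \<le> fock_norm \<beta> f"
proof -
  have "(\<Sum>\<eta>\<in>{\<eta>}. fock_weight \<beta> \<eta> * (cmod (power_series_coeff f \<eta>))\<^sup>2)
      \<le> (\<Sum>\<^sub>\<infinity>\<eta>. fock_weight \<beta> \<eta> * (cmod (power_series_coeff f \<eta>))\<^sup>2)"
    using fock_weight_pos[OF assms(1)]
    by (intro finite_sum_le_infsum fock_space_D assms mult_nonneg_nonneg) (auto simp: less_imp_le)
  hence "sqrt (fock_weight \<beta> \<eta> * (cmod (power_series_coeff f \<eta>))\<^sup>2) \<le> sqrt ((fock_norm \<beta> f)\<^sup>2)"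
    unfolding fock_norm_sq[OF assms(1)] by (intro real_sqrt_le_mono) simp
  thus ?thesis
    using fock_norm_nonneg[OF assms(1), of f]
    by (simp only: real_sqrt_mult real_sqrt_abs abs_norm_cancel abs_of_nonneg)
qed

section \<open>Bounded functionals on Fock space\<close>

definition fock_bounded_functional ::
  "real ^ ('n::finite) \<Rightarrow> real \<Rightarrow> ((complex ^ 'n \<Rightarrow> complex) \<Rightarrow> complex) \<Rightarrow> bool" where
  "fock_bounded_functional \<beta> C \<phi> \<longleftrightarrow>
     (\<forall>f\<in>fock_space \<beta>. \<forall>g\<in>fock_space \<beta>. \<phi> (\<lambda>z. f z + g z) = \<phi> f + \<phi> g) \<and>
     (\<forall>c. \<forall>f\<in>fock_space \<beta>. \<phi> (\<lambda>z. c * f z) = c * \<phi> f) \<and>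
     (\<forall>f\<in>fock_space \<beta>. cmod (\<phi> f) \<le> C * fock_norm \<beta> f)"

lemma fock_bounded_functional_cmult:
  assumes "fock_bounded_functional \<beta> C \<phi>" "f \<in> fock_space \<beta>"
  shows "\<phi> (\<lambda>z. c * f z) = c * \<phi> f"
  using assms by (simp add: fock_bounded_functional_def)

lemma functional_add_monomials:
  assumes \<beta>: "\<forall>i. \<beta> $ i > 0" and \<phi>: "fock_bounded_functional \<beta> C \<phi>"
    and f: "f \<in> fock_space \<beta>" and A: "finite A"
  shows "\<phi> (\<lambda>z. f z + (\<Sum>\<eta>\<in>A. c \<eta> * mindex_power z \<eta>))
           = \<phi> f + (\<Sum>\<eta>\<in>A. c \<eta> * \<phi> (\<lambda>z. mindex_power z \<eta>))"
  using A
proof induction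
  case (insert \<eta> A)
  have F: "(\<lambda>z. f z + (\<Sum>\<eta>\<in>A. c \<eta> * mindex_power z \<eta>)) \<in> fock_space \<beta>"
    by (intro fock_space_add \<beta> f monomials_in_fock_space insert.hyps)
  have "\<phi> (\<lambda>z. (f z + (\<Sum>\<eta>\<in>A. c \<eta> * mindex_power z \<eta>)) + c \<eta> * mindex_power z \<eta>)
      = \<phi> (\<lambda>z. f z + (\<Sum>\<eta>\<in>A. c \<eta> * mindex_power z \<eta>)) + c \<eta> * \<phi> (\<lambda>z. mindex_power z \<eta>)"
    using \<phi> F monomial_in_fock_space[of \<eta> \<beta>] fock_space_cmult[OF monomial_in_fock_space[of \<eta> \<beta>], of "c \<eta>"]
    unfolding fock_bounded_functional_def by simp
  thus ?case using insert by (simp add: algebra_simps)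
qed simp

text \<open>Subtracting from f its terms with exponents in A leaves a remainder whose norm is the
  square root of a tail of a convergent series. By boundedness \<phi> of the remainder tends to 0
  along the finite sets A, so \<phi> acts on power series term by term.\<close>

lemma functional_has_sum:
  assumes \<beta>: "\<forall>i. \<beta> $ i > 0" and \<phi>: "fock_bounded_functional \<beta> C \<phi>" and f: "f \<in> fock_space \<beta>"
  shows "((\<lambda>\<eta>. power_series_coeff f \<eta> * \<phi> (\<lambda>z. mindex_power z \<eta>)) has_sum \<phi> f) UNIV"
proof -
  define a where "a = power_series_coeff f"
  define q where "q = (\<lambda>\<eta>. fock_weight \<beta> \<eta> * (cmod (a \<eta>))\<^sup>2)"
  have q: "q summable_on UNIV"
    unfolding q_def a_def by (rule fock_space_D[OF f])
  have qs: "(sum q \<longlongrightarrow> infsum q UNIV) (finite_subsets_at_top UNIV)"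
    using has_sum_infsum[OF q] unfolding has_sum_def .
  have est: "cmod (sum (\<lambda>\<eta>. a \<eta> * \<phi> (\<lambda>z. mindex_power z \<eta>)) A - \<phi> f) \<le> C * sqrt (infsum q UNIV - sum q A)"
    if A: "finite A" for A
  proof -
    define r where "r = (\<lambda>z. f z + (\<Sum>\<eta>\<in>A. - a \<eta> * mindex_power z \<eta>))"
    have "has_power_series r (\<lambda>\<eta>. a \<eta> + (if \<eta> \<in> A then - a \<eta> else 0))"
      unfolding r_def a_def
      by (intro has_power_series_add fock_space_D[OF f] has_power_series_monomials A)
    hence "fock_norm \<beta> r = sqrt (\<Sum>\<^sub>\<infinity>\<eta>. fock_weight \<beta> \<eta> * (cmod (a \<eta> + (if \<eta> \<in> A then - a \<eta> else 0)))\<^sup>2)"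
      by (rule fock_norm_eq)
    also have "(\<Sum>\<^sub>\<infinity>\<eta>. fock_weight \<beta> \<eta> * (cmod (a \<eta> + (if \<eta> \<in> A then - a \<eta> else 0)))\<^sup>2) = infsum q (-A)"
      by (rule infsum_cong_neutral) (auto simp: q_def)
    also have "infsum q (-A) = infsum q UNIV - sum q A"
    proof -
      have "infsum q (A \<union> -A) = infsum q A + infsum q (-A)"
        by (intro infsum_Un_disjoint summable_on_subset[OF q]) auto
      thus ?thesis using A by simp
    qed
    finally have norm_r: "fock_norm \<beta> r = sqrt (infsum q UNIV - sum q A)" .
    have "r \<in> fock_space \<beta>"
      unfolding r_def by (intro fock_space_add \<beta> f monomials_in_fock_space A)
    hence "cmod (\<phi> r) \<le> C * fock_norm \<beta> r"
      using \<phi> unfolding fock_bounded_functional_def by blast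
    moreover have "\<phi> r = \<phi> f + (\<Sum>\<eta>\<in>A. - a \<eta> * \<phi> (\<lambda>z. mindex_power z \<eta>))"
      unfolding r_def by (rule functional_add_monomials[OF \<beta> \<phi> f A])
    ultimately show ?thesis
      by (simp add: norm_r sum_negf norm_minus_commute)
  qed
  have "((\<lambda>A. C * sqrt (infsum q UNIV - sum q A)) \<longlongrightarrow> C * sqrt (infsum q UNIV - infsum q UNIV))
      (finite_subsets_at_top UNIV)"
    by (intro tendsto_intros qs)
  hence lim0: "((\<lambda>A. C * sqrt (infsum q UNIV - sum q A)) \<longlongrightarrow> 0) (finite_subsets_at_top UNIV)"
    by simp
  have "\<forall>\<^sub>F A in finite_subsets_at_top UNIV.
      cmod (sum (\<lambda>\<eta>. a \<eta> * \<phi> (\<lambda>z. mindex_power z \<eta>)) A - \<phi> f) \<le> C * sqrt (infsum q UNIV - sum q A)"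
    by (rule eventually_finite_subsets_at_top_weakI) (rule est)
  from Lim_null_comparison[OF this lim0]
  have "((\<lambda>A. sum (\<lambda>\<eta>. a \<eta> * \<phi> (\<lambda>z. mindex_power z \<eta>)) A - \<phi> f) \<longlongrightarrow> 0) (finite_subsets_at_top UNIV)" .
  thus ?thesis unfolding has_sum_def a_def by (simp add: LIM_zero_iff)
qed

text \<open>A finite form of the Riesz representation: \<phi> is tested on the polynomial f whose
  coefficients are the conjugates of the values on monomials, divided by the weights. If X is the
  sum in question, then \<phi> f = X while f has norm sqrt X, so X \<le> C sqrt X.\<close>

lemma functional_monomials_bound:
  assumes \<beta>: "\<forall>i. \<beta> $ i > 0" and \<phi>: "fock_bounded_functional \<beta> C \<phi>" and C: "C \<ge> 0" and A: "finite A"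
  shows "(\<Sum>\<eta>\<in>A. (cmod (\<phi> (\<lambda>z. mindex_power z \<eta>)))\<^sup>2 / fock_weight \<beta> \<eta>) \<le> C\<^sup>2"
proof -
  define v where "v = (\<lambda>\<eta>. \<phi> (\<lambda>z. mindex_power z \<eta>))"
  define X where "X = (\<Sum>\<eta>\<in>A. (cmod (v \<eta>))\<^sup>2 / fock_weight \<beta> \<eta>)"
  define c where "c = (\<lambda>\<eta>. cnj (v \<eta>) / of_real (fock_weight \<beta> \<eta>))"
  define f where "f = (\<lambda>z. \<Sum>\<eta>\<in>A. c \<eta> * mindex_power z \<eta>)"
  have w: "fock_weight \<beta> \<eta> > 0" for \<eta> by (rule fock_weight_pos[OF \<beta>])
  have f: "f \<in> fock_space \<beta>"
    unfolding f_def by (rule monomials_in_fock_space[OF A])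
  have zero: "(\<lambda>z. 0) \<in> fock_space \<beta>"
    using monomials_in_fock_space[of "{}"] by simp
  have "\<phi> (\<lambda>z. 0) = 0"
    using fock_bounded_functional_cmult[OF \<phi> zero, of 0] by simp
  hence "\<phi> f = (\<Sum>\<eta>\<in>A. c \<eta> * v \<eta>)"
    using functional_add_monomials[OF \<beta> \<phi> zero A, of c] by (simp add: f_def v_def)
  also have "\<dots> = of_real X"
    unfolding X_def of_real_sum
    by (intro sum.cong) (auto simp: c_def complex_norm_square mult.commute simp del: of_real_power)
  finally have "\<phi> f = of_real X" .
  moreover have "fock_norm \<beta> f = sqrt X"
  proof -
    have "fock_weight \<beta> \<eta> * (cmod (c \<eta>))\<^sup>2 = (cmod (v \<eta>))\<^sup>2 / fock_weight \<beta> \<eta>" for \<eta>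
    proof -
      have div: "W * (x / W)\<^sup>2 = x\<^sup>2 / W" if "W > 0" for W x :: real
        using that by (simp add: power2_eq_square)
      have "cmod (c \<eta>) = cmod (v \<eta>) / fock_weight \<beta> \<eta>"
        using w[of \<eta>] by (simp only: c_def norm_divide norm_of_real complex_mod_cnj abs_of_pos)
      thus ?thesis by (simp only: div[OF w])
    qed
    thus ?thesis
      unfolding f_def fock_norm_monomials[OF A] X_def by simp
  qed
  ultimately have "cmod (of_real X) \<le> C * sqrt X"
    using \<phi> f unfolding fock_bounded_functional_def by metis
  moreover have X0: "X \<ge> 0"
    unfolding X_def by (intro sum_nonneg divide_nonneg_pos w) auto
  ultimately have "sqrt X * sqrt X \<le> C * sqrt X" by simp
  hence "sqrt X \<le> C"
    using C X0 by (cases "X = 0") (auto dest: mult_right_le_imp_le simp del: real_sqrt_mult_self)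
  hence "X \<le> C\<^sup>2"
    using X0 by (metis real_sqrt_ge_zero real_sqrt_pow2 power_mono)
  thus ?thesis by (simp add: X_def v_def)
qed

section \<open>Exponential functions and coefficient majorants\<close>

lemma mindex_power_sum_type:
  "mindex_power z \<zeta> = mindex_power (\<chi> i. z $ Inl i) (\<zeta> \<circ> Inl) * mindex_power (\<chi> i. z $ Inr i) (\<zeta> \<circ> Inr)"
  by (simp add: mindex_power_def prod_UNIV_sum_type)

lemma has_power_series_exp_dotc:
  fixes w :: "complex ^ 'n::finite"
  shows "has_power_series (\<lambda>u. exp (dotc u w)) (\<lambda>\<xi>. mindex_power w \<xi> / of_real (mindex_fact \<xi>))"
  unfolding has_power_series_def
proof
  fix u :: "complex ^ 'n"
  define g where "g = (\<lambda>i k. (u $ i * w $ i) ^ k / fact k)"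
  have norm_g: "norm (g i k) = (cmod (u $ i * w $ i)) ^ k / fact k" for i k
    by (simp add: g_def norm_divide norm_power)
  have summ: "summable (\<lambda>k. norm (g i k))" for i
    unfolding norm_g using summable_exp_generic[of "cmod (u $ i * w $ i)"]
    by (simp add: divide_inverse mult.commute)
  have abs: "(\<lambda>k. norm (g i k)) summable_on UNIV" for i
    using summ by (subst summable_on_UNIV_nonneg_real_iff) auto
  have gi: "(\<Sum>\<^sub>\<infinity>k. g i k) = exp (u $ i * w $ i)" for i
  proof -
    have "(g i has_sum (\<Sum>k. g i k)) UNIV"
      by (rule norm_summable_imp_has_sum[OF summ summable_sums[OF summable_norm_cancel[OF summ]]])
    moreover have "(\<Sum>k. g i k) = exp (u $ i * w $ i)"
      by (simp add: exp_def g_def scaleR_conv_of_real divide_inverse mult.commute)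
    ultimately show ?thesis by (simp add: infsumI)
  qed
  have PiE: "PiE (UNIV :: 'n set) (\<lambda>_. UNIV :: nat set) = UNIV" by simp
  have "infsum (\<lambda>\<eta>. \<Prod>i\<in>UNIV. g i (\<eta> i)) (PiE UNIV (\<lambda>_. UNIV)) = (\<Prod>i\<in>UNIV. infsum (g i) UNIV)"
    by (rule infsum_prod_PiE_abs) (use abs in auto)
  also have "\<dots> = exp (dotc u w)"
    by (simp add: gi dotc_def exp_sum)
  finally have val: "infsum (\<lambda>\<eta>. \<Prod>i\<in>UNIV. g i (\<eta> i)) UNIV = exp (dotc u w)"
    unfolding PiE .
  have "(\<lambda>\<eta>. \<Prod>i\<in>UNIV. norm (g i (\<eta> i))) summable_on UNIV"
    by (rule summable_on_multi_index_prod) (use summ in auto)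
  hence "(\<lambda>\<eta>. \<Prod>i\<in>UNIV. g i (\<eta> i)) summable_on UNIV"
    unfolding prod_norm by (rule abs_summable_summable)
  from has_sum_infsum[OF this]
  have "((\<lambda>\<eta>. \<Prod>i\<in>UNIV. g i (\<eta> i)) has_sum exp (dotc u w)) UNIV"
    unfolding val .
  moreover have "(\<Prod>i\<in>UNIV. g i (\<eta> i)) = mindex_power w \<eta> / of_real (mindex_fact \<eta>) * mindex_power u \<eta>" for \<eta>
    by (simp add: g_def prod_dividef power_mult_distrib prod.distrib mindex_power_def mindex_fact_def)
  ultimately show "((\<lambda>\<eta>. mindex_power w \<eta> / of_real (mindex_fact \<eta>) * mindex_power u \<eta>) has_sum exp (dotc u w)) UNIV"
    by simp
qed

text \<open>The terms of the squared norm are those of the exponential series in the variables |w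
  i|^2 / \<alpha> i. Hence symbols evaluate an operator at elements of its domain.\<close>

lemma exp_dotc_in_fock_space:
  fixes \<alpha> :: "real ^ 'n::finite"
  assumes "\<forall>i. \<alpha> $ i > 0"
  shows "(\<lambda>u. exp (dotc u w)) \<in> fock_space \<alpha>"
proof (rule fock_space_I[OF has_power_series_exp_dotc])
  have pos: "\<alpha> $ i > 0" for i using assms by blast
  have "(\<lambda>\<eta>. (\<Prod>i\<in>UNIV. ((cmod (w $ i))\<^sup>2 / \<alpha> $ i) ^ \<eta> i) / mindex_fact \<eta>) summable_on UNIV"
    by (rule summable_on_power_over_mindex_fact) (use pos in \<open>simp add: less_imp_le\<close>)
  moreover have "fock_weight \<alpha> \<eta> * (cmod (mindex_power w \<eta> / of_real (mindex_fact \<eta>)))\<^sup>2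
      = (\<Prod>i\<in>UNIV. ((cmod (w $ i))\<^sup>2 / \<alpha> $ i) ^ \<eta> i) / mindex_fact \<eta>" for \<eta>
  proof -
    have "(\<Prod>i\<in>UNIV. ((cmod (w $ i))\<^sup>2 / \<alpha> $ i) ^ \<eta> i) = (cmod (mindex_power w \<eta>))\<^sup>2 / mindex_power \<alpha> \<eta>"
    proof -
      have "(cmod (mindex_power w \<eta>))\<^sup>2 = (\<Prod>i\<in>UNIV. ((cmod (w $ i))\<^sup>2) ^ \<eta> i)"
        by (simp add: norm_mindex_power prod_power_distrib mult.commute flip: power_mult)
      thus ?thesis
        by (simp add: power_divide prod_dividef mindex_power_def[of \<alpha>])
    qed
    thus ?thesis
      using mindex_fact_pos[of \<eta>]
      by (simp add: norm_divide power_divide power2_eq_square)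
  qed
  ultimately show "(\<lambda>\<eta>. fock_weight \<alpha> \<eta> * (cmod (mindex_power w \<eta> / of_real (mindex_fact \<eta>)))\<^sup>2) summable_on UNIV"
    by simp
qed

text \<open>The common shape of the coefficient majorants: 1 over the root of a Fock weight has this
  form with x = sqrt \<beta>, and the root of a Fock weight over \<xi>! has it with x = 1 / sqrt
  \<alpha>. Factors R^\<eta> are absorbed by rescaling x.\<close>

definition root_weight :: "('n::finite \<Rightarrow> real) \<Rightarrow> ('n \<Rightarrow> nat) \<Rightarrow> real" where
  "root_weight x \<eta> = (\<Prod>i\<in>UNIV. x i ^ \<eta> i / sqrt (fact (\<eta> i)))"

lemma root_weight_sum_type:
  "root_weight (case_sum x y) \<zeta> = root_weight x (\<zeta> \<circ> Inl) * root_weight y (\<zeta> \<circ> Inr)"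
  by (simp add: root_weight_def prod_UNIV_sum_type)

lemma root_weight_mult:
  "root_weight x \<eta> * (\<Prod>i\<in>UNIV. y i ^ \<eta> i) = root_weight (\<lambda>i. x i * y i) \<eta>"
  by (simp add: root_weight_def power_mult_distrib flip: prod.distrib)

text \<open>The term is u v with u^2 = (2 x^2)^k / k! and v^2 = (1 / 2)^k, hence at most u^2 + v^2.
  The factor 2 in u is there to leave a convergent geometric series for v.\<close>

lemma summable_power_over_sqrt_fact:
  fixes x :: real
  assumes "x \<ge> 0"
  shows "summable (\<lambda>k. x ^ k / sqrt (fact k))"
proof (rule summable_comparison_test')
  have "summable (\<lambda>k. (2 * x\<^sup>2) ^ k / fact k)"
    using summable_exp_generic[of "2 * x\<^sup>2"] by (simp add: divide_inverse mult.commute)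
  moreover have "summable (\<lambda>k. (1 / 2 :: real) ^ k)"
    by (rule summable_geometric) simp
  ultimately show "summable (\<lambda>k. (2 * x\<^sup>2) ^ k / fact k + (1 / 2) ^ k)"
    by (rule summable_add)
  fix k :: nat
  define u where "u = (sqrt 2 * x) ^ k / sqrt (fact k)"
  define v where "v = (1 / sqrt 2) ^ k"
  have "u * v = x ^ k / sqrt (fact k)"
    by (simp add: u_def v_def power_mult_distrib power_divide)
  moreover have "u\<^sup>2 = (2 * x\<^sup>2) ^ k / fact k"
    by (simp add: u_def power_divide power_mult_distrib flip: power_mult) (simp add: power_mult mult.commute[of k])
  moreover have "v\<^sup>2 = (1 / 2) ^ k"
    by (simp add: v_def power_divide flip: power_mult) (simp add: power_mult mult.commute[of k])
  moreover have "u * v \<le> u\<^sup>2 + v\<^sup>2"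
    using sum_squares_bound[of u v] zero_le_power2[of u] zero_le_power2[of v] by linarith
  ultimately show "norm (x ^ k / sqrt (fact k)) \<le> (2 * x\<^sup>2) ^ k / fact k + (1 / 2) ^ k"
    using assms by simp
qed

lemma summable_on_root_weight:
  assumes "\<And>i. x i \<ge> 0"
  shows "root_weight x summable_on UNIV"
  unfolding root_weight_def
  by (rule summable_on_multi_index_prod) (use assms summable_power_over_sqrt_fact in auto)

lemma sqrt_prod: "sqrt (\<Prod>i\<in>A. h i) = (\<Prod>i\<in>A. sqrt (h i))"
  by (induction A rule: infinite_finite_induct) (auto simp: real_sqrt_mult)

lemma inverse_sqrt_fock_weight:
  fixes \<beta> :: "real ^ 'n::finite"
  shows "1 / sqrt (fock_weight \<beta> \<eta>) = root_weight (\<lambda>i. sqrt (\<beta> $ i)) \<eta>"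
  by (simp add: root_weight_def mindex_fact_def mindex_power_def real_sqrt_divide real_sqrt_power
      prod_dividef sqrt_prod)

lemma sqrt_fock_weight_over_mindex_fact:
  fixes \<alpha> :: "real ^ 'n::finite"
  shows "sqrt (fock_weight \<alpha> \<xi>) / mindex_fact \<xi> = root_weight (\<lambda>i. 1 / sqrt (\<alpha> $ i)) \<xi>"
proof -
  have "sqrt (fock_weight \<alpha> \<xi>) / mindex_fact \<xi> = 1 / (sqrt (mindex_fact \<xi>) * sqrt (mindex_power \<alpha> \<xi>))"
  proof -
    have "sqrt (x / y) / x = 1 / (sqrt x * sqrt y)" if "x > 0" for x y :: real
    proof -
      have "sqrt (x / y) / x = sqrt (x / y) / (sqrt x * sqrt x)" using that by simp
      also have "\<dots> = 1 / (sqrt x * sqrt y)"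
        using that by (simp add: real_sqrt_divide del: real_sqrt_mult_self)
      finally show ?thesis .
    qed
    from this[OF mindex_fact_pos] show ?thesis .
  qed
  also have "\<dots> = root_weight (\<lambda>i. 1 / sqrt (\<alpha> $ i)) \<xi>"
    by (simp add: root_weight_def mindex_fact_def mindex_power_def real_sqrt_power
        prod_dividef power_divide sqrt_prod prod.distrib mult.commute)
  finally show ?thesis .
qed

section \<open>Matrix coefficients of bounded operators\<close>

definition operator_coeff ::
  "((complex ^ ('n::finite) \<Rightarrow> complex) \<Rightarrow> (complex ^ ('m::finite) \<Rightarrow> complex)) \<Rightarrow>
     ('m \<Rightarrow> nat) \<Rightarrow> ('n \<Rightarrow> nat) \<Rightarrow> complex" where
  "operator_coeff T \<zeta> \<xi> = power_series_coeff (T (\<lambda>z. mindex_power z \<xi>)) \<zeta>"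

lemma fock_bounded_linear_bound:
  assumes "\<forall>i. \<alpha> $ i > 0" "\<forall>i. \<beta> $ i > 0" "fock_bounded_linear \<alpha> \<beta> T"
  obtains C where "C \<ge> 0" "\<And>f. f \<in> fock_space \<alpha> \<Longrightarrow> fock_norm \<beta> (T f) \<le> C * fock_norm \<alpha> f"
proof -
  obtain C where C: "\<And>f. f \<in> fock_space \<alpha> \<Longrightarrow> fock_norm \<beta> (T f) \<le> C * fock_norm \<alpha> f"
    using assms(3) unfolding fock_bounded_linear_def by blast
  have "fock_norm \<beta> (T f) \<le> \<bar>C\<bar> * fock_norm \<alpha> f" if "f \<in> fock_space \<alpha>" for f
  proof -
    have "C * fock_norm \<alpha> f \<le> \<bar>C\<bar> * fock_norm \<alpha> f"
      using fock_norm_nonneg[OF assms(1), of f] by (intro mult_right_mono) auto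
    thus ?thesis using C[OF that] by linarith
  qed
  thus ?thesis using that[of "\<bar>C\<bar>"] by auto
qed

lemma fock_bounded_linear_D:
  assumes "fock_bounded_linear \<alpha> \<beta> T" "f \<in> fock_space \<alpha>"
  shows "T f \<in> fock_space \<beta>"
    and "g \<in> fock_space \<alpha> \<Longrightarrow> T (\<lambda>z. f z + g z) = (\<lambda>z. T f z + T g z)"
    and "T (\<lambda>z. c * f z) = (\<lambda>z. c * T f z)"
  using assms unfolding fock_bounded_linear_def by blast+

text \<open>Reading off one coefficient of the image turns an operator into a functional, to which
  the results on functionals apply. The bound keeps its dependence on \<zeta>, since the decay of 1
  over the root of the weight is what later makes sums over \<zeta> converge.\<close>

lemma coefficient_functional_bounded:
  assumes \<alpha>: "\<forall>i. \<alpha> $ i > 0" and \<beta>: "\<forall>i. \<beta> $ i > 0" and T: "fock_bounded_linear \<alpha> \<beta> T"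
    and C: "\<And>f. f \<in> fock_space \<alpha> \<Longrightarrow> fock_norm \<beta> (T f) \<le> C * fock_norm \<alpha> f"
  shows "fock_bounded_functional \<alpha> (C / sqrt (fock_weight \<beta> \<zeta>)) (\<lambda>f. power_series_coeff (T f) \<zeta>)"
  unfolding fock_bounded_functional_def
proof (intro conjI ballI allI)
  fix f assume f: "f \<in> fock_space \<alpha>"
  have Tf: "T f \<in> fock_space \<beta>" by (rule fock_bounded_linear_D[OF T f])
  show "power_series_coeff (T (\<lambda>z. c * f z)) \<zeta> = c * power_series_coeff (T f) \<zeta>" for c
    unfolding fock_bounded_linear_D(3)[OF T f]
    by (subst power_series_coeff_eq[OF has_power_series_cmult[OF fock_space_D(1)[OF Tf]]]) simp
  have "sqrt (fock_weight \<beta> \<zeta>) * cmod (power_series_coeff (T f) \<zeta>) \<le> C * fock_norm \<alpha> f"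
    using sqrt_weight_coeff_le_fock_norm[OF \<beta> Tf, of \<zeta>] C[OF f] by linarith
  moreover have "sqrt (fock_weight \<beta> \<zeta>) > 0" using fock_weight_pos[OF \<beta>, of \<zeta>] by (simp only: real_sqrt_gt_0_iff)
  ultimately show "cmod (power_series_coeff (T f) \<zeta>) \<le> C / sqrt (fock_weight \<beta> \<zeta>) * fock_norm \<alpha> f"
    by (simp add: pos_le_divide_eq mult.commute del: real_sqrt_gt_0_iff)
  fix g assume g: "g \<in> fock_space \<alpha>"
  have Tg: "T g \<in> fock_space \<beta>" by (rule fock_bounded_linear_D[OF T g])
  show "power_series_coeff (T (\<lambda>z. f z + g z)) \<zeta> = power_series_coeff (T f) \<zeta> + power_series_coeff (T g) \<zeta>"
    unfolding fock_bounded_linear_D(2)[OF T f g]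
    by (subst power_series_coeff_eq[OF has_power_series_add[OF fock_space_D(1)[OF Tf] fock_space_D(1)[OF Tg]]]) simp
qed

lemma operator_coeff_bound:
  assumes \<alpha>: "\<forall>i. \<alpha> $ i > 0" and \<beta>: "\<forall>i. \<beta> $ i > 0" and T: "fock_bounded_linear \<alpha> \<beta> T"
    and C: "\<And>f. f \<in> fock_space \<alpha> \<Longrightarrow> fock_norm \<beta> (T f) \<le> C * fock_norm \<alpha> f"
  shows "cmod (operator_coeff T \<zeta> \<xi>) \<le> C * root_weight (\<lambda>i. sqrt (\<beta> $ i)) \<zeta> * sqrt (fock_weight \<alpha> \<xi>)"
proof -
  have "cmod (operator_coeff T \<zeta> \<xi>)
      \<le> C / sqrt (fock_weight \<beta> \<zeta>) * fock_norm \<alpha> (\<lambda>z. mindex_power z \<xi>)"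
    using coefficient_functional_bounded[OF \<alpha> \<beta> T C, of \<zeta>] monomial_in_fock_space[of \<xi> \<alpha>]
    unfolding fock_bounded_functional_def operator_coeff_def by blast
  thus ?thesis
    using inverse_sqrt_fock_weight[of \<zeta> \<beta>]
    by (simp only: fock_norm_monomial divide_inverse mult_1_left)
qed

text \<open>For fixed \<zeta> the coefficient functional acts term by term on the exponential; the
  power series of the image then sums over \<zeta>. An iterated sum alone does not give a sum over
  pairs, so absolute summability of the joint family is derived from the bound on the matrix
  coefficients.\<close>

lemma symbol_has_power_series:
  fixes \<alpha> :: "real ^ 'n::finite" and \<beta> :: "real ^ 'm::finite"
  assumes \<alpha>: "\<forall>i. \<alpha> $ i > 0" and \<beta>: "\<forall>i. \<beta> $ i > 0" and T: "fock_bounded_linear \<alpha> \<beta> T"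
  shows "has_power_series (symbol T)
    (\<lambda>\<zeta>. operator_coeff T (\<zeta> \<circ> Inl) (\<zeta> \<circ> Inr) / of_real (mindex_fact (\<zeta> \<circ> Inr)))"
  unfolding has_power_series_def
proof
  fix v :: "complex ^ ('m + 'n)"
  obtain C where C: "C \<ge> 0" "\<And>f. f \<in> fock_space \<alpha> \<Longrightarrow> fock_norm \<beta> (T f) \<le> C * fock_norm \<alpha> f"
    using fock_bounded_linear_bound[OF \<alpha> \<beta> T] by blast
  define z :: "complex ^ 'm" where "z = (\<chi> j. v $ Inl j)"
  define w :: "complex ^ 'n" where "w = (\<chi> i. v $ Inr i)"
  define e where "e = (\<lambda>u. exp (dotc u w))"
  define F where "F = (\<lambda>(\<zeta>, \<xi>). mindex_power w \<xi> / of_real (mindex_fact \<xi>) * operator_coeff T \<zeta> \<xi> * mindex_power z \<zeta>)"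
  \<comment> \<open>The left entries reflect the decay in the output exponent, the right ones the
    norm of the input monomial divided by \<xi>!.\<close>
  define x where "x = case_sum (\<lambda>j. sqrt (\<beta> $ j)) (\<lambda>i. 1 / sqrt (\<alpha> $ i))"
  define G where "G = (\<lambda>\<zeta>. C * (root_weight x \<zeta> * (\<Prod>i\<in>UNIV. cmod (v $ i) ^ \<zeta> i)))"
  have pos: "\<alpha> $ i \<ge> 0" "\<beta> $ j \<ge> 0" for i j
    using \<alpha> \<beta> by (auto simp: less_imp_le)
  have x: "x i \<ge> 0" for i by (auto simp: x_def pos split: sum.splits)
  have e: "e \<in> fock_space \<alpha>"
    unfolding e_def by (rule exp_dotc_in_fock_space[OF \<alpha>])
  have coeff_e: "power_series_coeff e \<xi> = mindex_power w \<xi> / of_real (mindex_fact \<xi>)" for \<xi>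
    unfolding e_def by (simp add: power_series_coeff_eq[OF has_power_series_exp_dotc])
  have inner: "((\<lambda>\<xi>. F (\<zeta>, \<xi>)) has_sum (power_series_coeff (T e) \<zeta> * mindex_power z \<zeta>)) UNIV" for \<zeta>
    using has_sum_cmult_left[OF functional_has_sum[OF \<alpha> coefficient_functional_bounded[OF \<alpha> \<beta> T C(2)] e, of \<zeta>],
        of "mindex_power z \<zeta>"]
    by (simp add: F_def coeff_e operator_coeff_def)
  have outer: "((\<lambda>\<zeta>. power_series_coeff (T e) \<zeta> * mindex_power z \<zeta>) has_sum T e z) UNIV"
    using fock_space_D(1)[OF fock_bounded_linear_D(1)[OF T e]] by (simp add: has_power_series_def)
  have F_le: "cmod (F (\<zeta> \<circ> Inl, \<zeta> \<circ> Inr)) \<le> G \<zeta>" for \<zeta>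
  proof -
    have "cmod (F (\<zeta> \<circ> Inl, \<zeta> \<circ> Inr)) = cmod (mindex_power z (\<zeta> \<circ> Inl)) * cmod (mindex_power w (\<zeta> \<circ> Inr)) *
        (cmod (operator_coeff T (\<zeta> \<circ> Inl) (\<zeta> \<circ> Inr)) / mindex_fact (\<zeta> \<circ> Inr))"
      using mindex_fact_pos[of "\<zeta> \<circ> Inr"] by (simp add: F_def norm_mult norm_divide)
    also have "\<dots> \<le> cmod (mindex_power z (\<zeta> \<circ> Inl)) * cmod (mindex_power w (\<zeta> \<circ> Inr)) *
        (C * root_weight (\<lambda>i. sqrt (\<beta> $ i)) (\<zeta> \<circ> Inl) * sqrt (fock_weight \<alpha> (\<zeta> \<circ> Inr)) / mindex_fact (\<zeta> \<circ> Inr))"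
      using mindex_fact_pos[of "\<zeta> \<circ> Inr"]
      by (intro mult_left_mono divide_right_mono operator_coeff_bound[OF \<alpha> \<beta> T C(2)]) auto
    also have "\<dots> = C * (root_weight (\<lambda>i. sqrt (\<beta> $ i)) (\<zeta> \<circ> Inl) *
        (sqrt (fock_weight \<alpha> (\<zeta> \<circ> Inr)) / mindex_fact (\<zeta> \<circ> Inr)) *
        (cmod (mindex_power z (\<zeta> \<circ> Inl)) * cmod (mindex_power w (\<zeta> \<circ> Inr))))"
      by (simp only: times_divide_eq_left times_divide_eq_right mult_ac)
    also have "\<dots> = G \<zeta>"
      unfolding sqrt_fock_weight_over_mindex_fact
      by (simp add: G_def x_def root_weight_sum_type norm_mindex_power z_def w_def prod_UNIV_sum_type)
    finally show ?thesis .
  qed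
  have "G summable_on UNIV"
    unfolding G_def root_weight_mult
    by (intro summable_on_cmult_right summable_on_root_weight) (use x in auto)
  hence "(\<lambda>\<zeta>. cmod (F (\<zeta> \<circ> Inl, \<zeta> \<circ> Inr))) summable_on UNIV"
    by (rule summable_on_comparison_test) (use F_le in auto)
  hence S: "(\<lambda>\<zeta>. F (\<zeta> \<circ> Inl, \<zeta> \<circ> Inr)) summable_on UNIV"
    by (rule abs_summable_summable)
  have bij: "(\<lambda>\<zeta>. F (\<zeta> \<circ> Inl, \<zeta> \<circ> Inr)) summable_on UNIV \<longleftrightarrow> F summable_on (UNIV \<times> UNIV)"
    by (rule summable_on_reindex_bij_witness[of _ "\<lambda>(\<zeta>, \<xi>). case_sum \<zeta> \<xi>" "\<lambda>\<zeta>. (\<zeta> \<circ> Inl, \<zeta> \<circ> Inr)"])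
       (auto simp: case_sum_comp_Inl_Inr)
  have "(F has_sum T e z) (UNIV \<times> UNIV)"
    by (rule has_sum_SigmaI[OF inner outer]) (use S bij in blast)
  moreover have "((\<lambda>\<zeta>. F (\<zeta> \<circ> Inl, \<zeta> \<circ> Inr)) has_sum T e z) UNIV \<longleftrightarrow> (F has_sum T e z) (UNIV \<times> UNIV)"
    by (rule has_sum_reindex_bij_witness[of _ "\<lambda>(\<zeta>, \<xi>). case_sum \<zeta> \<xi>" "\<lambda>\<zeta>. (\<zeta> \<circ> Inl, \<zeta> \<circ> Inr)"])
       (auto simp: case_sum_comp_Inl_Inr)
  ultimately have "((\<lambda>\<zeta>. F (\<zeta> \<circ> Inl, \<zeta> \<circ> Inr)) has_sum T e z) UNIV" by blast
  moreover have "symbol T v = T e z"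
    by (simp add: symbol_def e_def z_def w_def)
  ultimately show "((\<lambda>\<zeta>. operator_coeff T (\<zeta> \<circ> Inl) (\<zeta> \<circ> Inr) / of_real (mindex_fact (\<zeta> \<circ> Inr)) * mindex_power v \<zeta>)
      has_sum symbol T v) UNIV"
    by (simp add: F_def mindex_power_sum_type[of v] z_def w_def mult_ac)
qed

lemma fock_bounded_linear_comp:
  assumes \<alpha>: "\<forall>i. \<alpha> $ i > 0" and \<beta>: "\<forall>i. \<beta> $ i > 0" and \<gamma>: "\<forall>i. \<gamma> $ i > 0"
    and T: "fock_bounded_linear \<alpha> \<beta> T" and S: "fock_bounded_linear \<beta> \<gamma> S"
  shows "fock_bounded_linear \<alpha> \<gamma> (S \<circ> T)"
proof -
  obtain C where C: "C \<ge> 0" "\<And>f. f \<in> fock_space \<alpha> \<Longrightarrow> fock_norm \<beta> (T f) \<le> C * fock_norm \<alpha> f"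
    using fock_bounded_linear_bound[OF \<alpha> \<beta> T] by blast
  obtain D where D: "D \<ge> 0" "\<And>f. f \<in> fock_space \<beta> \<Longrightarrow> fock_norm \<gamma> (S f) \<le> D * fock_norm \<beta> f"
    using fock_bounded_linear_bound[OF \<beta> \<gamma> S] by blast
  have "fock_norm \<gamma> (S (T f)) \<le> D * C * fock_norm \<alpha> f" if f: "f \<in> fock_space \<alpha>" for f
    using D(2)[OF fock_bounded_linear_D(1)[OF T f]] mult_left_mono[OF C(2)[OF f] D(1)]
    by (simp add: mult.assoc)
  thus ?thesis
    unfolding fock_bounded_linear_def
    using fock_bounded_linear_D[OF T] fock_bounded_linear_D[OF S] by auto
qed

text \<open>Cauchy--Schwarz with the middle weights \<open>W\<close>: the row of S divided by
  \<open>W\<close> is controlled by \<open>functional_monomials_bound\<close>, the column of T times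
  \<open>W\<close> by the norm of the image of a monomial. The bound splits into a factor in
  \<kappa> and one in \<xi>, so it is summable in both after division by \<xi>!.\<close>

lemma contraction_coeff_bound:
  assumes \<alpha>: "\<forall>i. \<alpha> $ i > 0" and \<beta>: "\<forall>i. \<beta> $ i > 0" and \<gamma>: "\<forall>i. \<gamma> $ i > 0"
    and T: "fock_bounded_linear \<alpha> \<beta> T" and S: "fock_bounded_linear \<beta> \<gamma> S"
    and C: "C \<ge> 0" "\<And>f. f \<in> fock_space \<alpha> \<Longrightarrow> fock_norm \<beta> (T f) \<le> C * fock_norm \<alpha> f"
    and D: "D \<ge> 0" "\<And>f. f \<in> fock_space \<beta> \<Longrightarrow> fock_norm \<gamma> (S f) \<le> D * fock_norm \<beta> f"
    and A: "finite A"
  shows "(\<Sum>\<eta>\<in>A. cmod (operator_coeff S \<kappa> \<eta>) * cmod (operator_coeff T \<eta> \<xi>))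
           \<le> D * root_weight (\<lambda>i. sqrt (\<gamma> $ i)) \<kappa> * (C * sqrt (fock_weight \<alpha> \<xi>))"
proof -
  define W where "W = (\<lambda>\<eta> :: 'b \<Rightarrow> nat. sqrt (fock_weight \<beta> \<eta>))"
  have W: "W \<eta> > 0" for \<eta>
    unfolding W_def using fock_weight_pos[OF \<beta>, of \<eta>] by (simp only: real_sqrt_gt_0_iff)
  have W2: "(W \<eta>)\<^sup>2 = fock_weight \<beta> \<eta>" for \<eta>
    unfolding W_def using fock_weight_pos[OF \<beta>, of \<eta>] by (simp only: real_sqrt_pow2 less_imp_le)
  define f where "f = T (\<lambda>z. mindex_power z \<xi>)"
  have f: "f \<in> fock_space \<beta>"
    unfolding f_def by (intro fock_bounded_linear_D(1)[OF T] monomial_in_fock_space)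
  let ?a = "\<lambda>\<eta>. cmod (operator_coeff S \<kappa> \<eta>) / W \<eta>" and ?b = "\<lambda>\<eta>. W \<eta> * cmod (operator_coeff T \<eta> \<xi>)"
  have "(\<Sum>\<eta>\<in>A. cmod (operator_coeff S \<kappa> \<eta>) * cmod (operator_coeff T \<eta> \<xi>)) = (\<Sum>\<eta>\<in>A. \<bar>?a \<eta>\<bar> * \<bar>?b \<eta>\<bar>)"
    using W by (intro sum.cong) (auto simp: abs_mult abs_of_pos less_imp_neq[THEN not_sym])
  also have "\<dots> \<le> L2_set ?a A * L2_set ?b A"
    by (rule L2_set_mult_ineq)
  also have "\<dots> \<le> (D / sqrt (fock_weight \<gamma> \<kappa>)) * (C * sqrt (fock_weight \<alpha> \<xi>))"
  proof (rule mult_mono)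
    have D0: "0 \<le> D / sqrt (fock_weight \<gamma> \<kappa>)"
      by (rule divide_nonneg_nonneg[OF D(1) real_sqrt_ge_zero[OF less_imp_le[OF fock_weight_pos[OF \<gamma>]]]])
    show "0 \<le> D / sqrt (fock_weight \<gamma> \<kappa>)" by (rule D0)
    have "(\<Sum>\<eta>\<in>A. (?a \<eta>)\<^sup>2) \<le> (D / sqrt (fock_weight \<gamma> \<kappa>))\<^sup>2"
      using functional_monomials_bound[OF \<beta> coefficient_functional_bounded[OF \<beta> \<gamma> S D(2)] D0 A]
      by (simp only: power_divide W2 operator_coeff_def)
    thus "L2_set ?a A \<le> D / sqrt (fock_weight \<gamma> \<kappa>)"
      unfolding L2_set_def using D0 real_le_lsqrt by blast
    show "0 \<le> L2_set ?b A" by (rule L2_set_nonneg)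
    have "(\<Sum>\<eta>\<in>A. (?b \<eta>)\<^sup>2) = (\<Sum>\<eta>\<in>A. fock_weight \<beta> \<eta> * (cmod (power_series_coeff f \<eta>))\<^sup>2)"
      by (simp only: power_mult_distrib W2 operator_coeff_def f_def)
    also have "\<dots> \<le> (\<Sum>\<^sub>\<infinity>\<eta>. fock_weight \<beta> \<eta> * (cmod (power_series_coeff f \<eta>))\<^sup>2)"
      using fock_weight_pos[OF \<beta>]
      by (intro finite_sum_le_infsum fock_space_D f A mult_nonneg_nonneg) (auto simp: less_imp_le)
    also have "\<dots> = (fock_norm \<beta> f)\<^sup>2"
      by (rule fock_norm_sq[OF \<beta>, symmetric])
    finally have "L2_set ?b A \<le> fock_norm \<beta> f"
      unfolding L2_set_def using fock_norm_nonneg[OF \<beta>, of f] real_le_lsqrt by blast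
    also have "\<dots> \<le> C * sqrt (fock_weight \<alpha> \<xi>)"
      using C(2)[OF monomial_in_fock_space, of \<xi>] unfolding f_def fock_norm_monomial .
    finally show "L2_set ?b A \<le> C * sqrt (fock_weight \<alpha> \<xi>)" .
  qed
  also have "D / sqrt (fock_weight \<gamma> \<kappa>) = D * root_weight (\<lambda>i. sqrt (\<gamma> $ i)) \<kappa>"
    unfolding inverse_sqrt_fock_weight[symmetric] by simp
  finally show ?thesis .
qed

section \<open>Composition of Lee--Yang operators\<close>

lemma lee_yang_operator_comp:
  fixes \<alpha> :: "real ^ 'n::finite" and \<beta> :: "real ^ 'm::finite" and \<gamma> :: "real ^ 'k::finite"
  assumes \<alpha>: "\<forall>i. \<alpha> $ i > 0" and \<beta>: "\<forall>i. \<beta> $ i > 0" and \<gamma>: "\<forall>i. \<gamma> $ i > 0"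
    and T: "lee_yang_operator \<alpha> \<beta> T" and S: "lee_yang_operator \<beta> \<gamma> S"
  shows "lee_yang_operator \<alpha> \<gamma> (S \<circ> T)"
proof -
  have bT: "fock_bounded_linear \<alpha> \<beta> T" and bS: "fock_bounded_linear \<beta> \<gamma> S"
    using T S by (auto simp: lee_yang_operator_def)
  have bST: "fock_bounded_linear \<alpha> \<gamma> (S \<circ> T)"
    by (rule fock_bounded_linear_comp[OF \<alpha> \<beta> \<gamma> bT bS])
  obtain C where C: "C \<ge> 0" "\<And>f. f \<in> fock_space \<alpha> \<Longrightarrow> fock_norm \<beta> (T f) \<le> C * fock_norm \<alpha> f"
    using fock_bounded_linear_bound[OF \<alpha> \<beta> bT] by blast
  obtain D where D: "D \<ge> 0" "\<And>f. f \<in> fock_space \<beta> \<Longrightarrow> fock_norm \<gamma> (S f) \<le> D * fock_norm \<beta> f"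
    using fock_bounded_linear_bound[OF \<beta> \<gamma> bS] by blast
  define s where "s = (\<lambda>\<zeta> :: 'k + 'm \<Rightarrow> nat.
      operator_coeff S (\<zeta> \<circ> Inl) (\<zeta> \<circ> Inr) / of_real (mindex_fact (\<zeta> \<circ> Inr)))"
  define t where "t = (\<lambda>\<zeta> :: 'm + 'n \<Rightarrow> nat.
      operator_coeff T (\<zeta> \<circ> Inl) (\<zeta> \<circ> Inr) / of_real (mindex_fact (\<zeta> \<circ> Inr)))"
  define x where "x = case_sum (\<lambda>i. sqrt (\<gamma> $ i)) (\<lambda>i. 1 / sqrt (\<alpha> $ i))"
  have x: "x i \<ge> 0" for i
    using \<alpha> \<gamma> by (auto simp: x_def less_imp_le split: sum.splits)
  \<comment> \<open>The factor \<eta>! of the contraction cancels the denominator of s, and a term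
    of a matrix product over \<xi>! is left.\<close>
  have st: "of_real (mindex_fact \<eta>) * (s (case_sum (\<zeta> \<circ> Inl) \<eta>) * t (case_sum \<eta> (\<zeta> \<circ> Inr)))
      = operator_coeff T \<eta> (\<zeta> \<circ> Inr) * operator_coeff S (\<zeta> \<circ> Inl) \<eta> / of_real (mindex_fact (\<zeta> \<circ> Inr))"
    for \<zeta> :: "'k + 'n \<Rightarrow> nat" and \<eta>
    using mindex_fact_pos[of \<eta>] by (simp add: s_def t_def o_def)
  have st_norm: "mindex_fact \<eta> * (cmod (s (case_sum (\<zeta> \<circ> Inl) \<eta>)) * cmod (t (case_sum \<eta> (\<zeta> \<circ> Inr))))
      = cmod (operator_coeff S (\<zeta> \<circ> Inl) \<eta>) * cmod (operator_coeff T \<eta> (\<zeta> \<circ> Inr)) / mindex_fact (\<zeta> \<circ> Inr)"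
    for \<zeta> :: "'k + 'n \<Rightarrow> nat" and \<eta>
    using mindex_fact_pos[of \<eta>] mindex_fact_pos[of "\<lambda>i. \<zeta> (Inr i)"]
    by (simp add: s_def t_def o_def norm_divide)
  have partial: "(\<Sum>\<eta>\<in>A. mindex_fact \<eta> * (cmod (s (case_sum (\<zeta> \<circ> Inl) \<eta>)) * cmod (t (case_sum \<eta> (\<zeta> \<circ> Inr)))))
      \<le> D * C * root_weight x \<zeta>" if "finite A" for \<zeta> A
  proof -
    have "(\<Sum>\<eta>\<in>A. mindex_fact \<eta> * (cmod (s (case_sum (\<zeta> \<circ> Inl) \<eta>)) * cmod (t (case_sum \<eta> (\<zeta> \<circ> Inr)))))
        = (\<Sum>\<eta>\<in>A. cmod (operator_coeff S (\<zeta> \<circ> Inl) \<eta>) * cmod (operator_coeff T \<eta> (\<zeta> \<circ> Inr))) / mindex_fact (\<zeta> \<circ> Inr)"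
      by (simp only: st_norm sum_divide_distrib)
    also have "\<dots> \<le> D * root_weight (\<lambda>i. sqrt (\<gamma> $ i)) (\<zeta> \<circ> Inl) * (C * sqrt (fock_weight \<alpha> (\<zeta> \<circ> Inr))) / mindex_fact (\<zeta> \<circ> Inr)"
      using mindex_fact_pos[of "\<zeta> \<circ> Inr"]
      by (intro divide_right_mono contraction_coeff_bound[OF \<alpha> \<beta> \<gamma> bT bS C D that]) auto
    also have "\<dots> = D * C * (root_weight (\<lambda>i. sqrt (\<gamma> $ i)) (\<zeta> \<circ> Inl) * (sqrt (fock_weight \<alpha> (\<zeta> \<circ> Inr)) / mindex_fact (\<zeta> \<circ> Inr)))"
      by (simp only: times_divide_eq_left times_divide_eq_right mult_ac)
    also have "\<dots> = D * C * root_weight x \<zeta>"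
      unfolding sqrt_fock_weight_over_mindex_fact x_def root_weight_sum_type ..
    finally show ?thesis .
  qed
  have summ: "(\<lambda>\<eta>. mindex_fact \<eta> * (cmod (s (case_sum (\<zeta> \<circ> Inl) \<eta>)) * cmod (t (case_sum \<eta> (\<zeta> \<circ> Inr))))) summable_on UNIV"
    for \<zeta> :: "'k + 'n \<Rightarrow> nat"
  proof (rule nonneg_bdd_above_summable_on)
    show "0 \<le> mindex_fact \<eta> * (cmod (s (case_sum (\<zeta> \<circ> Inl) \<eta>)) * cmod (t (case_sum \<eta> (\<zeta> \<circ> Inr))))" for \<eta>
      using mindex_fact_pos[of \<eta>] by simp
    show "bdd_above (sum (\<lambda>\<eta>. mindex_fact \<eta> * (cmod (s (case_sum (\<zeta> \<circ> Inl) \<eta>)) * cmod (t (case_sum \<eta> (\<zeta> \<circ> Inr)))))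
        ` {F. F \<subseteq> UNIV \<and> finite F})"
      by (rule bdd_aboveI2[where M = "D * C * root_weight x \<zeta>"]) (simp only: mem_Collect_eq partial)
  qed
  have "symbol (S \<circ> T) \<in> LY"
  proof (rule LY_contraction[where f = "symbol S" and g = "symbol T" and s = s and t = t
        and M = "\<lambda>\<zeta>. D * C * root_weight x \<zeta>"])
    show "symbol S \<in> LY" "symbol T \<in> LY"
      using S T by (auto simp: lee_yang_operator_def)
    show "has_power_series (symbol S) s"
      unfolding s_def by (rule symbol_has_power_series[OF \<beta> \<gamma> bS])
    show "has_power_series (symbol T) t"
      unfolding t_def by (rule symbol_has_power_series[OF \<alpha> \<beta> bT])
    show "(\<Sum>\<^sub>\<infinity>\<eta>. mindex_fact \<eta> * (cmod (s (case_sum (\<zeta> \<circ> Inl) \<eta>)) * cmod (t (case_sum \<eta> (\<zeta> \<circ> Inr)))))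
        \<le> D * C * root_weight x \<zeta>" for \<zeta>
      by (rule infsum_le_finite_sums[OF summ partial])
    show "(\<lambda>\<zeta>. D * C * root_weight x \<zeta> * (\<Prod>i\<in>UNIV. R ^ \<zeta> i)) summable_on UNIV" if "R \<ge> 0" for R
      unfolding mult.assoc[of "D * C"] root_weight_mult
      by (intro summable_on_cmult_right summable_on_root_weight) (use x that in auto)
    have "(\<Sum>\<^sub>\<infinity>\<eta>. of_real (mindex_fact \<eta>) * (s (case_sum (\<zeta> \<circ> Inl) \<eta>) * t (case_sum \<eta> (\<zeta> \<circ> Inr))))
        = operator_coeff (S \<circ> T) (\<zeta> \<circ> Inl) (\<zeta> \<circ> Inr) / of_real (mindex_fact (\<zeta> \<circ> Inr))"
      for \<zeta> :: "'k + 'n \<Rightarrow> nat"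
    proof -
      \<comment> \<open>The matrix of the composition is the product of the matrices: a coefficient
        functional of S is applied term by term to the image of a monomial under T.\<close>
      have "((\<lambda>\<eta>. operator_coeff T \<eta> (\<zeta> \<circ> Inr) * operator_coeff S (\<zeta> \<circ> Inl) \<eta>)
          has_sum operator_coeff (S \<circ> T) (\<zeta> \<circ> Inl) (\<zeta> \<circ> Inr)) UNIV"
        using functional_has_sum[OF \<beta> coefficient_functional_bounded[OF \<beta> \<gamma> bS D(2)]
            fock_bounded_linear_D(1)[OF bT monomial_in_fock_space], of "\<zeta> \<circ> Inr" "\<zeta> \<circ> Inl"]
        unfolding operator_coeff_def comp_apply .
      thus ?thesis
        unfolding st by (intro infsumI has_sum_divide_const)
    qed
    thus "has_power_series (symbol (S \<circ> T)) (\<lambda>\<zeta>. \<Sum>\<^sub>\<infinity>\<eta>. of_real (mindex_fact \<eta>) *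
        (s (case_sum (\<zeta> \<circ> Inl) \<eta>) * t (case_sum \<eta> (\<zeta> \<circ> Inr))))"
      using symbol_has_power_series[OF \<alpha> \<gamma> bST] by simp
  qed (rule summ)
  thus ?thesis using bST by (simp add: lee_yang_operator_def)
qed

text \<open>The substitution carries points with positive real parts to such points and compact sets
  to compact sets, so the approximants can be composed with it. That the composite is entire is left
  to the caller, where an explicit power series is at hand.\<close>

lemma LY_subst:
  fixes g :: "'b::finite \<Rightarrow> complex ^ 'a::finite \<Rightarrow> complex"
  assumes f: "f \<in> LY" and g: "\<And>i. polynomial_fun (g i)"
    and pos: "\<And>z i. (\<forall>j. Re (z $ j) > 0) \<Longrightarrow> Re (g i z) > 0"
    and entire: "entire (\<lambda>z. f (\<chi> i. g i z))"
  shows "(\<lambda>z. f (\<chi> i. g i z)) \<in> LY"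
proof -
  obtain p where p: "\<And>j. polynomial_fun (p j)" "\<And>j z. \<forall>i. Re (z $ i) > 0 \<Longrightarrow> p j z \<noteq> 0"
    "\<And>K. compact K \<Longrightarrow> uniform_limit K p f sequentially"
    using f unfolding LY_def by blast
  have "uniform_limit K (\<lambda>j z. p j (\<chi> i. g i z)) (\<lambda>z. f (\<chi> i. g i z)) sequentially" if K: "compact K" for K
  proof -
    have "compact ((\<lambda>z. \<chi> i. g i z) ` K)"
      by (intro compact_continuous_image K continuous_on_vec_lambda continuous_on_polynomial_fun g)
    from p(3)[OF this] show ?thesis
      unfolding uniform_limit_iff by simp
  qed
  moreover have "polynomial_fun (\<lambda>z. p j (\<chi> i. g i z))" for j
    by (rule polynomial_fun_subst[OF p(1) g])
  moreover have "p j (\<chi> i. g i z) \<noteq> 0" if "\<forall>i. Re (z $ i) > 0" for j z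
    by (rule p(2)) (simp add: pos[OF that])
  ultimately show ?thesis
    unfolding LY_def using entire
    by (intro CollectI conjI exI[of _ "\<lambda>j z. p j (\<chi> i. g i z)"]) auto
qed

lemma fock_continuous_functional_bounded:
  assumes \<beta>: "\<forall>i. \<beta> $ i > 0" and \<phi>: "fock_continuous_functional \<beta> \<phi>"
  obtains C where "C \<ge> 0" "fock_bounded_functional \<beta> C \<phi>"
proof -
  have zero: "(\<lambda>z. 0) \<in> fock_space \<beta>"
    using monomials_in_fock_space[of "{}"] by simp
  have add: "\<phi> (\<lambda>z. f z + g z) = \<phi> f + \<phi> g" if "f \<in> fock_space \<beta>" "g \<in> fock_space \<beta>" for f g
    using \<phi> that unfolding fock_continuous_functional_def by blast
  have scale: "\<phi> (\<lambda>z. c * f z) = c * \<phi> f" if "f \<in> fock_space \<beta>" for c f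
    using \<phi> that unfolding fock_continuous_functional_def by blast
  have \<phi>0: "\<phi> (\<lambda>z. 0) = 0" using scale[OF zero, of 0] by simp
  have "\<forall>f\<in>fock_space \<beta>. \<forall>\<epsilon>>0. \<exists>\<delta>>0. \<forall>g\<in>fock_space \<beta>.
        fock_norm \<beta> (\<lambda>z. g z - f z) < \<delta> \<longrightarrow> cmod (\<phi> g - \<phi> f) < \<epsilon>"
    using \<phi> unfolding fock_continuous_functional_def by (elim conjE)
  from this[rule_format, OF zero, of 1] obtain \<delta> where \<delta>: "\<delta> > 0"
    "\<And>g. g \<in> fock_space \<beta> \<Longrightarrow> fock_norm \<beta> g < \<delta> \<Longrightarrow> cmod (\<phi> g) < 1"
    by (auto simp: \<phi>0)
  have "cmod (\<phi> f) \<le> 1 / \<delta> * fock_norm \<beta> f" if f: "f \<in> fock_space \<beta>" for f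
  proof (rule field_le_epsilon)
    fix e :: real assume e: "e > 0"
    \<comment> \<open>The summand \<delta> e makes r positive even if f has norm 0, and it makes the
      norm of the rescaled function strictly less than \<delta>.\<close>
    define r where "r = fock_norm \<beta> f + \<delta> * e"
    have nf: "0 \<le> fock_norm \<beta> f" by (rule fock_norm_nonneg[OF \<beta>])
    have r: "r > 0" "fock_norm \<beta> f < r"
      using nf e \<delta>(1) by (auto simp: r_def intro: add_nonneg_pos)
    have "fock_norm \<beta> (\<lambda>z. of_real (\<delta> / r) * f z) = \<delta> / r * fock_norm \<beta> f"
      using r \<delta>(1) by (subst fock_norm_cmult[OF f]) (simp del: of_real_divide)
    also have "\<dots> < \<delta>"
      using r \<delta>(1) by (simp add: field_simps)
    finally have "cmod (\<phi> (\<lambda>z. of_real (\<delta> / r) * f z)) < 1"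
      by (intro \<delta>(2) fock_space_cmult f)
    hence "cmod (of_real (\<delta> / r) * \<phi> f) < 1"
      unfolding scale[OF f] .
    hence "\<delta> / r * cmod (\<phi> f) < 1"
      using r \<delta>(1) by (simp add: norm_mult del: of_real_divide)
    hence "cmod (\<phi> f) \<le> r / \<delta>"
      using r \<delta>(1) by (simp add: field_simps)
    also have "\<dots> = 1 / \<delta> * fock_norm \<beta> f + e"
      using \<delta>(1) by (simp add: r_def field_simps)
    finally show "cmod (\<phi> f) \<le> 1 / \<delta> * fock_norm \<beta> f + e" .
  qed
  hence "fock_bounded_functional \<beta> (1 / \<delta>) \<phi>"
    unfolding fock_bounded_functional_def using add scale by blast
  thus ?thesis using that[of "1 / \<delta>"] \<delta>(1) by simp
qed

text \<open>A functional is handled as an operator into the constant functions.\<close>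

lemma fock_bounded_linear_const:
  assumes "fock_bounded_functional \<beta> C \<phi>"
  shows "fock_bounded_linear \<beta> \<gamma> (\<lambda>f _. \<phi> f)"
proof -
  \<comment> \<open>Constants are multiples of the monomial with exponent 0, whose weight is 1, so
    their norm does not depend on \<gamma>.\<close>
  have const: "(\<lambda>z. \<Sum>\<eta>\<in>{\<lambda>_. 0}. c * mindex_power z \<eta>) = (\<lambda>z. c)" for c :: complex
    by (simp add: mindex_power_def)
  have "(\<lambda>z. c) \<in> fock_space \<gamma>" for c
    using monomials_in_fock_space[of "{\<lambda>_. 0}" "\<lambda>_. c" \<gamma>] unfolding const by simp
  moreover have "fock_norm \<gamma> (\<lambda>z. c) = cmod c" for c
    using fock_norm_monomials[of "{\<lambda>_. 0}" \<gamma> "\<lambda>_. c"] unfolding const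
    by (simp add: mindex_fact_def mindex_power_def)
  ultimately show ?thesis
    using assms unfolding fock_bounded_linear_def fock_bounded_functional_def by auto
qed

lemma fock_continuous_functional_comp:
  assumes \<alpha>: "\<forall>i. \<alpha> $ i > 0" and \<beta>: "\<forall>i. \<beta> $ i > 0"
    and T: "fock_bounded_linear \<alpha> \<beta> T" and \<phi>: "fock_continuous_functional \<beta> \<phi>"
  shows "fock_continuous_functional \<alpha> (\<phi> \<circ> T)"
  unfolding fock_continuous_functional_def comp_apply
proof (intro conjI ballI allI impI)
  fix f assume f: "f \<in> fock_space \<alpha>"
  have Tf: "T f \<in> fock_space \<beta>" by (rule fock_bounded_linear_D[OF T f])
  show "\<phi> (T (\<lambda>z. c * f z)) = c * \<phi> (T f)" for c
    using \<phi> Tf unfolding fock_bounded_linear_D(3)[OF T f] fock_continuous_functional_def by blast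
  show "\<phi> (T (\<lambda>z. f z + g z)) = \<phi> (T f) + \<phi> (T g)" if "g \<in> fock_space \<alpha>" for g
    using \<phi> Tf fock_bounded_linear_D(1)[OF T that]
    unfolding fock_bounded_linear_D(2)[OF T f that] fock_continuous_functional_def by blast
  fix \<epsilon> :: real assume \<epsilon>: "\<epsilon> > 0"
  have "\<forall>f\<in>fock_space \<beta>. \<forall>\<epsilon>>0. \<exists>\<delta>>0. \<forall>g\<in>fock_space \<beta>.
        fock_norm \<beta> (\<lambda>z. g z - f z) < \<delta> \<longrightarrow> cmod (\<phi> g - \<phi> f) < \<epsilon>"
    using \<phi> unfolding fock_continuous_functional_def by (elim conjE)
  from this[rule_format, OF Tf \<epsilon>] obtain \<delta> where \<delta>: "\<delta> > 0"
    "\<And>g. g \<in> fock_space \<beta> \<Longrightarrow> fock_norm \<beta> (\<lambda>z. g z - T f z) < \<delta> \<Longrightarrow> cmod (\<phi> g - \<phi> (T f)) < \<epsilon>"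
    by blast
  obtain C where C: "C \<ge> 0" "\<And>f. f \<in> fock_space \<alpha> \<Longrightarrow> fock_norm \<beta> (T f) \<le> C * fock_norm \<alpha> f"
    using fock_bounded_linear_bound[OF \<alpha> \<beta> T] by blast
  show "\<exists>\<delta>>0. \<forall>g\<in>fock_space \<alpha>. fock_norm \<alpha> (\<lambda>z. g z - f z) < \<delta> \<longrightarrow> cmod (\<phi> (T g) - \<phi> (T f)) < \<epsilon>"
  \<comment> \<open>The bound C may be 0; C + 1 is a positive bound.\<close>
  proof (intro exI[of _ "\<delta> / (C + 1)"] conjI ballI impI)
    show "\<delta> / (C + 1) > 0" using \<delta>(1) C(1) by simp
    fix g assume g: "g \<in> fock_space \<alpha>" and less: "fock_norm \<alpha> (\<lambda>z. g z - f z) < \<delta> / (C + 1)"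
    have mf: "(\<lambda>z. - 1 * f z) \<in> fock_space \<alpha>" by (rule fock_space_cmult[OF f])
    have gf: "(\<lambda>z. g z - f z) \<in> fock_space \<alpha>"
      using fock_space_add[OF \<alpha> g mf] by simp
    have "T (\<lambda>z. g z + - 1 * f z) = (\<lambda>z. T g z + - 1 * T f z)"
      unfolding fock_bounded_linear_D(2)[OF T g mf] fock_bounded_linear_D(3)[OF T f] ..
    hence "fock_norm \<beta> (\<lambda>z. T g z - T f z) \<le> C * fock_norm \<alpha> (\<lambda>z. g z - f z)"
      using C(2)[OF gf] by simp
    also have "\<dots> \<le> (C + 1) * fock_norm \<alpha> (\<lambda>z. g z - f z)"
      by (intro mult_right_mono fock_norm_nonneg[OF \<alpha>]) simp
    also have "\<dots> < \<delta>" using less C(1) by (simp add: field_simps)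
    finally show "cmod (\<phi> (T g) - \<phi> (T f)) < \<epsilon>"
      by (rule \<delta>(2)[OF fock_bounded_linear_D(1)[OF T g]])
  qed
qed

text \<open>Types are nonempty, so \<phi> cannot become an operator into functions of no variables;
  it is sent to functions of one dummy variable on which nothing depends. After composition the
  dummy variable is set to 1, a point of the open half-plane, which recovers the function attached
  to the composed functional.\<close>

lemma lee_yang_functional_comp:
  fixes \<alpha> :: "real ^ 'n::finite" and \<beta> :: "real ^ 'm::finite"
  assumes \<alpha>: "\<forall>i. \<alpha> $ i > 0" and \<beta>: "\<forall>i. \<beta> $ i > 0"
    and \<phi>: "lee_yang_functional \<beta> \<phi>" and T: "lee_yang_operator \<alpha> \<beta> T"
  shows "lee_yang_functional \<alpha> (\<phi> \<circ> T)"
proof -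
  \<comment> \<open>Any positive weight would do, as a constant has the same norm in all these
    spaces.\<close>
  define \<gamma> :: "real ^ 1" where "\<gamma> = (\<chi> i. 1)"
  define S :: "(complex ^ 'm \<Rightarrow> complex) \<Rightarrow> (complex ^ 1 \<Rightarrow> complex)" where "S = (\<lambda>f _. \<phi> f)"
  have \<gamma>: "\<forall>i. \<gamma> $ i > 0" by (simp add: \<gamma>_def)
  have bT: "fock_bounded_linear \<alpha> \<beta> T"
    using T by (simp add: lee_yang_operator_def)
  have c\<phi>: "fock_continuous_functional \<beta> \<phi>"
    using \<phi> by (simp add: lee_yang_functional_def)
  obtain C where "fock_bounded_functional \<beta> C \<phi>"
    using fock_continuous_functional_bounded[OF \<beta> c\<phi>] by blast
  hence bS: "fock_bounded_linear \<beta> \<gamma> S"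
    unfolding S_def by (rule fock_bounded_linear_const)
  have sym: "symbol S v = \<phi> (\<lambda>z. exp (dotc z (\<chi> i. v $ Inr i)))" for v
    by (simp add: symbol_def S_def)
  have entS: "entire (symbol S)"
    unfolding entire_def by (rule exI) (rule symbol_has_power_series[OF \<beta> \<gamma> bS])
  have "(\<lambda>v :: complex ^ (1 + 'm). (\<lambda>w. \<phi> (\<lambda>z. exp (dotc z w))) (\<chi> i. v $ Inr i)) \<in> LY"
  proof (rule LY_subst)
    show "(\<lambda>w. \<phi> (\<lambda>z. exp (dotc z w))) \<in> LY"
      using \<phi> by (simp add: lee_yang_functional_def)
    show "entire (\<lambda>v :: complex ^ (1 + 'm). \<phi> (\<lambda>z. exp (dotc z (\<chi> i. v $ Inr i))))"
      using entS by (simp add: sym[abs_def])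
  qed (auto simp: polynomial_fun_coord)
  hence "lee_yang_operator \<beta> \<gamma> S"
    using bS by (simp add: lee_yang_operator_def sym[abs_def])
  hence ST: "symbol (S \<circ> T) \<in> LY"
    using lee_yang_operator_comp[OF \<alpha> \<beta> \<gamma> T] by (simp add: lee_yang_operator_def)
  have c\<phi>T: "fock_continuous_functional \<alpha> (\<phi> \<circ> T)"
    by (rule fock_continuous_functional_comp[OF \<alpha> \<beta> bT c\<phi>])
  obtain D where D: "fock_bounded_functional \<alpha> D (\<phi> \<circ> T)"
    using fock_continuous_functional_bounded[OF \<alpha> c\<phi>T] by blast
  define g :: "1 + 'n \<Rightarrow> complex ^ 'n \<Rightarrow> complex"
    where "g = (\<lambda>i w. case_sum (\<lambda>_. 1) (\<lambda>i. w $ i) i)"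
  have eq: "symbol (S \<circ> T) (\<chi> i :: 1 + 'n. g i w) = (\<phi> \<circ> T) (\<lambda>z. exp (dotc z w))" for w
    by (simp add: symbol_def S_def g_def)
  have "has_power_series (\<lambda>w. (\<phi> \<circ> T) (\<lambda>z. exp (dotc z w)))
      (\<lambda>\<xi>. (\<phi> \<circ> T) (\<lambda>z. mindex_power z \<xi>) / of_real (mindex_fact \<xi>))"
    unfolding has_power_series_def
  proof
    fix w
    show "((\<lambda>\<xi>. (\<phi> \<circ> T) (\<lambda>z. mindex_power z \<xi>) / of_real (mindex_fact \<xi>) * mindex_power w \<xi>)
        has_sum (\<phi> \<circ> T) (\<lambda>z. exp (dotc z w))) UNIV"
      using functional_has_sum[OF \<alpha> D exp_dotc_in_fock_space[OF \<alpha>, of w]]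
      by (simp add: power_series_coeff_eq[OF has_power_series_exp_dotc] mult_ac)
  qed
  hence ent: "entire (\<lambda>w. (\<phi> \<circ> T) (\<lambda>z. exp (dotc z w)))"
    unfolding entire_def by blast
  have "(\<lambda>w. symbol (S \<circ> T) (\<chi> i :: 1 + 'n. g i w)) \<in> LY"
  proof (rule LY_subst[OF ST])
    show "polynomial_fun (g i)" for i
      by (cases i) (simp_all add: g_def polynomial_fun_coord polynomial_fun_const)
    show "Re (g i w) > 0" if "\<forall>j. Re (w $ j) > 0" for w i
      using that by (cases i) (simp_all add: g_def)
    show "entire (\<lambda>w. symbol (S \<circ> T) (\<chi> i :: 1 + 'n. g i w))"
      using ent unfolding eq .
  qed
  thus ?thesis
    using c\<phi>T unfolding eq lee_yang_functional_def by blast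
qed

theorem theorem4p5:
  fixes \<alpha> :: "real ^ ('n::finite)" and \<beta> :: "real ^ ('m::finite)" and \<gamma> :: "real ^ ('k::finite)"
  assumes "\<forall>i. \<alpha> $ i > 0" and "\<forall>i. \<beta> $ i > 0" and "\<forall>i. \<gamma> $ i > 0"
  shows "(\<forall>(T :: (complex ^ 'n \<Rightarrow> complex) \<Rightarrow> (complex ^ 'm \<Rightarrow> complex))
            (S :: (complex ^ 'm \<Rightarrow> complex) \<Rightarrow> (complex ^ 'k \<Rightarrow> complex)).
            lee_yang_operator \<alpha> \<beta> T \<longrightarrow> lee_yang_operator \<beta> \<gamma> S \<longrightarrow>
            lee_yang_operator \<alpha> \<gamma> (S \<circ> T)) \<and>
         (\<forall>(\<phi> :: (complex ^ 'm \<Rightarrow> complex) \<Rightarrow> complex)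
            (T :: (complex ^ 'n \<Rightarrow> complex) \<Rightarrow> (complex ^ 'm \<Rightarrow> complex)).
            lee_yang_functional \<beta> \<phi> \<longrightarrow> lee_yang_operator \<alpha> \<beta> T \<longrightarrow>
            lee_yang_functional \<alpha> (\<phi> \<circ> T))"
  using lee_yang_operator_comp[OF assms] lee_yang_functional_comp[OF assms(1,2)] by blast

end
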